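(* Let $P$ be the linear Landau-type operator $$P= iv\cdot D_x+ D_v\cdot\lambda(v)D_{v}+(v \wedge D_v)\cdot\mu(v) (v \wedge D_v)+F(v), \quad x,v \in \mathbb{R}^{3},$$ where $\gamma\in[-3,1]$ and $\lambda,\mu,F$ are smooth positive functions on $\mathbb{R}^3$ such that for all $\alpha\in\mathbb{N}^3$ there is $C_\alpha>0$ with, for all $v\in\mathbb{R}^3$, $|\partial_v^{\alpha}\lambda(v)| +|\partial_v^{\alpha}\mu(v)| \leq C_{\alpha} \langle v \rangle^{\gamma-|\alpha|}$ and $|\partial_v^{\alpha}F(v)| \leq C_{\alpha} \langle v \rangle^{\gamma+2-|\alpha|}$; and such that there is $c>0$ with, for all $v\in\mathbb{R}^3$, $\lambda(v) \geq c \langle v \rangle^{\gamma}$, $\mu(v) \geq c \langle v \rangle^{\gamma}$, $F(v) \geq c \langle v \rangle^{\gamma+2}$. Then there exists a positive constant $C > 0$ such that for all $u \in \mathcal{S}(\mathbb{R}^{6}_{x,v})$, $$\|\langle v \rangle^{\gamma +2} u\|_{L^2}^2 + \|\langle v \rangle^{\gamma} |D_v|^{2} u \|_{L^2}^2 + \| \langle v \rangle^{\gamma} |v \wedge D_v|^{2} u \|_{L^2}^2 + \|\langle v\rangle^{\gamma/3} |D_x|^{2/3} u \|_{L^2}^2 + \|\langle v\rangle^{\gamma/3} |v \wedge D_x|^{2/3} u \|_{L^2}^2 \leq C (\|Pu\|_{L^2}^2 + \|u\|_{L^2}^2),$$ where $\|\cdot\|_{L^2}$ is the $L^2(\mathb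b{R}^6_{x,v})$-norm.
   Context: Notation: $D_x=i^{-1}\partial_x$, $D_v=i^{-1}\partial_v$, $\langle v\rangle=(1+|v|^2)^{1/2}$, and $\wedge$ is the cross product in $\mathbb{R}^3$. Here $v\wedge D_v=(v_2D_{v_3}-v_3D_{v_2},\,v_3D_{v_1}-v_1D_{v_3},\,v_1D_{v_2}-v_2D_{v_1})=:(Q_1,Q_2,Q_3)$, so $D_v\cdot\lambda D_v=\sum_j D_{v_j}\lambda(v)D_{v_j}$, $(v\wedge D_v)\cdot\mu(v)(v\wedge D_v)=\sum_j Q_j\mu(v)Q_j$, $|D_v|^2=\sum_jD_{v_j}^2$ and $|v\wedge D_v|^2=\sum_jQ_j^2$. The operators $|D_x|^{2/3}$ and $|v\wedge D_x|^{2/3}$ are the Fourier multipliers in the $x$ variable (with dual variable $\xi$) by $|\xi|^{2/3}$ and by $|v\wedge\xi|^{2/3}$ (for each fixed $v$), respectively. *)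

theory Defs
  imports "HOL-Analysis.Analysis"
begin

section \<open>Iterated partial derivatives, smooth and Schwartz functions\<close>

definition partial :: "'a \<Rightarrow> ('a::euclidean_space \<Rightarrow> 'b::real_normed_vector) \<Rightarrow> 'a \<Rightarrow> 'b"
  where "partial b f z = frechet_derivative f (at z) b"

primrec partials :: "'a list \<Rightarrow> ('a::euclidean_space \<Rightarrow> 'b::real_normed_vector) \<Rightarrow> 'a \<Rightarrow> 'b"
  where
    "partials [] f = f"
  | "partials (b # bs) f = partial b (partials bs f)"

text \<open>
  \<open>C\<^sup>\<infinity>\<close>: all iterated partial derivatives in the coordinate directions exist and are (totally)
  differentiable, hence continuous.  A word of basis vectors plays the role of a multi-index; for
  such functions the order of differentiation is irrelevant.
\<close>
definition smooth :: "('a::euclidean_space \<Rightarrow> 'b::real_normed_vector) \<Rightarrow> bool"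
  where "smooth f \<longleftrightarrow> (\<forall>bs. set bs \<subseteq> Basis \<longrightarrow> (\<forall>z. partials bs f differentiable (at z)))"

definition schwartz :: "('a::euclidean_space \<Rightarrow> complex) \<Rightarrow> bool"
  where "schwartz f \<longleftrightarrow> smooth f \<and>
    (\<forall>k::nat. \<forall>bs. set bs \<subseteq> Basis \<longrightarrow>
      (\<exists>B. \<forall>z. (1 + norm z) ^ k * norm (partials bs f z) \<le> B))"

definition multi_order :: "nat^3 \<Rightarrow> nat"
  where "multi_order \<alpha> = (\<Sum>j\<in>UNIV. \<alpha> $ j)"

definition multi_partial :: "nat^3 \<Rightarrow> (real^3 \<Rightarrow> 'b::real_normed_vector) \<Rightarrow> real^3 \<Rightarrow> 'b"
  where "multi_partial \<alpha> f =
    partials (replicate (\<alpha> $ 1) (axis 1 1) @ replicate (\<alpha> $ 2) (axis 2 1)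
      @ replicate (\<alpha> $ 3) (axis 3 1)) f"

definition bracket :: "real^3 \<Rightarrow> real"
  where "bracket v = sqrt (1 + (norm v)\<^sup>2)"


section \<open>Differential operators in phase space\<close>

text \<open>A point of \<open>\<real>\<^sup>6\<close> is a pair \<open>(x, v)\<close>.\<close>

type_synonym phase = "(real^3) \<times> (real^3)"

definition Dx :: "3 \<Rightarrow> (phase \<Rightarrow> complex) \<Rightarrow> phase \<Rightarrow> complex"
  where "Dx j u z = inverse \<i> * partial (axis j 1, 0) u z"

definition Dv :: "3 \<Rightarrow> (phase \<Rightarrow> complex) \<Rightarrow> phase \<Rightarrow> complex"
  where "Dv j u z = inverse \<i> * partial (0, axis j 1) u z"

definition mult_v :: "(real^3 \<Rightarrow> real) \<Rightarrow> (phase \<Rightarrow> complex) \<Rightarrow> phase \<Rightarrow> complex"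
  where "mult_v a u = (\<lambda>(x, v). complex_of_real (a v) * u (x, v))"

text \<open>The components \<open>Q\<^sub>j\<close> of the rotation field \<open>v \<and> D\<^sub>v\<close>.\<close>

definition Q :: "3 \<Rightarrow> (phase \<Rightarrow> complex) \<Rightarrow> phase \<Rightarrow> complex"
  where "Q j u z = (vector
    [mult_v (\<lambda>v. v $ 2) (Dv 3 u) z - mult_v (\<lambda>v. v $ 3) (Dv 2 u) z,
     mult_v (\<lambda>v. v $ 3) (Dv 1 u) z - mult_v (\<lambda>v. v $ 1) (Dv 3 u) z,
     mult_v (\<lambda>v. v $ 1) (Dv 2 u) z - mult_v (\<lambda>v. v $ 2) (Dv 1 u) z]
      :: complex^3) $ j"

definition Dv_sq :: "(phase \<Rightarrow> complex) \<Rightarrow> phase \<Rightarrow> complex"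
  where "Dv_sq u z = (\<Sum>j\<in>UNIV. Dv j (Dv j u) z)"

definition Q_sq :: "(phase \<Rightarrow> complex) \<Rightarrow> phase \<Rightarrow> complex"
  where "Q_sq u z = (\<Sum>j\<in>UNIV. Q j (Q j u) z)"

definition landau_op ::
    "(real^3 \<Rightarrow> real) \<Rightarrow> (real^3 \<Rightarrow> real) \<Rightarrow> (real^3 \<Rightarrow> real) \<Rightarrow> (phase \<Rightarrow> complex) \<Rightarrow> phase \<Rightarrow> complex"
  where "landau_op lam mu F u z =
      \<i> * (\<Sum>j\<in>UNIV. mult_v (\<lambda>v. v $ j) (Dx j u) z)
    + (\<Sum>j\<in>UNIV. Dv j (mult_v lam (Dv j u)) z)
    + (\<Sum>j\<in>UNIV. Q j (mult_v mu (Q j u)) z)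
    + mult_v F u z"


section \<open>Fourier multipliers in the space variable\<close>

definition fourier_x :: "(phase \<Rightarrow> complex) \<Rightarrow> real^3 \<Rightarrow> real^3 \<Rightarrow> complex"
  where "fourier_x u \<xi> v = (LINT x|lborel. cis (- (x \<bullet> \<xi>)) * u (x, v))"

text \<open>
  The symbol \<open>m v \<xi>\<close> may depend on the parameter \<open>v\<close>.  For Schwartz \<open>u\<close> and symbols of polynomial
  growth in \<open>\<xi>\<close> the integrand of the inversion formula is integrable.
\<close>
definition fourier_mult_x ::
    "(real^3 \<Rightarrow> real^3 \<Rightarrow> real) \<Rightarrow> (phase \<Rightarrow> complex) \<Rightarrow> phase \<Rightarrow> complex"
  where "fourier_mult_x m u = (\<lambda>(x, v). complex_of_real (1 / (2 * pi) ^ 3) *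
    (LINT \<xi>|lborel. cis (x \<bullet> \<xi>) * complex_of_real (m v \<xi>) * fourier_x u \<xi> v))"

definition Dx_two_thirds :: "(phase \<Rightarrow> complex) \<Rightarrow> phase \<Rightarrow> complex"
  where "Dx_two_thirds = fourier_mult_x (\<lambda>v \<xi>. norm \<xi> powr (2/3))"

definition v_cross_Dx_two_thirds :: "(phase \<Rightarrow> complex) \<Rightarrow> phase \<Rightarrow> complex"
  where "v_cross_Dx_two_thirds = fourier_mult_x (\<lambda>v \<xi>. norm (cross3 v \<xi>) powr (2/3))"


section \<open>The squared norm of the space of square-integrable functions\<close>

text \<open>
  Valued in \<open>[0, \<infinity>]\<close>, so that a function which is not square-integrable has norm \<open>\<infinity>\<close>, and not
  \<open>0\<close> as the Bochner integral would give.
\<close>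
definition L2_norm_sq :: "(phase \<Rightarrow> complex) \<Rightarrow> ennreal"
  where "L2_norm_sq f = (\<integral>\<^sup>+ z. ennreal ((cmod (f z))\<^sup>2) \<partial>lborel)"

end

theory Submission
  imports Defs "HOL-Probability.Probability"
begin

text \<open>
  A partial Fourier transform in \<open>x\<close> replaces \<open>iv \<cdot> D\<^sub>x\<close> by the multiplication by \<open>iv \<cdot> \<xi>\<close>, so by Plancherel's
  formula it suffices to prove an estimate on \<open>\<real>\<^sup>3\<close>, uniformly in \<open>\<xi> \<noteq> 0\<close>, for \<open>G = A f + iV f\<close> with \<open>V = v \<cdot> \<xi>\<close>
  and the elliptic part \<open>A\<close>.  Let \<open>T\<^sub>\<alpha>\<close> be the six fields \<open>\<nabla>\<close> and \<open>v \<and> \<nabla>\<close>, let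
  \<open>m\<^sup>2 = |\<xi>|\<^sup>2 + |v \<and> \<xi>|\<^sup>2 = \<Sum> (T\<^sub>\<alpha> V)\<^sup>2\<close> and \<open>phi = \<langle>v\<rangle>\<^bsup>\<gamma>/3\<^esup> m\<^bsup>2/3\<^esup>\<close>.

  Pairing \<open>G\<close> with \<open>\<langle>v\<rangle>\<^bsup>\<gamma>+2\<^esup> f\<close> controls \<open>\<parallel>\<langle>v\<rangle>\<^bsup>\<gamma>+2\<^esup> f\<parallel>\<close> and \<open>\<parallel>\<langle>v\<rangle>\<^bsup>\<gamma>+1\<^esup> T\<^sub>\<alpha> f\<parallel>\<close> by \<open>q = \<parallel>G\<parallel> + \<parallel>f\<parallel>\<close>.  Three
  quantities remain: \<open>X = \<parallel>phi f\<parallel>\<close>, \<open>Y = \<parallel>A f\<parallel>\<close> and \<open>Z\<close>, the norm of the \<open>T\<^sub>\<alpha> f\<close> with weight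
  \<open>\<langle>v\<rangle>\<^bsup>2\<gamma>/3\<^esup> m\<^bsup>1/3\<^esup>\<close>.  Pairing with \<open>phi f\<close> gives \<open>Z\<^sup>2 \<lesssim> q X\<close>; expanding \<open>\<parallel>A f + iV f\<parallel>\<^sup>2\<close> gives
  \<open>Y\<^sup>2 \<lesssim> q\<^sup>2 + X Z\<close>; pairing with \<open>\<langle>v\<rangle>\<^bsup>2\<gamma>/3\<^esup> m\<^bsup>-2/3\<^esup> \<Sum> (T\<^sub>\<alpha> V) T\<^sub>\<alpha> f\<close>, whose commutator with \<open>V\<close> is \<open>phi\<^sup>2\<close>, gives
  \<open>X\<^sup>2 \<lesssim> (q + Y) Z\<close>.  These three inequalities force \<open>X, Y \<lesssim> q\<close>.  Elliptic regularity for \<open>A\<close> then bounds the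
  second derivatives, because rotations commute with the Laplacian.
\<close>

section \<open>Rapidly decreasing functions\<close>

text \<open>The weights are forced. Let omega be the weight of the commutator multiplier and psi
  that of the first derivatives. The multiplier should have size psi and its commutator with V size
  phi^2, so omega m = psi and omega m^2 = phi^2; the energy identity with weight phi controls first
  derivatives with psi^2 = <v>^\<gamma> phi. Eliminating omega and psi gives phi^3 = <v>^\<gamma>
  m^2, the origin of the exponents \<gamma>/3 and 2/3. The failure of orthogonality between the
  elliptic and the transport part has size <v>^\<gamma> m = phi psi, so it fits the same scheme.

  The obstacle is the unbounded length of the rotation fields: differentiating a power of m along a
  field may cost a factor <v>. In the energy identity the loss is squared and gives
  <v>^(\<gamma>+2), exactly the strength of the zero-order term F. Hence the bound with weight
  <v>^(\<gamma>+2) must be available before the weight phi is tried.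

  All multipliers are differential operators of order at most one with explicit coefficients. Each
  estimate can therefore be checked pointwise, up to field derivatives of rapidly decreasing
  functions, whose integrals vanish.\<close>

lemma partial_eqI: "(f has_derivative f') (at z) \<Longrightarrow> partial b f z = f' b"
  unfolding partial_def by (simp add: frechet_derivative_at[symmetric])

lemma has_derivative_partial:
  "f differentiable (at z) \<Longrightarrow> (f has_derivative (\<lambda>b. partial b f z)) (at z)"
  unfolding partial_def using frechet_derivative_works by blast

lemma linear_partial: "f differentiable (at z) \<Longrightarrow> linear (\<lambda>b. partial b f z)"
  using has_derivative_partial has_derivative_linear by blast

lemma partial_sum_Basis:
  assumes "f differentiable (at z)"
  shows "partial w f z = (\<Sum>b\<in>Basis. (w \<bullet> b) *\<^sub>R partial b f z)"
proof -
  have "partial w f z = partial (\<Sum>b\<in>Basis. (w \<bullet> b) *\<^sub>R b) f z"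
    by (simp add: euclidean_representation)
  also have "\<dots> = (\<Sum>b\<in>Basis. (w \<bullet> b) *\<^sub>R partial b f z)"
    by (simp add: linear_sum[OF linear_partial[OF assms]] linear_cmul[OF linear_partial[OF assms]])
  finally show ?thesis .
qed

lemma partial_add:
  "f differentiable (at z) \<Longrightarrow> g differentiable (at z) \<Longrightarrow>
    partial b (\<lambda>z. f z + g z) z = partial b f z + partial b g z"
  by (rule partial_eqI) (auto intro!: derivative_eq_intros has_derivative_partial)

lemma partial_sum:
  "(\<And>i. i \<in> I \<Longrightarrow> f i differentiable (at z)) \<Longrightarrow>
    partial b (\<lambda>z. \<Sum>i\<in>I. f i z) z = (\<Sum>i\<in>I. partial b (f i) z)"
  by (rule partial_eqI) (auto intro!: derivative_eq_intros has_derivative_partial)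

lemma partial_scaleR:
  "f differentiable (at z) \<Longrightarrow> g differentiable (at z) \<Longrightarrow>
    partial b (\<lambda>z. f z *\<^sub>R g z) z = f z *\<^sub>R partial b g z + partial b f z *\<^sub>R g z"
  by (rule partial_eqI) (auto intro!: derivative_eq_intros has_derivative_partial)

lemma partial_mult:
  fixes f g :: "'a::euclidean_space \<Rightarrow> 'b::real_normed_algebra"
  shows "f differentiable (at z) \<Longrightarrow> g differentiable (at z) \<Longrightarrow>
    partial b (\<lambda>z. f z * g z) z = f z * partial b g z + partial b f z * g z"
  by (rule partial_eqI) (auto intro!: derivative_eq_intros has_derivative_partial)

lemma partial_cmult:
  fixes g :: "'a::euclidean_space \<Rightarrow> 'b::real_normed_algebra"
  shows "g differentiable (at z) \<Longrightarrow> partial b (\<lambda>z. c * g z) z = c * partial b g z"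
  by (rule partial_eqI) (auto intro!: derivative_eq_intros has_derivative_partial)

lemma partial_inner:
  "f differentiable (at z) \<Longrightarrow> g differentiable (at z) \<Longrightarrow>
    partial b (\<lambda>z. f z \<bullet> g z) z = f z \<bullet> partial b g z + partial b f z \<bullet> g z"
  by (rule partial_eqI) (auto intro!: derivative_eq_intros has_derivative_partial)

lemma partial_bounded_bilinear:
  assumes "bounded_bilinear p" "f differentiable (at z)" "g differentiable (at z)"
  shows "partial b (\<lambda>z. p (f z) (g z)) z = p (f z) (partial b g z) + p (partial b f z) (g z)"
  by (rule partial_eqI, rule bounded_bilinear.FDERIV[OF assms(1)])
    (use assms in \<open>auto intro!: has_derivative_partial\<close>)

text \<open>\<open>rapid1\<close> and \<open>slow1\<close> record one derivative. The energy
  identities differentiate products of Schwartz functions with coefficients and real powers of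
  weights, and tracking first derivatives replaces a proof that each such product is again
  Schwartz.\<close>

definition rapid :: "('a::euclidean_space \<Rightarrow> 'b::real_normed_vector) \<Rightarrow> bool" where
  "rapid g \<longleftrightarrow> continuous_on UNIV g \<and> (\<forall>k. \<exists>B. \<forall>z. (1 + norm z) ^ k * norm (g z) \<le> B)"

definition slow :: "('a::euclidean_space \<Rightarrow> 'b::real_normed_vector) \<Rightarrow> bool" where
  "slow g \<longleftrightarrow> continuous_on UNIV g \<and> (\<exists>k B. \<forall>z. norm (g z) \<le> B * (1 + norm z) ^ k)"

definition rapid1 :: "('a::euclidean_space \<Rightarrow> 'b::real_normed_vector) \<Rightarrow> bool" where
  "rapid1 g \<longleftrightarrow> (\<forall>z. g differentiable (at z)) \<and> rapid g \<and> (\<forall>b\<in>Basis. rapid (partial b g))"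

definition slow1 :: "('a::euclidean_space \<Rightarrow> 'b::real_normed_vector) \<Rightarrow> bool" where
  "slow1 g \<longleftrightarrow> (\<forall>z. g differentiable (at z)) \<and> slow g \<and> (\<forall>b\<in>Basis. slow (partial b g))"

lemma rapidD: "rapid g \<Longrightarrow> \<exists>B>0. \<forall>z. (1 + norm z) ^ k * norm (g z) \<le> B"
proof -
  assume "rapid g"
  then obtain B where "\<forall>z. (1 + norm z) ^ k * norm (g z) \<le> B"
    unfolding rapid_def by blast
  then have "\<forall>z. (1 + norm z) ^ k * norm (g z) \<le> max B 1"
    by (meson max.coboundedI1)
  then show ?thesis by (intro exI[of _ "max B 1"]) simp
qed

lemma slowD: "slow g \<Longrightarrow> \<exists>k B. B > 0 \<and> (\<forall>z. norm (g z) \<le> B * (1 + norm z) ^ k)"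
proof -
  assume "slow g"
  then obtain k B where B: "\<forall>z. norm (g z) \<le> B * (1 + norm z) ^ k"
    unfolding slow_def by blast
  have "norm (g z) \<le> max B 1 * (1 + norm z) ^ k" for z
    using B[rule_format, of z] mult_right_mono[of B "max B 1" "(1 + norm z) ^ k"] by simp
  then show ?thesis by (intro exI[of _ k] exI[of _ "max B 1"]) simp
qed

lemma rapid_imp_slow: "rapid g \<Longrightarrow> slow g"
  unfolding rapid_def slow_def by (metis mult.right_neutral mult_1 power_0)

section \<open>Closure of rapid and slow functions under products, sums and derivatives\<close>

lemma slow_bounded_bilinear:
  assumes "bounded_bilinear p" "slow f" "slow g"
  shows "slow (\<lambda>z. p (f z) (g z))"
proof -
  interpret bounded_bilinear p by fact
  obtain K where K: "K > 0" "\<And>a b. norm (p a b) \<le> norm a * norm b * K" using pos_bounded by blast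
  obtain k1 B1 where 1: "B1 > 0" "\<forall>z. norm (f z) \<le> B1 * (1 + norm z) ^ k1" using slowD assms by blast
  obtain k2 B2 where 2: "B2 > 0" "\<forall>z. norm (g z) \<le> B2 * (1 + norm z) ^ k2" using slowD assms by blast
  have "norm (p (f z) (g z)) \<le> (B1 * B2 * K) * (1 + norm z) ^ (k1 + k2)" for z
  proof -
    have "norm (p (f z) (g z)) \<le> norm (f z) * norm (g z) * K" by (rule K)
    also have "\<dots> \<le> (B1 * (1 + norm z) ^ k1) * (B2 * (1 + norm z) ^ k2) * K"
      using 1 2 K by (intro mult_mono) auto
    finally show ?thesis by (simp add: power_add ac_simps)
  qed
  moreover have "continuous_on UNIV (\<lambda>z. p (f z) (g z))"
    using assms unfolding slow_def by (intro continuous_on) auto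
  ultimately show ?thesis unfolding slow_def by blast
qed

text \<open>A general bilinear map serves scaling, multiplication and inner products at once. For
  order k of the product, the rapid factor is asked for order k + k1, which pays for the growth of
  the slow factor.\<close>

lemma rapid_bounded_bilinear:
  assumes "bounded_bilinear p" "slow f" "rapid g"
  shows "rapid (\<lambda>z. p (f z) (g z))"
proof -
  interpret bounded_bilinear p by fact
  obtain K where K: "K > 0" "\<And>a b. norm (p a b) \<le> norm a * norm b * K" using pos_bounded by blast
  obtain k1 B1 where 1: "B1 > 0" "\<forall>z. norm (f z) \<le> B1 * (1 + norm z) ^ k1" using slowD assms by blast
  have "\<exists>B. \<forall>z. (1 + norm z) ^ k * norm (p (f z) (g z)) \<le> B" for k
  proof -
    obtain B2 where 2: "\<forall>z. (1 + norm z) ^ (k + k1) * norm (g z) \<le> B2" using rapidD assms by blast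
    have "(1 + norm z) ^ k * norm (p (f z) (g z)) \<le> B1 * K * B2" for z
    proof -
      have "norm (p (f z) (g z)) \<le> norm (f z) * norm (g z) * K" by (rule K)
      also have "\<dots> \<le> (B1 * (1 + norm z) ^ k1) * norm (g z) * K"
        using 1 K by (intro mult_right_mono) auto
      finally have "(1 + norm z) ^ k * norm (p (f z) (g z)) \<le>
          (1 + norm z) ^ k * ((B1 * (1 + norm z) ^ k1) * norm (g z) * K)"
        by (intro mult_left_mono) auto
      also have "\<dots> = B1 * K * ((1 + norm z) ^ (k + k1) * norm (g z))"
        by (simp add: power_add ac_simps)
      also have "\<dots> \<le> B1 * K * B2" using 1 2 K by (intro mult_left_mono) auto
      finally show ?thesis .
    qed
    then show ?thesis by blast
  qed
  moreover have "continuous_on UNIV (\<lambda>z. p (f z) (g z))"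
    using assms unfolding slow_def rapid_def by (intro continuous_on) auto
  ultimately show ?thesis unfolding rapid_def by blast
qed

lemma slow_const [simp]: "slow (\<lambda>z. c)"
  unfolding slow_def by (auto intro!: exI[of _ 0] exI[of _ "norm c"])

lemma slow_bounded_linear:
  assumes "bounded_linear L" shows "slow L"
proof -
  obtain K where K: "K > 0" "\<And>x. norm (L x) \<le> norm x * K"
    using bounded_linear.pos_bounded[OF assms] by blast
  have "norm (L z) \<le> K * (1 + norm z) ^ 1" for z
    using K(2)[of z] K(1) by (simp add: algebra_simps)
  moreover have "continuous_on UNIV L" by (simp add: assms linear_continuous_on)
  ultimately show ?thesis unfolding slow_def by blast
qed

lemma slow_add:
  assumes "slow f" "slow g" shows "slow (\<lambda>z. f z + g z)"
proof -
  obtain k1 B1 where 1: "B1 > 0" "\<forall>z. norm (f z) \<le> B1 * (1 + norm z) ^ k1" using slowD assms by blast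
  obtain k2 B2 where 2: "B2 > 0" "\<forall>z. norm (g z) \<le> B2 * (1 + norm z) ^ k2" using slowD assms by blast
  have "norm (f z + g z) \<le> (B1 + B2) * (1 + norm z) ^ (k1 + k2)" for z
  proof -
    have "norm (f z + g z) \<le> norm (f z) + norm (g z)" by (rule norm_triangle_ineq)
    also have "\<dots> \<le> B1 * (1 + norm z) ^ (k1 + k2) + B2 * (1 + norm z) ^ (k1 + k2)"
      using 1 2 by (intro add_mono) (meson order_trans mult_left_mono power_increasing
        le_add1 le_add2 less_imp_le norm_ge_zero le_add_same_cancel1)+
    finally show ?thesis by (simp add: algebra_simps)
  qed
  then show ?thesis using assms unfolding slow_def by (blast intro: continuous_on_add)
qed

lemma rapid_zero [simp]: "rapid (\<lambda>z. 0)"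
  unfolding rapid_def by auto

lemma rapid_add:
  assumes "rapid f" "rapid g" shows "rapid (\<lambda>z. f z + g z)"
proof -
  have "\<exists>B. \<forall>z. (1 + norm z) ^ k * norm (f z + g z) \<le> B" for k
  proof -
    obtain B1 where 1: "\<forall>z. (1 + norm z) ^ k * norm (f z) \<le> B1" using rapidD assms by blast
    obtain B2 where 2: "\<forall>z. (1 + norm z) ^ k * norm (g z) \<le> B2" using rapidD assms by blast
    have "(1 + norm z) ^ k * norm (f z + g z) \<le> B1 + B2" for z
    proof -
      have "(1 + norm z) ^ k * norm (f z + g z) \<le> (1 + norm z) ^ k * (norm (f z) + norm (g z))"
        by (intro mult_left_mono norm_triangle_ineq) auto
      also have "\<dots> \<le> B1 + B2" using 1 2 by (simp add: distrib_left add_mono)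
      finally show ?thesis .
    qed
    then show ?thesis by blast
  qed
  then show ?thesis using assms unfolding rapid_def by (auto intro: continuous_on_add)
qed

lemmas rapid_scaleR = rapid_bounded_bilinear[OF bounded_bilinear_scaleR]
  and rapid_mult = rapid_bounded_bilinear[OF bounded_bilinear_mult]
  and slow_scaleR = slow_bounded_bilinear[OF bounded_bilinear_scaleR]
  and slow_inner = slow_bounded_bilinear[OF bounded_bilinear_inner]
  and slow_mult = slow_bounded_bilinear[OF bounded_bilinear_mult]

lemma rapid_cmult: "rapid g \<Longrightarrow> rapid (\<lambda>z. c * g z)" for g :: "'a::euclidean_space \<Rightarrow> 'b::real_normed_algebra"
  by (rule rapid_mult[OF slow_const])

lemma rapid_minus: "rapid g \<Longrightarrow> rapid (\<lambda>z. - g z)"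
  using rapid_scaleR[OF slow_const, of g "-1"] by simp

lemma slow_minus: "slow g \<Longrightarrow> slow (\<lambda>z. - g z)"
  using slow_scaleR[OF slow_const, of g "-1"] by simp

lemma rapid_sum: "(\<And>i. i \<in> I \<Longrightarrow> rapid (f i)) \<Longrightarrow> rapid (\<lambda>z. \<Sum>i\<in>I. f i z)"
  by (induction I rule: infinite_finite_induct) (auto intro: rapid_add)

lemma slow_sum: "(\<And>i. i \<in> I \<Longrightarrow> slow (f i)) \<Longrightarrow> slow (\<lambda>z. \<Sum>i\<in>I. f i z)"
  by (induction I rule: infinite_finite_induct) (auto intro: slow_add)

lemma rapid_norm: "rapid g \<Longrightarrow> rapid (\<lambda>z. norm (g z))"
  unfolding rapid_def by (auto intro: continuous_on_norm)

lemma rapid_norm_sq: "rapid g \<Longrightarrow> rapid (\<lambda>z. (norm (g z))\<^sup>2)"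
  unfolding power2_eq_square by (intro rapid_mult rapid_imp_slow rapid_norm)

lemma rapid1D: "rapid1 g \<Longrightarrow> g differentiable (at z)" "rapid1 g \<Longrightarrow> rapid g"
    "rapid1 g \<Longrightarrow> b \<in> Basis \<Longrightarrow> rapid (partial b g)"
  and slow1D: "slow1 h \<Longrightarrow> h differentiable (at z)" "slow1 h \<Longrightarrow> slow h"
    "slow1 h \<Longrightarrow> b \<in> Basis \<Longrightarrow> slow (partial b h)"
  unfolding rapid1_def slow1_def by auto

text \<open>The direction may vary with the point and grow, as the rotation fields do; expanding it
  in the basis turns its components into slow factors.\<close>

lemma rapid_partial:
  assumes "rapid1 g" "slow s" shows "rapid (\<lambda>z. partial (s z) g z)"
proof -
  have "(\<lambda>z. partial (s z) g z) = (\<lambda>z. \<Sum>b\<in>Basis. (s z \<bullet> b) *\<^sub>R partial b g z)"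
    using partial_sum_Basis rapid1D(1)[OF assms(1)] by blast
  then show ?thesis
    using assms by (simp, intro rapid_sum rapid_scaleR slow_inner) (auto intro: rapid1D)
qed

lemma slow_partial:
  assumes "slow1 g" "slow s" shows "slow (\<lambda>z. partial (s z) g z)"
proof -
  have "(\<lambda>z. partial (s z) g z) = (\<lambda>z. \<Sum>b\<in>Basis. (s z \<bullet> b) *\<^sub>R partial b g z)"
    using partial_sum_Basis slow1D(1)[OF assms(1)] by blast
  then show ?thesis
    using assms by (simp, intro slow_sum slow_scaleR slow_inner) (auto intro: slow1D)
qed

lemma rapid1_imp_slow1: "rapid1 g \<Longrightarrow> slow1 g"
  unfolding rapid1_def slow1_def by (auto intro: rapid_imp_slow)

lemma slow1_bounded_bilinear:
  assumes "bounded_bilinear p" "slow1 f" "slow1 g"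
  shows "slow1 (\<lambda>z. p (f z) (g z))"
proof -
  have "(\<lambda>z. p (f z) (g z)) differentiable (at z)" for z
    using bounded_bilinear.FDERIV[OF assms(1)] slow1D(1)[OF assms(2), of z] slow1D(1)[OF assms(3), of z]
    unfolding differentiable_def by blast
  moreover have "partial b (\<lambda>z. p (f z) (g z)) = (\<lambda>z. p (f z) (partial b g z) + p (partial b f z) (g z))" for b
    by (rule ext, rule partial_bounded_bilinear[OF assms(1)]) (use assms in \<open>auto intro: slow1D\<close>)
  ultimately show ?thesis
    using assms unfolding slow1_def by (auto intro!: slow_add slow_bounded_bilinear[OF assms(1)])
qed

lemma rapid1_bounded_bilinear:
  assumes "bounded_bilinear p" "slow1 f" "rapid1 g"
  shows "rapid1 (\<lambda>z. p (f z) (g z))"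
proof -
  have "(\<lambda>z. p (f z) (g z)) differentiable (at z)" for z
    using bounded_bilinear.FDERIV[OF assms(1)] slow1D(1)[OF assms(2), of z] rapid1D(1)[OF assms(3), of z]
    unfolding differentiable_def by blast
  moreover have "partial b (\<lambda>z. p (f z) (g z)) = (\<lambda>z. p (f z) (partial b g z) + p (partial b f z) (g z))" for b
    by (rule ext, rule partial_bounded_bilinear[OF assms(1)]) (use assms in \<open>auto intro: slow1D rapid1D\<close>)
  ultimately show ?thesis
    using assms unfolding slow1_def rapid1_def
    by (auto intro!: rapid_add rapid_bounded_bilinear[OF assms(1)]
        intro: rapid_bounded_bilinear[OF bounded_bilinear.flip[OF assms(1)]])
qed

lemmas rapid1_scaleR = rapid1_bounded_bilinear[OF bounded_bilinear_scaleR]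
  and rapid1_inner = rapid1_bounded_bilinear[OF bounded_bilinear_inner rapid1_imp_slow1]
  and rapid1_mult = rapid1_bounded_bilinear[OF bounded_bilinear_mult]
  and slow1_mult = slow1_bounded_bilinear[OF bounded_bilinear_mult]

lemma partial_const [simp]: "partial b (\<lambda>z. c) = (\<lambda>z. 0)"
  by (simp add: partial_def fun_eq_iff)

lemma slow1_const [simp]: "slow1 (\<lambda>z. c)"
  unfolding slow1_def by simp

lemma partial_bounded_linear: "bounded_linear L \<Longrightarrow> partial b L = (\<lambda>z. L b)"
  by (rule ext, rule partial_eqI) (rule bounded_linear_imp_has_derivative)

lemma slow1_bounded_linear: "bounded_linear L \<Longrightarrow> slow1 L"
  unfolding slow1_def
  by (auto simp: slow_bounded_linear partial_bounded_linear bounded_linear_imp_differentiable)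

lemma rapid1_add: "rapid1 f \<Longrightarrow> rapid1 g \<Longrightarrow> rapid1 (\<lambda>z. f z + g z)"
proof -
  assume fg: "rapid1 f" "rapid1 g"
  then have "partial b (\<lambda>z. f z + g z) = (\<lambda>z. partial b f z + partial b g z)" for b
    by (auto intro!: partial_add rapid1D)
  then show ?thesis using fg unfolding rapid1_def by (auto intro!: rapid_add)
qed

lemma slow1_add: "slow1 f \<Longrightarrow> slow1 g \<Longrightarrow> slow1 (\<lambda>z. f z + g z)"
proof -
  assume fg: "slow1 f" "slow1 g"
  then have "partial b (\<lambda>z. f z + g z) = (\<lambda>z. partial b f z + partial b g z)" for b
    by (auto intro!: partial_add slow1D)
  then show ?thesis using fg unfolding slow1_def by (auto intro!: slow_add)
qed

lemma rapid1_sum: "(\<And>i. i \<in> I \<Longrightarrow> rapid1 (f i)) \<Longrightarrow> rapid1 (\<lambda>z. \<Sum>i\<in>I. f i z)"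
proof (induction I rule: infinite_finite_induct)
  case (insert x F)
  then show ?case by (auto intro: rapid1_add)
qed (auto simp: rapid1_def)

lemma rapid1_cmult: "rapid1 g \<Longrightarrow> rapid1 (\<lambda>z. c * g z)" for g :: "'a::euclidean_space \<Rightarrow> 'b::real_normed_algebra"
  by (rule rapid1_mult[OF slow1_const])

section \<open>Integrability of rapidly decreasing functions and integration by parts\<close>

lemma nn_integral_decay_finite:
  "(\<integral>\<^sup>+ z. ennreal (1 / (1 + norm (z::'a::euclidean_space)) ^ (2 * DIM('a))) \<partial>lborel) < \<infinity>"
proof -
  define f :: "real \<Rightarrow> real" where "f x = inverse (1 + x\<^sup>2)" for x
  have f0: "f x \<ge> 0" for x unfolding f_def by simp
  have [measurable]: "f \<in> borel_measurable borel" unfolding f_def by measurable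
  have "integrable lborel f"
    using integrable_inverse_1_plus_square unfolding f_def set_integrable_def by simp
  then have fin: "(\<integral>\<^sup>+ x. ennreal (f x) \<partial>lborel) < \<infinity>"
    unfolding integrable_iff_bounded using f0 by simp
  have "(\<integral>\<^sup>+ z. ennreal (1 / (1 + norm (z::'a)) ^ (2 * DIM('a))) \<partial>lborel)
      \<le> (\<integral>\<^sup>+ z. (\<Prod>b\<in>Basis. ennreal (f ((z::'a) \<bullet> b))) \<partial>lborel)"
  proof (rule nn_integral_mono)
    fix z :: 'a
    \<comment> \<open>Each coordinate is bounded by the norm, so one factor (1 + norm z)^2 per
      coordinate dominates 1 plus the square of that coordinate. The majorant is a product of
      one-dimensional functions 1/(1 + x^2), which explains the exponent 2 n in dimension n.\<close>
    have "1 / (1 + norm z) ^ (2 * DIM('a)) = (\<Prod>b\<in>(Basis::'a set). inverse ((1 + norm z)\<^sup>2))"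
      by (simp add: power_mult power_inverse[symmetric] divide_inverse)
    also have "\<dots> \<le> (\<Prod>b\<in>Basis. f (z \<bullet> b))"
    proof (rule prod_mono, safe)
      fix b :: 'a assume "b \<in> Basis"
      then have "\<bar>z \<bullet> b\<bar> \<le> norm z" by (rule Basis_le_norm)
      then have "(z \<bullet> b)\<^sup>2 \<le> (norm z)\<^sup>2" by (simp add: abs_le_square_iff[symmetric])
      then have "1 + (z \<bullet> b)\<^sup>2 \<le> (1 + norm z)\<^sup>2" by (simp add: power2_sum add_increasing2)
      then show "inverse ((1 + norm z)\<^sup>2) \<le> f (z \<bullet> b)"
        unfolding f_def by (intro le_imp_inverse_le) (auto intro: add_pos_nonneg)
    qed (simp)
    finally show "ennreal (1 / (1 + norm z) ^ (2 * DIM('a))) \<le> (\<Prod>b\<in>Basis. ennreal (f (z \<bullet> b)))"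
      by (simp add: prod_ennreal f0 ennreal_leI)
  qed
  also have "\<dots> = (\<Prod>b\<in>(Basis::'a set). (\<integral>\<^sup>+ x. ennreal (f x) \<partial>lborel))"
    by (rule nn_integral_lborel_prod) auto
  also have "\<dots> < \<infinity>"
    using fin by (simp add: less_top[symmetric] ennreal_prod_eq_top power_eq_top_ennreal)
  finally show ?thesis .
qed

lemma integrable_decay:
  "integrable lborel (\<lambda>z::'a::euclidean_space. C / (1 + norm z) ^ (2 * DIM('a)))"
proof -
  have "integrable lborel (\<lambda>z::'a. 1 / (1 + norm z) ^ (2 * DIM('a)))"
    unfolding integrable_iff_bounded using nn_integral_decay_finite[where 'a='a] by simp
  from integrable_mult_right[OF this, of C] show ?thesis by simp
qed

lemma integrable_rapid:
  fixes g :: "'a::euclidean_space \<Rightarrow> 'b::{banach, second_countable_topology}"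
  assumes "rapid g" shows "integrable lborel g"
proof -
  obtain B where B: "B > 0" "\<forall>z. (1 + norm z) ^ (2 * DIM('a)) * norm (g z) \<le> B" using rapidD assms by blast
  have "norm (g z) \<le> norm (B / (1 + norm z) ^ (2 * DIM('a)))" for z
  proof -
    have "(1 + norm z) ^ (2 * DIM('a)) > 0" by (simp add: add_pos_nonneg)
    then have "norm (g z) \<le> B / (1 + norm z) ^ (2 * DIM('a))"
      using B(2)[rule_format, of z] by (simp add: pos_le_divide_eq mult.commute)
    then show ?thesis using B(1) by auto
  qed
  then show ?thesis
    using assms unfolding rapid_def
    by (intro Bochner_Integration.integrable_bound[OF integrable_decay[of B]])
      (auto intro: borel_measurable_continuous_onI)
qed

lemma lborel_integral_translate:
  fixes g :: "'a::euclidean_space \<Rightarrow> 'b::{banach, second_countable_topology}"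
  assumes [measurable]: "g \<in> borel_measurable borel"
  shows "(LINT z|lborel. g (c + z)) = (LINT z|lborel. g z)"
  by (subst (2) lborel_distr_plus[of c, symmetric]) (simp add: integral_distr)

lemma nn_integral_translate:
  fixes g :: "'a::euclidean_space \<Rightarrow> ennreal"
  assumes [measurable]: "g \<in> borel_measurable borel"
  shows "(\<integral>\<^sup>+ z. g (c + z) \<partial>lborel) = (\<integral>\<^sup>+ z. g z \<partial>lborel)"
  by (subst (2) lborel_distr_plus[of c, symmetric]) (simp add: nn_integral_distr)

lemma rapid_measurable: "rapid g \<Longrightarrow> g \<in> borel_measurable borel"
  unfolding rapid_def by (auto intro: borel_measurable_continuous_onI)

lemma has_vector_derivative_line:
  assumes "\<And>z. g differentiable (at z)"
  shows "((\<lambda>t. g (z + t *\<^sub>R b)) has_vector_derivative partial b g (z + t *\<^sub>R b)) (at t within S)"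
proof -
  have D: "(g has_derivative (\<lambda>d. partial d g (z + t *\<^sub>R b))) (at (z + t *\<^sub>R b))"
    by (rule has_derivative_partial) (rule assms)
  have L: "((\<lambda>t. z + t *\<^sub>R b) has_derivative (\<lambda>h. h *\<^sub>R b)) (at t within S)"
    by (auto intro!: derivative_eq_intros)
  from has_derivative_compose[OF L D] show ?thesis
    unfolding has_vector_derivative_def
    by (simp add: linear_cmul[OF linear_partial[OF assms]])
qed

lemma norm_diff_line_le:
  assumes "\<And>z. g differentiable (at z)" "0 \<le> h"
    and "\<And>t. 0 \<le> t \<Longrightarrow> t \<le> h \<Longrightarrow> norm (partial b g (z + t *\<^sub>R b)) \<le> B"
  shows "norm (g (z + h *\<^sub>R b) - g z) \<le> B * h"
proof -
  have "norm (g (z + h *\<^sub>R b) - g (z + 0 *\<^sub>R b)) \<le> B * norm (h - 0)"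
  proof (rule differentiable_bound[where S="{0..h}"])
    fix t assume t: "t \<in> {0..h}"
    show "((\<lambda>t. g (z + t *\<^sub>R b)) has_derivative (\<lambda>h. h *\<^sub>R partial b g (z + t *\<^sub>R b))) (at t within {0..h})"
      using has_vector_derivative_line[OF assms(1)] unfolding has_vector_derivative_def .
    have "norm (partial b g (z + t *\<^sub>R b)) \<le> B" using t assms(3) by simp
    then show "onorm (\<lambda>h. h *\<^sub>R partial b g (z + t *\<^sub>R b)) \<le> B"
      by (intro onorm_le) (simp add: mult.commute[of B] mult_left_mono)
  qed (use assms(2) in auto)
  then show ?thesis using assms(2) by simp
qed

text \<open>By translation invariance every difference quotient of \<open>g\<close> in direction
  \<open>b\<close> has integral 0, and dominated convergence carries this over to the
  derivative.\<close>

lemma integral_partial_eq_0: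
  fixes g :: "'a::euclidean_space \<Rightarrow> 'b::{banach, second_countable_topology}"
  assumes g: "rapid1 g" and b: "b \<in> Basis"
  shows "(LINT z|lborel. partial b g z) = 0"
proof -
  have [measurable]: "g \<in> borel_measurable borel" "partial b g \<in> borel_measurable borel"
    using g b by (auto intro: rapid_measurable rapid1D)
  have dg: "g differentiable (at z)" for z using g by (rule rapid1D)
  define N where "N = 2 * DIM('a)"
  obtain B where B: "B > 0" "\<And>z. (1 + norm z) ^ N * norm (partial b g z) \<le> B"
    using rapidD[OF rapid1D(3)[OF g b], of N] by blast
  define h where "h n = 1 / real (Suc n)" for n
  have h: "0 < h n" "h n \<le> 1" for n unfolding h_def by auto
  define s where "s n z = (1 / h n) *\<^sub>R (g (z + h n *\<^sub>R b) - g z)" for n z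
  \<comment> \<open>A shift by at most one unit vector changes 1 + norm z by at most a factor 2,
    hence 2^N; the decay of the derivative then dominates all the quotients.\<close>
  define C where "C = B * 2 ^ N"
  have norm_le: "norm (partial b g (z + t *\<^sub>R b)) \<le> C / (1 + norm z) ^ N"
    if "0 \<le> t" "t \<le> 1" for z t
  proof -
    have "norm z \<le> norm (z + t *\<^sub>R b) + norm (t *\<^sub>R b)"
      using norm_triangle_ineq4[of "z + t *\<^sub>R b" "t *\<^sub>R b"] by simp
    also have "\<dots> \<le> norm (z + t *\<^sub>R b) + 1" using that b by simp
    also have "\<dots> \<le> 2 * norm (z + t *\<^sub>R b) + 1" by simp
    finally have *: "1 + norm z \<le> 2 * (1 + norm (z + t *\<^sub>R b))" by simp
    define p where "p = norm (partial b g (z + t *\<^sub>R b))"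
    have p: "p \<ge> 0" unfolding p_def by simp
    have "(1 + norm z) ^ N * p \<le> (2 * (1 + norm (z + t *\<^sub>R b))) ^ N * p"
      using * p by (intro mult_right_mono power_mono) auto
    also have "\<dots> = 2 ^ N * ((1 + norm (z + t *\<^sub>R b)) ^ N * p)"
      by (simp only: power_mult_distrib mult.assoc)
    also have "\<dots> \<le> 2 ^ N * B" using B(2) p_def by (intro mult_left_mono) auto
    finally have "(1 + norm z) ^ N * p \<le> C" unfolding C_def by (simp add: mult.commute)
    then show ?thesis unfolding p_def[symmetric]
      by (subst pos_le_divide_eq) (auto simp: mult.commute add_pos_nonneg)
  qed
  have bound: "norm (s n z) \<le> C / (1 + norm z) ^ N" for n z
  proof -
    have "norm (g (z + h n *\<^sub>R b) - g z) \<le> C / (1 + norm z) ^ N * h n"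
    proof (rule norm_diff_line_le[OF dg])
      fix t assume "0 \<le> t" "t \<le> h n"
      then show "norm (partial b g (z + t *\<^sub>R b)) \<le> C / (1 + norm z) ^ N"
        using h(2)[of n] by (intro norm_le) auto
    qed (use h(1)[of n] in simp)
    then show ?thesis unfolding s_def using h(1)[of n] by (simp add: pos_divide_le_eq)
  qed
  have lim: "(\<lambda>n. s n z) \<longlonglongrightarrow> partial b g z" for z
  proof -
    have "((\<lambda>t. g (z + t *\<^sub>R b)) has_vector_derivative partial b g (z + 0 *\<^sub>R b)) (at 0)"
      by (rule has_vector_derivative_line) (rule dg)
    then have "((\<lambda>t. norm (g (z + t *\<^sub>R b) - g z - t *\<^sub>R partial b g z) / norm t) \<longlongrightarrow> 0) (at 0)"
      unfolding has_vector_derivative_def has_derivative_at by simp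
    moreover have "filterlim h (at 0) sequentially"
      unfolding filterlim_at h_def using LIMSEQ_inverse_real_of_nat by (auto simp: inverse_eq_divide)
    ultimately have "(\<lambda>n. norm (g (z + h n *\<^sub>R b) - g z - h n *\<^sub>R partial b g z) / norm (h n)) \<longlonglongrightarrow> 0"
      by (rule filterlim_compose)
    moreover have "norm (g (z + h n *\<^sub>R b) - g z - h n *\<^sub>R partial b g z) / norm (h n)
        = norm (s n z - partial b g z)" for n
    proof -
      have "s n z - partial b g z = (1 / h n) *\<^sub>R (g (z + h n *\<^sub>R b) - g z - h n *\<^sub>R partial b g z)"
        unfolding s_def using h(1)[of n] by (simp add: scaleR_diff_right)
      then show ?thesis using h(1)[of n] by simp
    qed
    ultimately show ?thesis by (simp add: LIM_zero_iff tendsto_norm_zero_iff)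
  qed
  have "(\<lambda>n. LINT z|lborel. s n z) \<longlonglongrightarrow> (LINT z|lborel. partial b g z)"
  proof (rule integral_dominated_convergence[where w="\<lambda>z. C / (1 + norm z) ^ N"])
    show "s n \<in> borel_measurable lborel" for n unfolding s_def by measurable
    show "integrable lborel (\<lambda>z::'a. C / (1 + norm z) ^ N)" unfolding N_def by (rule integrable_decay)
  qed (use lim bound in auto)
  moreover have "(LINT z|lborel. s n z) = 0" for n
  proof -
    have ig: "integrable lborel g" using g by (auto intro: integrable_rapid rapid1D)
    then have "integrable (distr lborel borel ((+) (h n *\<^sub>R b))) g"
      by (simp only: lborel_distr_plus)
    then have "integrable lborel (\<lambda>z. g (z + h n *\<^sub>R b))"
      by (subst (asm) integrable_distr_eq) (auto simp: add.commute)
    moreover have "(LINT z|lborel. g (z + h n *\<^sub>R b)) = (LINT z|lborel. g z)"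
      using lborel_integral_translate[of g "h n *\<^sub>R b"] by (simp add: add.commute)
    ultimately show ?thesis unfolding s_def using ig by simp
  qed
  ultimately show ?thesis by (simp add: LIMSEQ_const_iff)
qed

text \<open>Young's form of the symmetry theorem, with the first partials differentiable at the one
  point \<open>z\<close>. The second difference \<open>D s\<close> is symmetric in \<open>a\<close>
  and \<open>b\<close>, and divided by s^2 it tends to each of the two mixed derivatives.\<close>

lemma partial_commute:
  fixes f :: "'a::euclidean_space \<Rightarrow> 'b::real_normed_vector"
  assumes f: "\<And>z. f differentiable (at z)"
    and fa: "partial a f differentiable (at z)" and fb: "partial b f differentiable (at z)"
  shows "partial a (partial b f) z = partial b (partial a f) z"
proof -
  define D where "D s = f (z + s *\<^sub>R a + s *\<^sub>R b) - f (z + s *\<^sub>R a) - f (z + s *\<^sub>R b) + f z" for s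
  \<comment> \<open>The estimate treats \<open>a\<close> and \<open>b\<close> differently, so it is
    stated for arbitrary directions and used twice, the second time with the two exchanged.\<close>
  have key: "\<forall>e>0. \<exists>d>0. \<forall>s. 0 < s \<and> s < d \<longrightarrow> norm (D' s - s\<^sup>2 *\<^sub>R partial b (partial a f) z) \<le> e * s\<^sup>2"
    if ga: "partial a f differentiable (at z)"
      and D': "D' = (\<lambda>s. f (z + s *\<^sub>R a + s *\<^sub>R b) - f (z + s *\<^sub>R a) - f (z + s *\<^sub>R b) + f z)"
    for a b :: 'a and D'
  proof (intro allI impI)
    fix e :: real assume e: "e > 0"
    define g where "g = partial a f"
    define c where "c = 2 * norm a + norm b + 1"
    have c: "c > 0" unfolding c_def by (simp add: add_nonneg_pos)
    have "(g has_derivative (\<lambda>w. partial w g z)) (at z)"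
      using ga unfolding g_def by (rule has_derivative_partial)
    moreover have "e / c > 0" using e c by simp
    ultimately obtain d where d: "d > 0"
      "\<And>y. norm (y - z) < d \<Longrightarrow> norm (g y - g z - partial (y - z) g z) \<le> e / c * norm (y - z)"
      unfolding has_derivative_at_alt by metis
    have lin: "linear (\<lambda>w. partial w g z)" using ga unfolding g_def by (rule linear_partial)
    show "\<exists>d>0. \<forall>s. 0 < s \<and> s < d \<longrightarrow> norm (D' s - s\<^sup>2 *\<^sub>R partial b (partial a f) z) \<le> e * s\<^sup>2"
    proof (intro exI[of _ "d / c"] conjI allI impI)
      show "d / c > 0" using d c by simp
      fix s assume s: "0 < s \<and> s < d / c"
      \<comment> \<open>The derivative of \<open>psi\<close> in t is a difference of two values of
        \<open>g\<close> near \<open>z\<close> minus the expected linear part. Differentiability of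
        \<open>g\<close> at \<open>z\<close>, applied at both points, bounds it by e * s;
        \<open>c\<close> is chosen to cover the two displacements together.\<close>
      define psi where "psi t = f ((z + s *\<^sub>R b) + t *\<^sub>R a) - f (z + t *\<^sub>R a) - t *\<^sub>R (s *\<^sub>R partial b g z)" for t
      have "norm (psi s - psi 0) \<le> (e * s) * norm (s - 0)"
      proof (rule differentiable_bound[where S="{0..s}"])
        fix t assume t: "t \<in> {0..s}"
        define psi' where "psi' = g ((z + s *\<^sub>R b) + t *\<^sub>R a) - g (z + t *\<^sub>R a) - s *\<^sub>R partial b g z"
        have "((\<lambda>t. t *\<^sub>R (s *\<^sub>R partial b g z)) has_vector_derivative s *\<^sub>R partial b g z) (at t within {0..s})"
          unfolding has_vector_derivative_def by (rule bounded_linear_imp_has_derivative) (rule bounded_linear_scaleR_left)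
        then have "(psi has_vector_derivative psi') (at t within {0..s})"
          unfolding psi_def psi'_def g_def
          by (intro has_vector_derivative_diff[OF has_vector_derivative_diff[OF
            has_vector_derivative_line[OF f] has_vector_derivative_line[OF f]]])
        then show "(psi has_derivative (\<lambda>h. h *\<^sub>R psi')) (at t within {0..s})"
          unfolding has_vector_derivative_def .
        let ?w1 = "s *\<^sub>R b + t *\<^sub>R a" and ?w2 = "t *\<^sub>R a"
        have ta: "norm ?w2 \<le> s * norm a" using t by (simp add: mult_right_mono)
        have w1: "norm ?w1 \<le> s * (norm a + norm b)"
          using norm_triangle_ineq[of "s *\<^sub>R b" "t *\<^sub>R a"] ta s by (simp add: algebra_simps)
        have cs: "s * (norm a + norm b) < d" "s * norm a < d"
        proof -
          have sc: "s * c < d" using s c by (simp add: pos_less_divide_eq)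
          have "s * (norm a + norm b) \<le> s * c" "s * norm a \<le> s * c"
            unfolding c_def using s by (auto intro!: mult_left_mono simp: add_nonneg_nonneg)
          with sc show "s * (norm a + norm b) < d" "s * norm a < d" by linarith+
        qed
        have 1: "norm (g (z + ?w1) - g z - partial ?w1 g z) \<le> e / c * norm ?w1"
          using d(2)[of "z + ?w1"] w1 cs by simp
        have 2: "norm (g (z + ?w2) - g z - partial ?w2 g z) \<le> e / c * norm ?w2"
          using d(2)[of "z + ?w2"] ta cs by simp
        have "psi' = (g (z + ?w1) - g z - partial ?w1 g z) - (g (z + ?w2) - g z - partial ?w2 g z)"
          unfolding psi'_def using linear_add[OF lin, of "s *\<^sub>R b" "t *\<^sub>R a"] linear_cmul[OF lin, of s b]
          by (simp add: algebra_simps)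
        then have "norm psi' \<le> e / c * norm ?w1 + e / c * norm ?w2"
          using norm_triangle_ineq4[of "g (z + ?w1) - g z - partial ?w1 g z" "g (z + ?w2) - g z - partial ?w2 g z"] 1 2
          by simp
        also have "\<dots> = e / c * (norm ?w1 + norm ?w2)" by (simp only: distrib_left)
        also have "\<dots> \<le> e / c * (s * c)"
        proof (rule mult_left_mono)
          have "norm ?w1 + norm ?w2 \<le> s * (norm a + norm b) + s * norm a" using w1 ta by (rule add_mono)
          also have "\<dots> \<le> s * c" unfolding c_def using s by (simp add: algebra_simps)
          finally show "norm ?w1 + norm ?w2 \<le> s * c" .
        qed (use e c in simp)
        also have "\<dots> = e * s" using c by simp
        finally have "norm psi' \<le> e * s" .
        then show "onorm (\<lambda>h. h *\<^sub>R psi') \<le> e * s"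
          by (intro onorm_le) (simp add: mult.commute[of "e * s"] mult_left_mono)
      qed (use s in auto)
      moreover have "psi s - psi 0 = D' s - s\<^sup>2 *\<^sub>R partial b (partial a f) z"
        unfolding psi_def D' g_def by (simp add: power2_eq_square algebra_simps)
      ultimately show "norm (D' s - s\<^sup>2 *\<^sub>R partial b (partial a f) z) \<le> e * s\<^sup>2"
        using s by (simp add: power2_eq_square)
    qed
  qed
  define X where "X = partial b (partial a f) z"
  define Y where "Y = partial a (partial b f) z"
  have "norm (X - Y) \<le> e" if e: "e > 0" for e
  proof -
    have kX: "\<forall>e>0. \<exists>d>0. \<forall>s. 0 < s \<and> s < d \<longrightarrow> norm (D s - s\<^sup>2 *\<^sub>R X) \<le> e * s\<^sup>2"
      unfolding X_def by (rule key[OF fa]) (simp add: D_def fun_eq_iff)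
    have kY: "\<forall>e>0. \<exists>d>0. \<forall>s. 0 < s \<and> s < d \<longrightarrow> norm (D s - s\<^sup>2 *\<^sub>R Y) \<le> e * s\<^sup>2"
      unfolding Y_def by (rule key[OF fb]) (simp add: D_def fun_eq_iff algebra_simps)
    have e2: "e / 2 > 0" using e by simp
    from kX e2 obtain d1 where d1: "d1 > 0" "\<And>s. 0 < s \<and> s < d1 \<Longrightarrow> norm (D s - s\<^sup>2 *\<^sub>R X) \<le> e / 2 * s\<^sup>2"
      by metis
    from kY e2 obtain d2 where d2: "d2 > 0" "\<And>s. 0 < s \<and> s < d2 \<Longrightarrow> norm (D s - s\<^sup>2 *\<^sub>R Y) \<le> e / 2 * s\<^sup>2"
      by metis
    define s where "s = min d1 d2 / 2"
    have s: "0 < s" "s < d1" "s < d2" using d1(1) d2(1) unfolding s_def by auto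
    have "s\<^sup>2 *\<^sub>R (X - Y) = (D s - s\<^sup>2 *\<^sub>R Y) - (D s - s\<^sup>2 *\<^sub>R X)"
      by (simp add: scaleR_diff_right)
    then have "norm (s\<^sup>2 *\<^sub>R (X - Y)) \<le> norm (D s - s\<^sup>2 *\<^sub>R Y) + norm (D s - s\<^sup>2 *\<^sub>R X)"
      using norm_triangle_ineq4 by metis
    also have "\<dots> \<le> e / 2 * s\<^sup>2 + e / 2 * s\<^sup>2"
      by (intro add_mono d1(2) d2(2) conjI s)
    finally have "norm (s\<^sup>2 *\<^sub>R (X - Y)) \<le> e * s\<^sup>2" by simp
    then have "s\<^sup>2 * norm (X - Y) \<le> s\<^sup>2 * e" by (simp add: mult.commute)
    then show ?thesis using s(1) by simp
  qed
  then have "norm (X - Y) \<le> 0" by (rule dense_ge)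
  then show ?thesis unfolding X_def Y_def by simp
qed

section \<open>Schwartz functions\<close>

text \<open>The quantifier over all words of derivatives is replaced by closure under a single
  derivative: a class of differentiable, rapidly decaying functions that is stable under coordinate
  derivatives consists of Schwartz functions.\<close>

lemma schwartz_coinduct:
  fixes f :: "'a::euclidean_space \<Rightarrow> complex"
  assumes "C f" and "\<And>g. C g \<Longrightarrow> (\<forall>z. g differentiable (at z)) \<and> (\<forall>k. \<exists>B. \<forall>z. (1 + norm z) ^ k * norm (g z) \<le> B)"
    and "\<And>g b. C g \<Longrightarrow> b \<in> Basis \<Longrightarrow> C (partial b g)"
  shows "schwartz f"
proof -
  have "set bs \<subseteq> Basis \<Longrightarrow> C (partials bs f)" for bs
    by (induction bs) (use assms in auto)
  then show ?thesis unfolding schwartz_def smooth_def using assms(2) by blast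
qed

lemma partials_append: "partials (bs @ cs) f = partials bs (partials cs f)"
  by (induction bs) auto

lemma schwartz_partial: "schwartz f \<Longrightarrow> b \<in> Basis \<Longrightarrow> schwartz (partial b f)"
  unfolding schwartz_def smooth_def
proof safe
  fix bs :: "'a list" and z
  assume b: "b \<in> Basis" "set bs \<subseteq> Basis"
    and *: "\<forall>bs. set bs \<subseteq> Basis \<longrightarrow> (\<forall>z. partials bs f differentiable at z)"
      "\<forall>k bs. set bs \<subseteq> Basis \<longrightarrow> (\<exists>B. \<forall>z. (1 + norm z) ^ k * cmod (partials bs f z) \<le> B)"
  have eq: "partials bs (partial b f) = partials (bs @ [b]) f" by (simp add: partials_append)
  show "partials bs (partial b f) differentiable at z" unfolding eq using b * by simp
  fix k show "\<exists>B. \<forall>z. (1 + norm z) ^ k * cmod (partials bs (partial b f) z) \<le> B"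
    unfolding eq using b * by (metis append_Nil2 insert_subset list.simps(15) set_append sup.bounded_iff set_ConsD bot.extremum list.set(1))
qed

lemma schwartz_differentiable: "schwartz f \<Longrightarrow> f differentiable (at z)"
  unfolding schwartz_def smooth_def by (metis empty_subsetI list.set(1) partials.simps(1))

lemma schwartz_decay: "schwartz f \<Longrightarrow> \<exists>B. \<forall>z. (1 + norm z) ^ k * norm (f z) \<le> B"
  unfolding schwartz_def by (metis empty_subsetI list.set(1) partials.simps(1))

lemma continuous_on_differentiable:
  "(\<And>z. f differentiable (at z)) \<Longrightarrow> continuous_on UNIV f"
  by (simp add: continuous_at_imp_continuous_on differentiable_imp_continuous_within)

lemma schwartz_rapid: "schwartz f \<Longrightarrow> rapid f"
  unfolding rapid_def using schwartz_differentiable schwartz_decay continuous_on_differentiable by blast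

lemma schwartz_rapid1: "schwartz f \<Longrightarrow> rapid1 f"
  unfolding rapid1_def using schwartz_differentiable schwartz_rapid schwartz_partial by blast

text \<open>Differentiating a coordinate times f gives the coordinate times a derivative of f plus a
  constant multiple of f. The span is therefore stable under derivatives, and
  \<open>schwartz_coinduct\<close> yields sums, constant multiples and coordinate multiples of
  Schwartz functions together.\<close>

inductive coord_span :: "('a::euclidean_space \<Rightarrow> complex) \<Rightarrow> bool" where
  base: "schwartz f \<Longrightarrow> coord_span f"
| coord: "schwartz f \<Longrightarrow> coord_span (\<lambda>z. complex_of_real (z \<bullet> a) * f z)"
| add: "coord_span f \<Longrightarrow> coord_span g \<Longrightarrow> coord_span (\<lambda>z. f z + g z)"
| cmult: "coord_span f \<Longrightarrow> coord_span (\<lambda>z. c * f z)"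

lemma slow1_coord: "slow1 (\<lambda>z. complex_of_real (z \<bullet> a))"
  by (rule slow1_bounded_linear) (intro bounded_linear_compose[OF bounded_linear_of_real] bounded_linear_inner_left)

lemma partial_coord: "partial b (\<lambda>z. complex_of_real (z \<bullet> a)) = (\<lambda>z. complex_of_real (b \<bullet> a))"
  by (rule partial_bounded_linear) (intro bounded_linear_compose[OF bounded_linear_of_real] bounded_linear_inner_left)

lemma coord_span_rapid1: "coord_span f \<Longrightarrow> rapid1 f"
  by (induction rule: coord_span.induct)
    (auto intro: schwartz_rapid1 rapid1_add rapid1_cmult rapid1_mult slow1_coord)

lemma coord_span_partial: "coord_span f \<Longrightarrow> b \<in> Basis \<Longrightarrow> coord_span (partial b f)"
proof (induction rule: coord_span.induct)
  case (base f)
  then show ?case by (intro coord_span.base schwartz_partial)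
next
  case (coord f a)
  have "partial b (\<lambda>z. complex_of_real (z \<bullet> a) * f z)
      = (\<lambda>z. complex_of_real (z \<bullet> a) * partial b f z + complex_of_real (b \<bullet> a) * f z)"
    by (rule ext, rule trans[OF partial_mult[OF slow1D(1)[OF slow1_coord[of a]] schwartz_differentiable[OF coord(1)]]])
      (simp add: partial_coord)
  then show ?case
    using coord by (simp only:) (rule coord_span.add[OF coord_span.coord coord_span.cmult[OF coord_span.base]],
      auto intro: schwartz_partial)
next
  case (add f g)
  have "partial b (\<lambda>z. f z + g z) = (\<lambda>z. partial b f z + partial b g z)"
    by (rule ext, rule partial_add[OF rapid1D(1)[OF coord_span_rapid1[OF add(1)]] rapid1D(1)[OF coord_span_rapid1[OF add(2)]]])
  then show ?case using add by (simp add: coord_span.add)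
next
  case (cmult f c)
  have "partial b (\<lambda>z. c * f z) = (\<lambda>z. c * partial b f z)"
    by (rule ext, rule partial_cmult[OF rapid1D(1)[OF coord_span_rapid1[OF cmult(1)]]])
  then show ?case using cmult by (simp add: coord_span.cmult)
qed

lemma coord_span_schwartz: "coord_span f \<Longrightarrow> schwartz f"
  by (rule schwartz_coinduct[of coord_span])
    (use coord_span_rapid1 coord_span_partial in \<open>auto simp: rapid1_def rapid_def\<close>)

lemma schwartz_add: "schwartz f \<Longrightarrow> schwartz g \<Longrightarrow> schwartz (\<lambda>z. f z + g z)"
  by (rule coord_span_schwartz[OF coord_span.add[OF coord_span.base coord_span.base]])

lemma schwartz_coord: "schwartz f \<Longrightarrow> schwartz (\<lambda>z. complex_of_real (z \<bullet> a) * f z)"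
  by (rule coord_span_schwartz[OF coord_span.coord])

lemma schwartz_cmult: "schwartz f \<Longrightarrow> schwartz (\<lambda>z. c * f z)"
  by (rule coord_span_schwartz[OF coord_span.cmult[OF coord_span.base]])

section \<open>The Fourier transform on integrable functions\<close>

text \<open>Unnormalised, matching \<open>fourier_x\<close>; Plancherel's formula then carries the
  constant (2 pi)^n.\<close>

definition ft :: "('a::euclidean_space \<Rightarrow> complex) \<Rightarrow> 'a \<Rightarrow> complex" where
  "ft g \<xi> = (LINT x|lborel. cis (- (x \<bullet> \<xi>)) * g x)"

lemma measurable_cis [measurable]: "cis \<in> borel_measurable borel"
  by (intro borel_measurable_continuous_onI continuous_intros) 

lemma measurable_cnj [measurable]: "cnj \<in> borel_measurable borel"
  by (intro borel_measurable_continuous_onI continuous_intros)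

lemma integral_affine:
  fixes f :: "'a::euclidean_space \<Rightarrow> 'b::{banach, second_countable_topology}"
  assumes [measurable]: "f \<in> borel_measurable borel" and c: "c \<noteq> 0"
  shows "(LINT x|lborel. f x) = \<bar>c\<bar> ^ DIM('a) *\<^sub>R (LINT x|lborel. f (t + c *\<^sub>R x))"
  by (subst lborel_affine[OF c, of t]) (simp add: integral_density integral_distr)

lemma nn_integral_affine:
  fixes f :: "'a::euclidean_space \<Rightarrow> ennreal"
  assumes [measurable]: "f \<in> borel_measurable borel" and c: "c \<noteq> 0"
  shows "(\<integral>\<^sup>+ x. f x \<partial>lborel) = ennreal (\<bar>c\<bar> ^ DIM('a)) * (\<integral>\<^sup>+ x. f (t + c *\<^sub>R x) \<partial>lborel)"
  by (subst lborel_affine[OF c, of t]) (simp add: nn_integral_density nn_integral_distr nn_integral_cmult)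

lemma integrable_affine:
  fixes f :: "'a::euclidean_space \<Rightarrow> 'b::{banach, second_countable_topology}"
  assumes f: "integrable lborel f" and c: "c \<noteq> 0"
  shows "integrable lborel (\<lambda>x. f (t + c *\<^sub>R x))"
proof -
  have [measurable]: "f \<in> borel_measurable borel" using borel_measurable_integrable[OF f] by simp
  have "(\<integral>\<^sup>+ x. norm (f x) \<partial>lborel) < \<infinity>" using f unfolding integrable_iff_bounded by simp
  then have "ennreal (\<bar>c\<bar> ^ DIM('a)) * (\<integral>\<^sup>+ x. norm (f (t + c *\<^sub>R x)) \<partial>lborel) < \<infinity>"
    by (subst (asm) nn_integral_affine[OF _ c, of _ t]) auto
  then have "(\<integral>\<^sup>+ x. norm (f (t + c *\<^sub>R x)) \<partial>lborel) < \<infinity>"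
    using c by (auto simp: ennreal_mult_less_top)
  then show ?thesis by (intro integrableI_bounded) auto
qed

text \<open>Supplies the hypothesis of Fubini's theorem: characters have modulus one, so a tensor
  product of integrable functions dominates the double integrals that occur.\<close>

lemma integrable_lborel_product_bound:
  fixes F :: "'a::euclidean_space \<times> 'b::euclidean_space \<Rightarrow> 'c::{banach, second_countable_topology}"
  assumes [measurable]: "F \<in> borel_measurable (lborel \<Otimes>\<^sub>M lborel)"
    and a: "integrable lborel a" and b: "integrable lborel b"
    and bound: "\<And>x y. norm (F (x, y)) \<le> norm (a x :: real) * norm (b y :: real)"
  shows "integrable (lborel \<Otimes>\<^sub>M lborel) F"
proof (rule integrableI_bounded)
  have [measurable]: "a \<in> borel_measurable borel" "b \<in> borel_measurable borel"
    using borel_measurable_integrable[OF a] borel_measurable_integrable[OF b] by auto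
  have "(\<integral>\<^sup>+ p. norm (F p) \<partial>(lborel \<Otimes>\<^sub>M lborel)) = (\<integral>\<^sup>+ x. (\<integral>\<^sup>+ y. norm (F (x, y)) \<partial>lborel) \<partial>lborel)"
    by (simp add: lborel.nn_integral_fst [symmetric])
  also have "\<dots> \<le> (\<integral>\<^sup>+ x. (\<integral>\<^sup>+ y. ennreal (norm (a x)) * ennreal (norm (b y)) \<partial>lborel) \<partial>lborel)"
    by (intro nn_integral_mono) (simp add: ennreal_mult[symmetric] bound ennreal_leI del: real_norm_def)
  also have "\<dots> = (\<integral>\<^sup>+ x. norm (a x) \<partial>lborel) * (\<integral>\<^sup>+ y. norm (b y) \<partial>lborel)"
    by (simp add: nn_integral_cmult nn_integral_multc)
  also have "\<dots> < \<infinity>"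
    using a b unfolding integrable_iff_bounded by (simp add: ennreal_mult_less_top)
  finally show "(\<integral>\<^sup>+ p. norm (F p) \<partial>(lborel \<Otimes>\<^sub>M lborel)) < \<infinity>" .
qed fact

lemma integral_lborel_prod:
  fixes f :: "'a::euclidean_space \<Rightarrow> real \<Rightarrow> 'b::{real_normed_field, banach, second_countable_topology}"
  assumes f: "\<And>b. b \<in> Basis \<Longrightarrow> integrable lborel (f b)"
  shows "integrable lborel (\<lambda>z. \<Prod>b\<in>Basis. f b (z \<bullet> b))" (is ?I)
    and "(LINT z|lborel. (\<Prod>b\<in>Basis. f b (z \<bullet> b))) = (\<Prod>b\<in>Basis. (LINT x|lborel. f b x))" (is ?E)
proof -
  interpret product_sigma_finite "\<lambda>_::'a. lborel :: real measure" ..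
  have [measurable]: "\<And>b. b \<in> Basis \<Longrightarrow> f b \<in> borel_measurable borel"
    using borel_measurable_integrable[OF f] by simp
  have m: "(\<lambda>z. \<Prod>b\<in>Basis. f b (z \<bullet> b)) \<in> borel_measurable (borel :: 'a measure)"
    by measurable
  have s: "(\<Prod>b\<in>Basis. f b ((\<Sum>c\<in>Basis. x c *\<^sub>R c) \<bullet> b)) = (\<Prod>b\<in>Basis. f b (x b))" for x
    by (intro prod.cong refl) simp
  show ?I unfolding lborel_eq[where 'a='a]
    by (subst integrable_distr_eq[OF _ m]) (auto simp: s intro!: product_integrable_prod f)
  show ?E unfolding lborel_eq[where 'a='a]
    by (subst integral_distr[OF _ m]) (auto simp: s intro!: product_integral_prod f)
qed

section \<open>The Gaussian and its Fourier transform\<close>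

definition gaussian :: "'a::euclidean_space \<Rightarrow> real" where
  "gaussian z = exp (- ((norm z)\<^sup>2) / 2)"

lemma measurable_gaussian [measurable]: "gaussian \<in> borel_measurable borel"
  unfolding gaussian_def by measurable

lemma gaussian_pos: "gaussian z > 0" and gaussian_le_1: "gaussian z \<le> 1"
  unfolding gaussian_def by auto

text \<open>Read off from the characteristic function of the standard normal distribution; the
  factor \<open>sqrt (2 * pi)\<close> undoes the normalisation of its density.\<close>

lemma gaussian_1dim:
  "integrable lborel (\<lambda>x. complex_of_real (exp (- (x\<^sup>2) / 2)) * cis (t * x))"
  "(LINT x|lborel. complex_of_real (exp (- (x\<^sup>2) / 2)) * cis (t * x)) = sqrt (2 * pi) * exp (- (t\<^sup>2) / 2)"
proof -
  have e: "exp (- (x\<^sup>2) / 2) = sqrt (2 * pi) * std_normal_density x" for x :: real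
    unfolding std_normal_density_def by simp
  have "integrable lborel (\<lambda>x::real. exp (- (x\<^sup>2) / 2))"
    unfolding e using integrable_std_normal_moment[of 0] by simp
  then have "integrable lborel (\<lambda>x. complex_of_real (exp (- (x\<^sup>2) / 2)))" by simp
  then show "integrable lborel (\<lambda>x. complex_of_real (exp (- (x\<^sup>2) / 2)) * cis (t * x))"
    by (rule Bochner_Integration.integrable_bound) (auto simp: norm_mult)
  have "complex_of_real (exp (- (t\<^sup>2) / 2)) = char std_normal_distribution t"
    by (simp add: char_std_normal_distribution)
  also have "\<dots> = (LINT x|lborel. std_normal_density x *\<^sub>R iexp (t * x))"
    unfolding char_def by (subst integral_density) auto
  finally have c: "(LINT x|lborel. std_normal_density x *\<^sub>R iexp (t * x)) = complex_of_real (exp (- (t\<^sup>2) / 2))" ..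
  have "(LINT x|lborel. complex_of_real (exp (- (x\<^sup>2) / 2)) * cis (t * x))
      = (LINT x|lborel. complex_of_real (sqrt (2 * pi)) * (std_normal_density x *\<^sub>R iexp (t * x)))"
    unfolding e by (simp add: cis_conv_exp scaleR_conv_of_real mult.assoc)
  then show "(LINT x|lborel. complex_of_real (exp (- (x\<^sup>2) / 2)) * cis (t * x)) = sqrt (2 * pi) * exp (- (t\<^sup>2) / 2)"
    unfolding integral_mult_right_zero c by simp
qed

lemma gaussian_cis:
  fixes z :: "'a::euclidean_space"
  shows "complex_of_real (gaussian x) * cis (z \<bullet> x)
    = (\<Prod>b\<in>Basis. complex_of_real (exp (- ((x \<bullet> b)\<^sup>2) / 2)) * cis ((z \<bullet> b) * (x \<bullet> b)))"
proof -
  have n: "(norm x)\<^sup>2 = (\<Sum>b\<in>Basis. (x \<bullet> b)\<^sup>2)"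
    by (subst power2_norm_eq_inner, subst euclidean_inner) (simp add: power2_eq_square)
  have "gaussian x = (\<Prod>b\<in>Basis. exp (- ((x \<bullet> b)\<^sup>2) / 2))"
    unfolding gaussian_def n by (simp add: exp_sum[symmetric] sum_divide_distrib sum_negf)
  moreover have "cis (z \<bullet> x) = (\<Prod>b\<in>Basis. cis ((z \<bullet> b) * (x \<bullet> b)))"
    by (simp add: cis_conv_exp exp_sum[symmetric] sum_distrib_left[symmetric] euclidean_inner[of z x])
  ultimately show ?thesis by (simp add: prod.distrib)
qed

lemma gaussian_fourier:
  fixes z :: "'a::euclidean_space"
  shows "integrable lborel (\<lambda>x::'a. complex_of_real (gaussian x) * cis (z \<bullet> x))"
    and "(LINT x|lborel. complex_of_real (gaussian x) * cis (z \<bullet> x))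
      = complex_of_real (sqrt (2 * pi) ^ DIM('a) * gaussian z)"
proof -
  let ?f = "\<lambda>b x. complex_of_real (exp (- (x\<^sup>2) / 2)) * cis ((z \<bullet> b) * x)"
  show "integrable lborel (\<lambda>x::'a. complex_of_real (gaussian x) * cis (z \<bullet> x))"
    unfolding gaussian_cis using integral_lborel_prod(1)[of ?f] gaussian_1dim(1) by simp
  have n: "(norm z)\<^sup>2 = (\<Sum>b\<in>Basis. (z \<bullet> b)\<^sup>2)"
    by (subst power2_norm_eq_inner, subst euclidean_inner) (simp add: power2_eq_square)
  have g: "gaussian z = (\<Prod>b\<in>Basis. exp (- ((z \<bullet> b)\<^sup>2) / 2))"
    unfolding gaussian_def n by (simp add: exp_sum[symmetric] sum_divide_distrib sum_negf)
  show "(LINT x|lborel. complex_of_real (gaussian x) * cis (z \<bullet> x))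
      = complex_of_real (sqrt (2 * pi) ^ DIM('a) * gaussian z)"
    unfolding gaussian_cis using integral_lborel_prod(2)[of ?f] gaussian_1dim
    by (simp add: g prod.distrib)
qed

lemma integrable_gaussian: "integrable lborel (gaussian :: 'a::euclidean_space \<Rightarrow> real)"
  using gaussian_fourier(1)[of 0] by (simp add: complex_of_real_integrable_eq)

lemma integral_gaussian: "(LINT x|lborel. gaussian (x::'a::euclidean_space)) = sqrt (2 * pi) ^ DIM('a)"
proof -
  have "complex_of_real (LINT x|lborel. gaussian (x::'a)) = complex_of_real (sqrt (2 * pi) ^ DIM('a))"
    using gaussian_fourier(2)[of "0::'a"] by (simp add: gaussian_def)
  then show ?thesis by (simp only: of_real_eq_iff)
qed


text \<open>The converse direction holds because the inverse character is again unimodular. It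
  transfers non-integrability of \<open>g\<close> to the integrand that defines
  \<open>ft g\<close>.\<close>

lemma integrable_cis_mult_iff:
  "integrable lborel (\<lambda>x::'a::euclidean_space. cis (- (x \<bullet> \<xi>)) * g x) \<longleftrightarrow> integrable lborel g"
proof
  assume g: "integrable lborel g"
  then have [measurable]: "g \<in> borel_measurable borel" using borel_measurable_integrable[OF g] by simp
  show "integrable lborel (\<lambda>x::'a. cis (- (x \<bullet> \<xi>)) * g x)"
    by (rule Bochner_Integration.integrable_bound[OF g]) (auto simp: norm_mult)
next
  assume h: "integrable lborel (\<lambda>x. cis (- (x \<bullet> \<xi>)) * g x)"
  have [measurable]: "(\<lambda>x. cis (- (x \<bullet> \<xi>)) * g x) \<in> borel_measurable borel"
    using borel_measurable_integrable[OF h] by simp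
  have "integrable lborel (\<lambda>x. cis (x \<bullet> \<xi>) * (cis (- (x \<bullet> \<xi>)) * g x))"
    by (rule Bochner_Integration.integrable_bound[OF h]) (auto simp: norm_mult)
  then show "integrable lborel g" by (simp add: mult.assoc[symmetric] cis_mult)
qed

lemma measurable_ft [measurable]:
  assumes [measurable]: "g \<in> borel_measurable borel"
  shows "ft g \<in> borel_measurable borel"
  unfolding ft_def by measurable

lemma norm_ft_le:
  assumes "integrable lborel g" shows "norm (ft g \<xi>) \<le> (LINT x|lborel. norm (g x))"
  unfolding ft_def by (rule order_trans[OF integral_norm_bound]) (simp add: norm_mult)

text \<open>The Gaussian factor makes the double integral behind Plancherel's formula absolutely convergent.\<close>
lemma ft_gaussian_identity:
  fixes g :: "'a::euclidean_space \<Rightarrow> complex"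
  assumes g: "integrable lborel g" and d: "d > 0"
  shows "complex_of_real (LINT \<xi>|lborel. gaussian (d *\<^sub>R \<xi>) * (norm (ft g \<xi>))\<^sup>2)
    = (LINT x|lborel. cnj (g x) * (LINT w|lborel. g (x + d *\<^sub>R w) *
        complex_of_real (sqrt (2 * pi) ^ DIM('a) * gaussian w)))"
proof -
  have [measurable]: "g \<in> borel_measurable borel" using borel_measurable_integrable[OF g] by simp
  have gd: "integrable lborel (\<lambda>\<xi>::'a. gaussian (d *\<^sub>R \<xi>))"
    using integrable_affine[OF integrable_gaussian, of d 0] d by simp
  have ng: "integrable lborel (\<lambda>x. norm (g x))" using g by simp
  define C where "C = (LINT x|lborel. norm (g x))"
  have C: "norm (ft g \<xi>) \<le> C" for \<xi> unfolding C_def by (rule norm_ft_le[OF g])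
  have C0: "C \<ge> 0" using C[of 0] norm_ge_zero order_trans by blast
  \<comment> \<open>The inversion integral regularised by a Gaussian. It turns out to be
    \<open>g\<close> averaged against a Gaussian of width d.\<close>
  define J where "J x = (LINT \<xi>|lborel. gaussian (d *\<^sub>R \<xi>) * (cis (x \<bullet> \<xi>) * ft g \<xi>))" for x
  have J: "J x = (LINT w|lborel. g (x + d *\<^sub>R w) * complex_of_real (sqrt (2 * pi) ^ DIM('a) * gaussian w))" for x
  proof -
    have "J x = (LINT \<xi>|lborel. (LINT y|lborel. gaussian (d *\<^sub>R \<xi>) * (cis ((x - y) \<bullet> \<xi>) * g y)))"
      unfolding J_def ft_def
      by (intro Bochner_Integration.integral_cong refl)
        (simp add: integral_mult_right_zero[symmetric] mult.assoc[symmetric] cis_mult inner_diff_left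
          del: integral_mult_right_zero)
    also have "\<dots> = (LINT y|lborel. (LINT \<xi>|lborel. gaussian (d *\<^sub>R \<xi>) * (cis ((x - y) \<bullet> \<xi>) * g y)))"
    proof (rule lborel_pair.Fubini_integral)
      show "integrable (lborel \<Otimes>\<^sub>M lborel) (\<lambda>(y, \<xi>). complex_of_real (gaussian (d *\<^sub>R \<xi>)) * (cis ((x - y) \<bullet> \<xi>) * g y))"
        by (rule integrable_lborel_product_bound[OF _ ng gd])
          (auto simp: norm_mult gaussian_pos less_imp_le)
    qed
    also have "\<dots> = (LINT y|lborel. g y * (LINT \<xi>|lborel. gaussian (d *\<^sub>R \<xi>) * cis ((x - y) \<bullet> \<xi>)))"
      by (intro Bochner_Integration.integral_cong refl)
        (simp add: integral_mult_right_zero[symmetric] ac_simps del: integral_mult_right_zero)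
    \<comment> \<open>The substitution y = x + d w makes the Gaussian in w independent of d; its
      Jacobian is cancelled by the rescaling of \<xi> in the inner integral.\<close>
    also have "\<dots> = d ^ DIM('a) *\<^sub>R (LINT w|lborel. g (x + d *\<^sub>R w) *
        (LINT \<xi>|lborel. gaussian (d *\<^sub>R \<xi>) * cis ((- w) \<bullet> (d *\<^sub>R \<xi>))))"
      by (subst integral_affine[of _ d x]) (use d in auto)
    also have "\<dots> = (LINT w|lborel. g (x + d *\<^sub>R w) *
        (d ^ DIM('a) *\<^sub>R (LINT \<xi>|lborel. gaussian (d *\<^sub>R \<xi>) * cis ((- w) \<bullet> (d *\<^sub>R \<xi>)))))"
      by (simp only: mult_scaleR_right integral_scaleR_right)
    also have "\<dots> = (LINT w|lborel. g (x + d *\<^sub>R w) * complex_of_real (sqrt (2 * pi) ^ DIM('a) * gaussian w))"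
    proof (intro Bochner_Integration.integral_cong refl arg_cong2[where f="(*)"])
      fix w :: 'a
      have "(LINT \<xi>|lborel. complex_of_real (gaussian \<xi>) * cis ((- w) \<bullet> \<xi>))
          = \<bar>d\<bar> ^ DIM('a) *\<^sub>R (LINT \<xi>|lborel. gaussian (0 + d *\<^sub>R \<xi>) * cis ((- w) \<bullet> (0 + d *\<^sub>R \<xi>)))"
        by (rule integral_affine) (use d in auto)
      then show "d ^ DIM('a) *\<^sub>R (LINT \<xi>|lborel. complex_of_real (gaussian (d *\<^sub>R \<xi>)) * cis ((- w) \<bullet> (d *\<^sub>R \<xi>)))
          = complex_of_real (sqrt (2 * pi) ^ DIM('a) * gaussian w)"
        using d gaussian_fourier(2)[of "- w"] by (simp add: gaussian_def)
    qed
    finally show ?thesis .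
  qed
  have "complex_of_real (LINT \<xi>|lborel. gaussian (d *\<^sub>R \<xi>) * (norm (ft g \<xi>))\<^sup>2)
      = (LINT \<xi>|lborel. gaussian (d *\<^sub>R \<xi>) * ft g \<xi> * cnj (ft g \<xi>))"
    by (simp only: integral_complex_of_real[symmetric] of_real_mult complex_norm_square mult.assoc)
  also have "\<dots> = (LINT \<xi>|lborel. (LINT x|lborel. gaussian (d *\<^sub>R \<xi>) * ft g \<xi> * (cis (x \<bullet> \<xi>) * cnj (g x))))"
  proof (intro Bochner_Integration.integral_cong refl)
    fix \<xi> :: 'a
    have "cnj (ft g \<xi>) = (LINT x|lborel. cis (x \<bullet> \<xi>) * cnj (g x))"
    proof -
      have "cnj (ft g \<xi>) = (LINT x|lborel. cnj (cis (- (x \<bullet> \<xi>)) * g x))"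
        unfolding ft_def by (rule Bochner_Integration.integral_cnj[symmetric])
      then show ?thesis by (simp add: cis_cnj)
    qed
    then show "gaussian (d *\<^sub>R \<xi>) * ft g \<xi> * cnj (ft g \<xi>)
        = (LINT x|lborel. gaussian (d *\<^sub>R \<xi>) * ft g \<xi> * (cis (x \<bullet> \<xi>) * cnj (g x)))"
      by simp
  qed
  also have "\<dots> = (LINT x|lborel. (LINT \<xi>|lborel. gaussian (d *\<^sub>R \<xi>) * ft g \<xi> * (cis (x \<bullet> \<xi>) * cnj (g x))))"
  proof (rule lborel_pair.Fubini_integral)
    have iC: "integrable lborel (\<lambda>x. C * norm (g x))" using ng by simp
    show "integrable (lborel \<Otimes>\<^sub>M lborel)
        (\<lambda>(x, \<xi>). complex_of_real (gaussian (d *\<^sub>R \<xi>)) * ft g \<xi> * (cis (x \<bullet> \<xi>) * cnj (g x)))"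
    proof (rule integrable_lborel_product_bound[OF _ iC gd])
      fix x \<xi> :: 'a
      have "gaussian (d *\<^sub>R \<xi>) * norm (ft g \<xi>) * norm (g x) \<le> gaussian (d *\<^sub>R \<xi>) * C * norm (g x)"
        by (intro mult_right_mono mult_left_mono C) (auto simp: gaussian_pos less_imp_le)
      then show "norm (case (x, \<xi>) of (x, \<xi>) \<Rightarrow> complex_of_real (gaussian (d *\<^sub>R \<xi>)) * ft g \<xi> * (cis (x \<bullet> \<xi>) * cnj (g x)))
          \<le> norm (C * norm (g x)) * norm (gaussian (d *\<^sub>R \<xi>))"
        using C0 by (simp add: norm_mult ac_simps gaussian_pos less_imp_le)
    qed measurable
  qed
  also have "\<dots> = (LINT x|lborel. cnj (g x) * J x)"
    unfolding J_def by (intro Bochner_Integration.integral_cong refl)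
      (simp add: integral_mult_right_zero[symmetric] ac_simps del: integral_mult_right_zero)
  finally show ?thesis unfolding J .
qed

section \<open>Plancherel's formula as two inequalities\<close>

lemma gaussian_scaled_LIMSEQ:
  "(\<lambda>n. gaussian ((1 / real (Suc n)) *\<^sub>R \<xi>)) \<longlonglongrightarrow> 1"
proof -
  have "(\<lambda>n. gaussian (inverse (real (Suc n)) *\<^sub>R \<xi>)) \<longlonglongrightarrow> exp (- ((norm (0 *\<^sub>R \<xi>))\<^sup>2) / 2)"
    unfolding gaussian_def by (intro tendsto_intros LIMSEQ_inverse_real_of_nat) auto
  then show ?thesis by (simp add: inverse_eq_divide)
qed

text \<open>After \<open>ft_gaussian_identity\<close>, the inequality 2ab <= a^2 + b^2 and
  translation invariance separate the two factors of \<open>g\<close>. What remains is the mass of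
  the Gaussian, which gives (2 pi)^n whatever the value of \<open>d\<close>.\<close>

lemma ft_weighted_le:
  fixes g :: "'a::euclidean_space \<Rightarrow> complex"
  assumes g: "integrable lborel g" and d: "d > 0"
  shows "(\<integral>\<^sup>+ \<xi>. ennreal (gaussian (d *\<^sub>R \<xi>) * (norm (ft g \<xi>))\<^sup>2) \<partial>lborel)
    \<le> ennreal ((2 * pi) ^ DIM('a)) * (\<integral>\<^sup>+ x. ennreal ((norm (g x))\<^sup>2) \<partial>lborel)"
proof -
  have [measurable]: "g \<in> borel_measurable borel" using borel_measurable_integrable[OF g] by simp
  define S where "S = sqrt (2 * pi) ^ DIM('a)"
  have "S * S = (sqrt (2 * pi) * sqrt (2 * pi)) ^ DIM('a)" unfolding S_def by (simp only: power_mult_distrib)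
  then have S: "S > 0" "S * S = (2 * pi) ^ DIM('a)" unfolding S_def by auto
  define N where "N = (\<integral>\<^sup>+ x. ennreal ((norm (g x))\<^sup>2) \<partial>lborel)"
  define H where "H x = (LINT w|lborel. g (x + d *\<^sub>R w) * complex_of_real (S * gaussian w))" for x
  have gd: "integrable lborel (\<lambda>\<xi>::'a. gaussian (d *\<^sub>R \<xi>))"
    using integrable_affine[OF integrable_gaussian, of d 0] d by simp
  have "integrable lborel (\<lambda>\<xi>. gaussian (d *\<^sub>R \<xi>) * (norm (ft g \<xi>))\<^sup>2)"
  proof (rule Bochner_Integration.integrable_bound)
    show "integrable lborel (\<lambda>\<xi>::'a. gaussian (d *\<^sub>R \<xi>) * (LINT x|lborel. norm (g x))\<^sup>2)"
      using gd by simp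
    show "AE \<xi> in lborel. norm (gaussian (d *\<^sub>R \<xi>) * (norm (ft g \<xi>))\<^sup>2) \<le> norm (gaussian (d *\<^sub>R \<xi>) * (LINT x|lborel. norm (g x))\<^sup>2)"
      by (auto simp: abs_mult gaussian_pos less_imp_le intro!: mult_left_mono power_mono norm_ft_le g)
  qed measurable
  then have "(\<integral>\<^sup>+ \<xi>. ennreal (gaussian (d *\<^sub>R \<xi>) * (norm (ft g \<xi>))\<^sup>2) \<partial>lborel)
      = ennreal (LINT \<xi>|lborel. gaussian (d *\<^sub>R \<xi>) * (norm (ft g \<xi>))\<^sup>2)"
    by (rule nn_integral_eq_integral) (simp add: gaussian_pos less_imp_le)
  also have "\<dots> \<le> ennreal (norm (complex_of_real (LINT \<xi>|lborel. gaussian (d *\<^sub>R \<xi>) * (norm (ft g \<xi>))\<^sup>2)))"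
    by (simp add: ennreal_leI)
  also have "\<dots> = ennreal (norm (LINT x|lborel. cnj (g x) * H x))"
    unfolding ft_gaussian_identity[OF g d] H_def S_def ..
  \<comment> \<open>If the integrand is not integrable, the Bochner integral is 0 and the bound is
    trivial; the same distinction is made for \<open>H x\<close> in the next step.\<close>
  also have "\<dots> \<le> (\<integral>\<^sup>+ x. norm (cnj (g x) * H x) \<partial>lborel)"
    by (cases "integrable lborel (\<lambda>x. cnj (g x) * H x)")
      (auto intro: integral_norm_bound_ennreal simp: not_integrable_integral_eq)
  also have "\<dots> \<le> (\<integral>\<^sup>+ x. (\<integral>\<^sup>+ w. ennreal (norm (g x) * (norm (g (x + d *\<^sub>R w)) * (S * gaussian w))) \<partial>lborel) \<partial>lborel)"
  proof (rule nn_integral_mono)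
    fix x
    have "ennreal (norm (H x)) \<le> (\<integral>\<^sup>+ w. norm (g (x + d *\<^sub>R w) * complex_of_real (S * gaussian w)) \<partial>lborel)"
      unfolding H_def
      by (cases "integrable lborel (\<lambda>w. g (x + d *\<^sub>R w) * complex_of_real (S * gaussian w))")
        (auto intro: integral_norm_bound_ennreal simp: not_integrable_integral_eq)
    then have "ennreal (norm (g x)) * ennreal (norm (H x))
        \<le> ennreal (norm (g x)) * (\<integral>\<^sup>+ w. norm (g (x + d *\<^sub>R w) * complex_of_real (S * gaussian w)) \<partial>lborel)"
      by (rule mult_left_mono) simp
    also have "\<dots> = (\<integral>\<^sup>+ w. ennreal (norm (g x) * (norm (g (x + d *\<^sub>R w)) * (S * gaussian w))) \<partial>lborel)"
      using S(1) by (subst nn_integral_cmult[symmetric]) (auto simp: norm_mult ennreal_mult' gaussian_pos less_imp_le)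
    finally show "ennreal (norm (cnj (g x) * H x)) \<le> (\<integral>\<^sup>+ w. ennreal (norm (g x) * (norm (g (x + d *\<^sub>R w)) * (S * gaussian w))) \<partial>lborel)"
      by (simp add: norm_mult ennreal_mult')
  qed
  also have "\<dots> \<le> (\<integral>\<^sup>+ x. (\<integral>\<^sup>+ w. ennreal (S / 2 * gaussian w) *
      (ennreal ((norm (g x))\<^sup>2) + ennreal ((norm (g (d *\<^sub>R w + x)))\<^sup>2)) \<partial>lborel) \<partial>lborel)"
  proof (intro nn_integral_mono)
    fix x w :: 'a
    have "norm (g x) * norm (g (x + d *\<^sub>R w)) \<le> ((norm (g x))\<^sup>2 + (norm (g (x + d *\<^sub>R w)))\<^sup>2) / 2"
      using sum_squares_bound[of "norm (g x)" "norm (g (x + d *\<^sub>R w))"] by simp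
    then have "norm (g x) * norm (g (x + d *\<^sub>R w)) * (S * gaussian w)
        \<le> ((norm (g x))\<^sup>2 + (norm (g (x + d *\<^sub>R w)))\<^sup>2) / 2 * (S * gaussian w)"
      using S(1) by (intro mult_right_mono) (auto simp: gaussian_pos less_imp_le)
    then have "norm (g x) * (norm (g (x + d *\<^sub>R w)) * (S * gaussian w))
        \<le> (S / 2 * gaussian w) * ((norm (g x))\<^sup>2 + (norm (g (d *\<^sub>R w + x)))\<^sup>2)"
      by (simp add: algebra_simps)
    then show "ennreal (norm (g x) * (norm (g (x + d *\<^sub>R w)) * (S * gaussian w)))
      \<le> ennreal (S / 2 * gaussian w) * (ennreal ((norm (g x))\<^sup>2) + ennreal ((norm (g (d *\<^sub>R w + x)))\<^sup>2))"
      using S(1) by (simp add: ennreal_plus[symmetric] ennreal_mult'[symmetric] gaussian_pos less_imp_le ennreal_leI del: ennreal_plus)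
  qed
  also have "\<dots> = (\<integral>\<^sup>+ w. (\<integral>\<^sup>+ x. ennreal (S / 2 * gaussian w) *
      (ennreal ((norm (g x))\<^sup>2) + ennreal ((norm (g (d *\<^sub>R w + x)))\<^sup>2)) \<partial>lborel) \<partial>lborel)"
    by (rule lborel_pair.Fubini'[symmetric]) measurable
  also have "\<dots> = (\<integral>\<^sup>+ w. ennreal (S / 2 * gaussian w) * (N + N) \<partial>(lborel :: 'a measure))"
    unfolding N_def
    by (intro nn_integral_cong)
      (simp add: nn_integral_cmult nn_integral_add nn_integral_translate[of "\<lambda>x. ennreal ((norm (g x))\<^sup>2)"])
  also have "\<dots> = ennreal (LINT w|lborel. S / 2 * gaussian (w :: 'a)) * (N + N)"
    using S(1) by (subst nn_integral_multc, measurable, subst nn_integral_eq_integral)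
      (auto simp: integrable_gaussian gaussian_pos less_imp_le)
  also have "(LINT w|lborel. S / 2 * gaussian (w :: 'a)) = S * S / 2"
    unfolding integral_mult_right_zero integral_gaussian S_def by simp
  also have "ennreal (S * S / 2) * (N + N) = (ennreal (S * S / 2) + ennreal (S * S / 2)) * N"
    by (simp only: distrib_left distrib_right)
  also have "ennreal (S * S / 2) + ennreal (S * S / 2) = ennreal (S * S)"
    using S(1) by (subst ennreal_plus[symmetric]) auto
  finally show ?thesis unfolding S(2) N_def .
qed

text \<open>Integrability is not needed: otherwise the Bochner integral \<open>ft g\<close> is \<open>0\<close>.\<close>
lemma plancherel_le:
  fixes g :: "'a::euclidean_space \<Rightarrow> complex"
  shows "(\<integral>\<^sup>+ \<xi>. ennreal ((norm (ft g \<xi>))\<^sup>2) \<partial>lborel)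
    \<le> ennreal ((2 * pi) ^ DIM('a)) * (\<integral>\<^sup>+ x. ennreal ((norm (g x))\<^sup>2) \<partial>lborel)"
proof (cases "integrable lborel g")
  case False
  then have "ft g \<xi> = 0" for \<xi>
    unfolding ft_def by (intro not_integrable_integral_eq) (simp add: integrable_cis_mult_iff)
  then show ?thesis by simp
next
  case True
  then have [measurable]: "g \<in> borel_measurable borel" using borel_measurable_integrable[OF True] by simp
  let ?s = "\<lambda>n \<xi>. ennreal (gaussian ((1 / real (Suc n)) *\<^sub>R \<xi>) * (norm (ft g \<xi>))\<^sup>2)"
  have "(\<lambda>n. ?s n \<xi>) \<longlonglongrightarrow> ennreal (1 * (norm (ft g \<xi>))\<^sup>2)" for \<xi>
    by (intro tendsto_ennrealI tendsto_mult tendsto_const gaussian_scaled_LIMSEQ)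
  then have "liminf (\<lambda>n. ?s n \<xi>) = ennreal ((norm (ft g \<xi>))\<^sup>2)" for \<xi>
    using lim_imp_Liminf[OF sequentially_bot] by force
  then have "(\<integral>\<^sup>+ \<xi>. ennreal ((norm (ft g \<xi>))\<^sup>2) \<partial>lborel) = (\<integral>\<^sup>+ \<xi>. liminf (\<lambda>n. ?s n \<xi>) \<partial>lborel)"
    by simp
  also have "\<dots> \<le> liminf (\<lambda>n. \<integral>\<^sup>+ \<xi>. ?s n \<xi> \<partial>lborel)"
    by (rule nn_integral_liminf) measurable
  also have "\<dots> \<le> ennreal ((2 * pi) ^ DIM('a)) * (\<integral>\<^sup>+ x. ennreal ((norm (g x))\<^sup>2) \<partial>lborel)"
  proof (rule Liminf_le)
    show "\<forall>\<^sub>F n in sequentially. (\<integral>\<^sup>+ \<xi>. ?s n \<xi> \<partial>lborel)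
        \<le> ennreal ((2 * pi) ^ DIM('a)) * (\<integral>\<^sup>+ x. ennreal ((norm (g x))\<^sup>2) \<partial>lborel)"
      by (intro always_eventually allI ft_weighted_le[OF True]) simp
  qed simp
  finally show ?thesis .
qed

text \<open>Now the width of the regularisation tends to 0. Continuity gives pointwise convergence
  of the averages \<open>H n\<close> to a multiple of \<open>g\<close>, boundedness gives the
  majorant, and \<open>gaussian_le_1\<close> bounds every approximation by the full integral of the
  transform.\<close>

lemma plancherel_ge:
  fixes g :: "'a::euclidean_space \<Rightarrow> complex"
  assumes g: "integrable lborel g" and cont: "continuous_on UNIV g" and bound: "\<And>x. norm (g x) \<le> B"
  shows "ennreal ((2 * pi) ^ DIM('a)) * (\<integral>\<^sup>+ x. ennreal ((norm (g x))\<^sup>2) \<partial>lborel)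
    \<le> (\<integral>\<^sup>+ \<xi>. ennreal ((norm (ft g \<xi>))\<^sup>2) \<partial>lborel)"
proof -
  have [measurable]: "g \<in> borel_measurable borel" using borel_measurable_integrable[OF g] by simp
  have B0: "B \<ge> 0" using bound[of 0] norm_ge_zero order_trans by blast
  define S where "S = sqrt (2 * pi) ^ DIM('a)"
  have "S * S = (sqrt (2 * pi) * sqrt (2 * pi)) ^ DIM('a)" unfolding S_def by (simp only: power_mult_distrib)
  then have S: "S > 0" "S * S = (2 * pi) ^ DIM('a)" unfolding S_def by auto
  define h where "h n = 1 / real (Suc n)" for n
  have h: "h n > 0" for n unfolding h_def by simp
  have h0: "h \<longlonglongrightarrow> 0" unfolding h_def using LIMSEQ_inverse_real_of_nat by (simp add: inverse_eq_divide)
  define H where "H n x = (LINT w|lborel. g (x + h n *\<^sub>R w) * complex_of_real (S * gaussian w))" for n x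
  have iG: "integrable lborel (\<lambda>w::'a. B * (S * gaussian w))"
    by (simp add: integrable_gaussian)
  have Hb: "norm (H n x) \<le> B * (S * S)" for n x
  proof -
    have "norm (H n x) \<le> (LINT w|lborel. B * (S * gaussian (w::'a)))"
      unfolding H_def
    proof (rule Bochner_Integration.integral_norm_bound_integral)
      show "integrable lborel (\<lambda>w. g (x + h n *\<^sub>R w) * complex_of_real (S * gaussian w))"
        by (rule Bochner_Integration.integrable_bound[OF iG])
          (use S(1) bound B0 in \<open>auto simp: norm_mult abs_mult gaussian_pos less_imp_le intro!: mult_right_mono\<close>)
      show "norm (g (x + h n *\<^sub>R w) * complex_of_real (S * gaussian w)) \<le> B * (S * gaussian w)" for w
        using S(1) bound by (auto simp: norm_mult abs_mult gaussian_pos less_imp_le intro!: mult_right_mono)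
    qed (rule iG)
    then show ?thesis by (simp add: integral_gaussian S_def)
  qed
  have Hlim: "(\<lambda>n. H n x) \<longlonglongrightarrow> g x * complex_of_real (S * S)" for x
  proof -
    have "(\<lambda>n. H n x) \<longlonglongrightarrow> (LINT w|lborel. g x * complex_of_real (S * gaussian (w::'a)))"
      unfolding H_def
    proof (rule integral_dominated_convergence[OF _ _ iG])
      show "AE w in lborel. (\<lambda>n. g (x + h n *\<^sub>R w) * complex_of_real (S * gaussian w)) \<longlonglongrightarrow> g x * complex_of_real (S * gaussian w)"
      proof (intro AE_I2 tendsto_mult tendsto_const)
        fix w
        have "(\<lambda>n. x + h n *\<^sub>R w) \<longlonglongrightarrow> x + 0 *\<^sub>R w" by (intro tendsto_intros h0)
        then show "(\<lambda>n. g (x + h n *\<^sub>R w)) \<longlonglongrightarrow> g x"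
          using cont by (auto simp: continuous_on_eq_continuous_at intro: isCont_tendsto_compose)
      qed
      show "AE w in lborel. norm (g (x + h n *\<^sub>R w) * complex_of_real (S * gaussian w)) \<le> B * (S * gaussian w)" for n
        using S(1) bound by (auto simp: norm_mult abs_mult gaussian_pos less_imp_le intro!: mult_right_mono)
    qed measurable
    then show ?thesis by (simp add: integral_gaussian S_def)
  qed
  have [measurable]: "H n \<in> borel_measurable borel" for n unfolding H_def by measurable
  have i1: "integrable lborel (\<lambda>x. (B * (S * S)) * norm (g x))" using g by simp
  have "(\<lambda>n. LINT x|lborel. cnj (g x) * H n x) \<longlonglongrightarrow> (LINT x|lborel. cnj (g x) * (g x * complex_of_real (S * S)))"
  proof (rule integral_dominated_convergence[OF _ _ i1])
    show "AE x in lborel. norm (cnj (g x) * H n x) \<le> B * (S * S) * norm (g x)" for n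
      by (intro AE_I2) (simp add: norm_mult mult.commute[of "B * (S * S)"] mult_left_mono Hb)
    show "AE x in lborel. (\<lambda>n. cnj (g x) * H n x) \<longlonglongrightarrow> cnj (g x) * (g x * complex_of_real (S * S))"
      by (intro AE_I2 tendsto_intros Hlim)
  qed measurable
  then have "(\<lambda>n. norm (LINT x|lborel. cnj (g x) * H n x)) \<longlonglongrightarrow> norm (LINT x|lborel. cnj (g x) * (g x * complex_of_real (S * S)))"
    by (rule tendsto_norm)
  moreover have "(LINT x|lborel. cnj (g x) * (g x * complex_of_real (S * S)))
      = complex_of_real (S * S * (LINT x|lborel. (norm (g x))\<^sup>2))"
  proof -
    have "cnj (g x) * (g x * complex_of_real (S * S)) = complex_of_real (S * S * (norm (g x))\<^sup>2)" for x
      using complex_norm_square[of "g x"] by (simp add: ac_simps)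
    then show ?thesis by (simp only: integral_complex_of_real integral_mult_right_zero)
  qed
  moreover have "norm (complex_of_real (S * S * (LINT x|lborel. (norm (g x))\<^sup>2))) = S * S * (LINT x|lborel. (norm (g x))\<^sup>2)"
    using S(1) unfolding norm_of_real by simp
  ultimately have lim: "(\<lambda>n. ennreal (norm (LINT x|lborel. cnj (g x) * H n x)))
      \<longlonglongrightarrow> ennreal (S * S * (LINT x|lborel. (norm (g x))\<^sup>2))"
    by (intro tendsto_ennrealI) (simp only:)
  have le: "ennreal (norm (LINT x|lborel. cnj (g x) * H n x)) \<le> (\<integral>\<^sup>+ \<xi>. ennreal ((norm (ft g \<xi>))\<^sup>2) \<partial>lborel)" for n
  proof -
    have "norm (LINT x|lborel. cnj (g x) * H n x)
        = (LINT \<xi>|lborel. gaussian (h n *\<^sub>R \<xi>) * (norm (ft g \<xi>))\<^sup>2)"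
      unfolding H_def S_def ft_gaussian_identity[OF g h, symmetric]
      by (simp add: gaussian_pos less_imp_le)
    also have "ennreal \<dots> \<le> (\<integral>\<^sup>+ \<xi>. ennreal (norm (gaussian (h n *\<^sub>R \<xi>) * (norm (ft g \<xi>))\<^sup>2)) \<partial>lborel)"
    proof (cases "integrable lborel (\<lambda>\<xi>. gaussian (h n *\<^sub>R \<xi>) * (norm (ft g \<xi>))\<^sup>2)")
      case True
      from integral_norm_bound_ennreal[OF this] show ?thesis by (auto intro: order_trans[OF ennreal_leI[OF abs_ge_self]])
    qed (simp add: not_integrable_integral_eq)
    also have "\<dots> \<le> (\<integral>\<^sup>+ \<xi>. ennreal ((norm (ft g \<xi>))\<^sup>2) \<partial>lborel)"
      by (intro nn_integral_mono ennreal_leI)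
        (simp add: abs_mult gaussian_pos less_imp_le mult_left_le_one_le gaussian_le_1)
    finally show ?thesis .
  qed
  have i2: "integrable lborel (\<lambda>x. (norm (g x))\<^sup>2)"
  proof (rule Bochner_Integration.integrable_bound)
    show "integrable lborel (\<lambda>x. B * norm (g x))" using g by simp
    show "AE x in lborel. norm ((norm (g x))\<^sup>2) \<le> norm (B * norm (g x))"
      using bound B0 by (auto simp: power2_eq_square abs_mult intro!: mult_right_mono)
  qed measurable
  have "ennreal (S * S) * (\<integral>\<^sup>+ x. ennreal ((norm (g x))\<^sup>2) \<partial>lborel) = ennreal (S * S * (LINT x|lborel. (norm (g x))\<^sup>2))"
    using S(1) by (subst nn_integral_eq_integral[OF i2]) (auto simp: ennreal_mult')
  also have "\<dots> \<le> (\<integral>\<^sup>+ \<xi>. ennreal ((norm (ft g \<xi>))\<^sup>2) \<partial>lborel)"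
    by (rule LIMSEQ_le_const2[OF lim]) (use le in blast)
  finally show ?thesis unfolding S(2) .
qed

lemma ft_add: "integrable lborel f \<Longrightarrow> integrable lborel g \<Longrightarrow> ft (\<lambda>x. f x + g x) \<xi> = ft f \<xi> + ft g \<xi>"
  unfolding ft_def by (simp add: distrib_left integrable_cis_mult_iff)

lemma ft_diff: "integrable lborel f \<Longrightarrow> integrable lborel g \<Longrightarrow> ft (\<lambda>x. f x - g x) \<xi> = ft f \<xi> - ft g \<xi>"
  unfolding ft_def by (simp add: right_diff_distrib integrable_cis_mult_iff)

lemma ft_cmult: "ft (\<lambda>x. c * f x) \<xi> = c * ft f \<xi>"
  unfolding ft_def by (simp add: mult.left_commute[of _ c])

lemma ft_scaleR: "ft (\<lambda>x. c *\<^sub>R f x) \<xi> = c *\<^sub>R ft f \<xi>"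
  unfolding scaleR_conv_of_real by (rule ft_cmult)

lemma ft_sum:
  "(\<And>i. i \<in> I \<Longrightarrow> integrable lborel (f i)) \<Longrightarrow> ft (\<lambda>x. \<Sum>i\<in>I. f i x) \<xi> = (\<Sum>i\<in>I. ft (f i) \<xi>)"
  unfolding ft_def by (simp add: sum_distrib_left integrable_cis_mult_iff)

section \<open>Partial Fourier transform of Schwartz functions\<close>

lemma fourier_x_eq_ft: "fourier_x u \<xi> v = ft (\<lambda>x. u (x, v)) \<xi>"
  unfolding fourier_x_def ft_def ..

lemma zero_prod_in_Basis: "b \<in> Basis \<Longrightarrow> (0, b) \<in> Basis" and prod_zero_in_Basis: "b \<in> Basis \<Longrightarrow> (b, 0) \<in> Basis"
  by (auto simp: Basis_prod_def)

lemma norm_Pair_ge: "norm x \<le> norm (x, v)" "norm v \<le> norm (x, v)"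
  by (auto simp: norm_prod_def)

lemma rapid_slice: "rapid u \<Longrightarrow> rapid (\<lambda>x. u (x, v))"
  unfolding rapid_def
proof safe
  assume "continuous_on UNIV u"
  then show "continuous_on UNIV (\<lambda>x. u (x, v))"
    by (rule continuous_on_compose2) (auto intro!: continuous_intros)
next
  fix k assume "\<forall>k. \<exists>B. \<forall>z. (1 + norm z) ^ k * norm (u z) \<le> B"
  then obtain B where B: "\<And>z. (1 + norm z) ^ k * norm (u z) \<le> B" by blast
  have "(1 + norm x) ^ k * norm (u (x, v)) \<le> B" for x
    by (rule order_trans[OF mult_right_mono[OF power_mono] B[of "(x, v)"]]) (auto simp: norm_Pair_ge)
  then show "\<exists>B. \<forall>x. (1 + norm x) ^ k * norm (u (x, v)) \<le> B" by blast
qed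

lemma partial_slice_fst:
  assumes "u differentiable (at (x, v))"
  shows "(\<lambda>x. u (x, v)) differentiable (at x)" "partial b (\<lambda>x. u (x, v)) x = partial (b, 0) u (x, v)"
proof -
  have "((\<lambda>x. (x, v)) has_derivative (\<lambda>d. (d, 0))) (at x)" by (auto intro!: derivative_eq_intros)
  from has_derivative_compose[OF this has_derivative_partial[OF assms]]
  have *: "((\<lambda>x. u (x, v)) has_derivative (\<lambda>d. partial (d, 0) u (x, v))) (at x)" .
  then show "(\<lambda>x. u (x, v)) differentiable (at x)" unfolding differentiable_def by blast
  from partial_eqI[OF *] show "partial b (\<lambda>x. u (x, v)) x = partial (b, 0) u (x, v)" .
qed

lemma has_derivative_slice_snd:
  assumes "u differentiable (at (x, v))"
  shows "((\<lambda>v. u (x, v)) has_derivative (\<lambda>d. partial (0, d) u (x, v))) (at v)"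
proof -
  have "((\<lambda>v. (x, v)) has_derivative (\<lambda>d. (0, d))) (at v)" by (auto intro!: derivative_eq_intros)
  from has_derivative_compose[OF this has_derivative_partial[OF assms]] show ?thesis .
qed

lemma schwartz_slice_rapid1: "schwartz u \<Longrightarrow> rapid1 (\<lambda>x. u (x, v))"
proof -
  assume u: "schwartz u"
  have d: "u differentiable (at z)" for z using u by (rule schwartz_differentiable)
  have "partial b (\<lambda>x. u (x, v)) = (\<lambda>x. partial (b, 0) u (x, v))" for b
    using partial_slice_fst(2)[OF d] by blast
  then show ?thesis unfolding rapid1_def
    using partial_slice_fst(1)[OF d] rapid_slice[OF schwartz_rapid[OF u]]
      rapid_slice[OF schwartz_rapid[OF schwartz_partial[OF u prod_zero_in_Basis]]] by simp
qed

lemma schwartz_slice_integrable: "schwartz u \<Longrightarrow> integrable lborel (\<lambda>x. u (x, v))"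
  by (intro integrable_rapid rapid_slice schwartz_rapid)

lemma partial_Pair_sum:
  assumes "u differentiable (at z)"
  shows "partial (0, d) u z = (\<Sum>b\<in>Basis. (d \<bullet> b) *\<^sub>R partial (0, b) u z)"
proof -
  have lin: "linear (\<lambda>d. partial d u z)" by (rule linear_partial[OF assms])
  have "partial (0, d) u z = partial (\<Sum>b\<in>Basis. (d \<bullet> b) *\<^sub>R (0, b)) u z"
    by (simp add: sum_prod euclidean_representation)
  then show ?thesis by (simp only: linear_sum[OF lin] linear_cmul[OF lin])
qed

text \<open>A Lipschitz bound in the second variable whose constant decays in the first. Applied to
  first velocity derivatives, it gives a Taylor remainder with a majorant integrable in x.\<close>

lemma schwartz_slice_bound:
  assumes u: "schwartz u" and b: "b \<in> Basis"
  shows "\<exists>M\<ge>0. \<forall>x v w. norm (u (x, w) - u (x, v)) \<le> (M / (1 + norm x) ^ N) * norm (w - v)"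
proof -
  have d: "u differentiable (at z)" for z using u by (rule schwartz_differentiable)
  have "\<forall>b\<in>Basis. \<exists>B>0. \<forall>z. (1 + norm z) ^ N * norm (partial (0, b) u z) \<le> B"
    using rapidD[OF schwartz_rapid[OF schwartz_partial[OF u zero_prod_in_Basis]]] by (intro ballI)
  then obtain B where B: "\<And>b z. b \<in> Basis \<Longrightarrow> B b > 0 \<and> (1 + norm z) ^ N * norm (partial (0, b) u z) \<le> B b"
    by metis
  define M where "M = sum B Basis"
  have M: "M \<ge> 0" unfolding M_def using B by (simp add: sum_nonneg less_imp_le)
  have on: "onorm (\<lambda>d. partial (0, d) u (x, w)) \<le> M / (1 + norm x) ^ N" for x w
  proof (rule onorm_le)
    fix d
    have "norm (partial (0, d) u (x, w)) \<le> (\<Sum>b\<in>Basis. norm d * (B b / (1 + norm x) ^ N))"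
      unfolding partial_Pair_sum[OF d, of d]
    proof (rule sum_norm_le)
      fix b :: 'b assume b: "b \<in> Basis"
      have "(1 + norm x) ^ N * norm (partial (0, b) u (x, w)) \<le> B b"
        by (rule order_trans[OF mult_right_mono[OF power_mono] conjunct2[OF B[OF b, of "(x, w)"]]])
          (auto simp: norm_Pair_ge)
      then have "norm (partial (0, b) u (x, w)) \<le> B b / (1 + norm x) ^ N"
        by (subst pos_le_divide_eq) (auto simp: mult.commute add_pos_nonneg)
      then show "norm ((d \<bullet> b) *\<^sub>R partial (0, b) u (x, w)) \<le> norm d * (B b / (1 + norm x) ^ N)"
        using b unfolding norm_scaleR by (intro mult_mono) (auto simp: Basis_le_norm)
    qed
    then show "norm (partial (0, d) u (x, w)) \<le> (M / (1 + norm x) ^ N) * norm d"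
      unfolding M_def by (simp add: sum_distrib_left sum_divide_distrib mult.commute)
  qed
  have "norm (u (x, w) - u (x, v)) \<le> (M / (1 + norm x) ^ N) * norm (w - v)" for x v w
    by (rule differentiable_bound[where S=UNIV and f="\<lambda>v. u (x, v)", OF _ has_derivative_at_withinI[OF has_derivative_slice_snd[OF d]] on])
      auto
  then show ?thesis using M by blast
qed

text \<open>Differentiation under the integral sign in quantitative form: the first-order Taylor
  remainder of \<open>u\<close> in v is quadratic in w - v with a coefficient integrable in x, so
  the definition of the derivative can be verified directly.\<close>

lemma fourier_x_has_derivative:
  assumes u: "schwartz u"
  shows "(fourier_x u \<xi> has_derivative (\<lambda>d. fourier_x (partial (0, d) u) \<xi> v)) (at v)"
proof -
  have d: "u differentiable (at z)" for z using u by (rule schwartz_differentiable)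
  let ?N = "2 * DIM(real^3)"
  have sp: "schwartz (partial (0, b) u)" if "b \<in> Basis" for b :: "real^3"
    using u that by (intro schwartz_partial zero_prod_in_Basis)
  have int: "integrable lborel (\<lambda>x. partial (0, d) u (x, v))" for d :: "real^3" and v
    unfolding partial_Pair_sum[OF d, of d]
    by (rule Bochner_Integration.integrable_sum, rule integrable_scaleR_right,
      rule schwartz_slice_integrable, rule sp)
  have eq: "fourier_x (partial (0, d) u) \<xi> v = (\<Sum>b\<in>Basis. (d \<bullet> b) *\<^sub>R fourier_x (partial (0, b) u) \<xi> v)" for d
    unfolding fourier_x_eq_ft partial_Pair_sum[OF d, of d]
    by (subst ft_sum, rule integrable_scaleR_right, rule schwartz_slice_integrable, rule sp)
      (auto simp: ft_scaleR)
  have "linear (\<lambda>d. \<Sum>b\<in>Basis. (d \<bullet> b) *\<^sub>R fourier_x (partial (0, b) u) \<xi> v)"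
    by (intro linearI) (simp_all add: inner_add_left scaleR_add_left sum.distrib scaleR_sum_right)
  moreover have "(\<lambda>d. fourier_x (partial (0, d) u) \<xi> v) = (\<lambda>d. \<Sum>b\<in>Basis. (d \<bullet> b) *\<^sub>R fourier_x (partial (0, b) u) \<xi> v)"
    by (rule ext) (rule eq)
  ultimately have "linear (\<lambda>d. fourier_x (partial (0, d) u) \<xi> v)" by (simp only:)
  then have bl: "bounded_linear (\<lambda>d. fourier_x (partial (0, d) u) \<xi> v)"
    by (simp add: linear_conv_bounded_linear)
  have "\<forall>b\<in>Basis. \<exists>M\<ge>0. \<forall>x v w. norm (partial (0, b) u (x, w) - partial (0, b) u (x, v))
      \<le> (M / (1 + norm x) ^ ?N) * norm (w - v)"
    using schwartz_slice_bound[OF sp] by blast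
  then obtain M where M: "\<And>b. b \<in> Basis \<Longrightarrow> M b \<ge> 0"
    "\<And>b x v w. b \<in> Basis \<Longrightarrow> norm (partial (0, b) u (x, w) - partial (0, b) u (x, v)) \<le> (M b / (1 + norm x) ^ ?N) * norm (w - v)"
    by metis
  define K where "K = sum M Basis"
  have K: "K \<ge> 0" unfolding K_def using M by (auto intro!: sum_nonneg)
  have taylor: "norm (u (x, w) - u (x, v) - partial (0, w - v) u (x, v)) \<le> (norm (w - v))\<^sup>2 * (K / (1 + norm x) ^ ?N)" for x w
  proof -
    have "norm (u (x, w) - u (x, v) - partial (0, w - v) u (x, v)) \<le> norm (w - v) * (K / (1 + norm x) ^ ?N * norm (w - v))"
    proof (rule differentiable_bound_linearization[where f="\<lambda>v. u (x, v)" and S="cball v (norm (w - v))"])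
      show "v + t *\<^sub>R (w - v) \<in> cball v (norm (w - v))" if "t \<in> {0..1}" for t
        using that by (auto simp: dist_norm mult_left_le_one_le)
      show "((\<lambda>v. u (x, v)) has_derivative (\<lambda>d. partial (0, d) u (x, y))) (at y within cball v (norm (w - v)))" for y
        by (rule has_derivative_at_withinI[OF has_derivative_slice_snd[OF d]])
      show "onorm ((\<lambda>d. partial (0, d) u (x, y)) - (\<lambda>d. partial (0, d) u (x, v))) \<le> K / (1 + norm x) ^ ?N * norm (w - v)"
        if y: "y \<in> cball v (norm (w - v))" for y
      proof (rule onorm_le)
        fix d
        have "((\<lambda>d. partial (0, d) u (x, y)) - (\<lambda>d. partial (0, d) u (x, v))) d
            = (\<Sum>b\<in>Basis. (d \<bullet> b) *\<^sub>R (partial (0, b) u (x, y) - partial (0, b) u (x, v)))"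
          unfolding fun_diff_def partial_Pair_sum[OF d, of d] by (simp add: sum_subtractf scaleR_diff_right)
        also have "norm \<dots> \<le> (\<Sum>b\<in>Basis. norm d * (M b / (1 + norm x) ^ ?N * norm (w - v)))"
        proof (rule sum_norm_le)
          fix b :: "real^3" assume b: "b \<in> Basis"
          have "norm (partial (0, b) u (x, y) - partial (0, b) u (x, v)) \<le> (M b / (1 + norm x) ^ ?N) * norm (y - v)"
            using M(2)[OF b] .
          also have "\<dots> \<le> (M b / (1 + norm x) ^ ?N) * norm (w - v)"
            using y M(1)[OF b] by (intro mult_left_mono) (auto simp: dist_norm norm_minus_commute)
          finally show "norm ((d \<bullet> b) *\<^sub>R (partial (0, b) u (x, y) - partial (0, b) u (x, v)))
              \<le> norm d * (M b / (1 + norm x) ^ ?N * norm (w - v))"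
            using b unfolding norm_scaleR by (intro mult_mono) (auto simp: Basis_le_norm)
        qed
        also have "\<dots> = K / (1 + norm x) ^ ?N * norm (w - v) * norm d"
          unfolding K_def by (simp only: sum_distrib_left[symmetric] sum_distrib_right[symmetric] sum_divide_distrib[symmetric]) simp
        finally show "norm (((\<lambda>d. partial (0, d) u (x, y)) - (\<lambda>d. partial (0, d) u (x, v))) d)
            \<le> K / (1 + norm x) ^ ?N * norm (w - v) * norm d" .
      qed
    qed simp
    then show ?thesis by (simp add: power2_eq_square mult_ac)
  qed
  define I where "I = (LINT x|lborel. K / (1 + norm (x::real^3)) ^ ?N)"
  have I: "I \<ge> 0" unfolding I_def using K by (intro integral_nonneg_AE) (auto intro!: divide_nonneg_nonneg)
  have est: "norm (fourier_x u \<xi> w - fourier_x u \<xi> v - fourier_x (partial (0, w - v) u) \<xi> v) \<le> (norm (w - v))\<^sup>2 * I" for w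
  proof -
    have "fourier_x u \<xi> w - fourier_x u \<xi> v - fourier_x (partial (0, w - v) u) \<xi> v
        = ft (\<lambda>x. u (x, w) - u (x, v) - partial (0, w - v) u (x, v)) \<xi>"
      unfolding fourier_x_eq_ft
      by (simp add: ft_diff schwartz_slice_integrable[OF u] int)
    also have "norm \<dots> \<le> (LINT x|lborel. norm (u (x, w) - u (x, v) - partial (0, w - v) u (x, v)))"
      by (intro norm_ft_le Bochner_Integration.integrable_diff schwartz_slice_integrable[OF u] int)
    also have "\<dots> \<le> (LINT x|lborel. (norm (w - v))\<^sup>2 * (K / (1 + norm (x::real^3)) ^ ?N))"
    proof (rule Bochner_Integration.integral_mono)
      show "integrable lborel (\<lambda>x. norm (u (x, w) - u (x, v) - partial (0, w - v) u (x, v)))"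
        by (intro integrable_norm Bochner_Integration.integrable_diff schwartz_slice_integrable[OF u] int)
      show "integrable lborel (\<lambda>x::real^3. (norm (w - v))\<^sup>2 * (K / (1 + norm x) ^ ?N))"
        by (rule integrable_mult_right) (rule integrable_decay)
    qed (rule taylor)
    also have "\<dots> = (norm (w - v))\<^sup>2 * I" unfolding I_def by (rule integral_mult_right_zero)
    finally show ?thesis .
  qed
  show ?thesis unfolding has_derivative_at_alt
  proof (intro conjI bl allI impI)
    fix e :: real assume e: "e > 0"
    show "\<exists>d>0. \<forall>w. norm (w - v) < d \<longrightarrow> norm (fourier_x u \<xi> w - fourier_x u \<xi> v - fourier_x (partial (0, w - v) u) \<xi> v) \<le> e * norm (w - v)"
    \<comment> \<open>The integrated remainder constant \<open>I\<close> may vanish, hence I + 1 in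
      the denominator.\<close>
    proof (intro exI[of _ "e / (I + 1)"] conjI allI impI)
      show "e / (I + 1) > 0" using e I by simp
      fix w assume w: "norm (w - v) < e / (I + 1)"
      have "norm (w - v) * I \<le> e / (I + 1) * (I + 1)" using w I e by (intro mult_mono) auto
      then have "norm (w - v) * I \<le> e" using I by simp
      then have "norm (w - v) * I * norm (w - v) \<le> e * norm (w - v)" by (rule mult_right_mono) simp
      then show "norm (fourier_x u \<xi> w - fourier_x u \<xi> v - fourier_x (partial (0, w - v) u) \<xi> v) \<le> e * norm (w - v)"
        using est[of w] by (simp add: power2_eq_square mult_ac)
    qed
  qed
qed

lemma fourier_x_partial:
  assumes u: "schwartz u"
  shows "fourier_x u \<xi> differentiable (at v)" "partial d (fourier_x u \<xi>) v = fourier_x (partial (0, d) u) \<xi> v"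
  using fourier_x_has_derivative[OF u] partial_eqI unfolding differentiable_def by blast+

lemma fourier_x_decay:
  assumes u: "schwartz u"
  shows "\<exists>B. \<forall>v. (1 + norm v) ^ k * norm (fourier_x u \<xi> v) \<le> B"
proof -
  let ?N = "2 * DIM(real^3)"
  \<comment> \<open>The decay of \<open>u\<close> is split: k powers go to v, and the remaining
    \<open>?N\<close> powers make the integral over x converge.\<close>
  obtain B where B: "\<And>z. (1 + norm z) ^ (k + ?N) * norm (u z) \<le> B" "B > 0"
    using rapidD[OF schwartz_rapid[OF u]] by blast
  have bd: "norm (u (x, v)) \<le> (B / (1 + norm v) ^ k) / (1 + norm x) ^ ?N" for x v
  proof -
    have "(1 + norm v) ^ k * (1 + norm x) ^ ?N * norm (u (x, v)) \<le> (1 + norm (x, v)) ^ k * (1 + norm (x, v)) ^ ?N * norm (u (x, v))"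
      by (intro mult_right_mono mult_mono power_mono) (auto simp: norm_Pair_ge)
    also have "\<dots> \<le> B" using B(1)[of "(x, v)"] by (simp add: power_add)
    finally have "norm (u (x, v)) * ((1 + norm v) ^ k * (1 + norm x) ^ ?N) \<le> B" by (simp only: mult_ac)
    then have "norm (u (x, v)) \<le> B / ((1 + norm v) ^ k * (1 + norm x) ^ ?N)"
      by (subst pos_le_divide_eq) (auto intro!: mult_pos_pos zero_less_power add_pos_nonneg)
    then show ?thesis by (simp only: divide_divide_eq_left)
  qed
  have "(1 + norm v) ^ k * norm (fourier_x u \<xi> v) \<le> (LINT x|lborel. B / (1 + norm (x::real^3)) ^ ?N)" for v
  proof -
    have pos: "(1 + norm v) ^ k > 0" by (auto intro!: zero_less_power add_pos_nonneg)
    have "norm (fourier_x u \<xi> v) \<le> (LINT x|lborel. norm (u (x, v)))"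
      unfolding fourier_x_eq_ft by (intro norm_ft_le schwartz_slice_integrable u)
    also have "\<dots> \<le> (LINT x|lborel. (B / (1 + norm v) ^ k) / (1 + norm (x::real^3)) ^ ?N)"
      by (intro integral_mono integrable_norm schwartz_slice_integrable u integrable_decay bd)
    finally have "(1 + norm v) ^ k * norm (fourier_x u \<xi> v) \<le> (1 + norm v) ^ k * (LINT x|lborel. (B / (1 + norm v) ^ k) / (1 + norm (x::real^3)) ^ ?N)"
      using pos by (intro mult_left_mono) auto
    also have "\<dots> = (LINT x|lborel. (1 + norm v) ^ k * ((B / (1 + norm v) ^ k) / (1 + norm (x::real^3)) ^ ?N))"
      by (rule integral_mult_right_zero[symmetric])
    also have "\<dots> = (LINT x|lborel. B / (1 + norm (x::real^3)) ^ ?N)"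
    proof (intro Bochner_Integration.integral_cong refl)
      have "p * ((B / p) / D) = B / D" if "p > 0" for p D :: real using that by simp
      from this[OF pos] show "(1 + norm v) ^ k * ((B / (1 + norm v) ^ k) / (1 + norm x) ^ ?N) = B / (1 + norm x) ^ ?N" for x :: "real^3" .
    qed
    finally show ?thesis .
  qed
  then show ?thesis by blast
qed

text \<open>Velocity derivatives commute with the transform in x, so the transforms of all Schwartz
  functions at a fixed \<xi> form a class as \<open>schwartz_coinduct\<close> requires.\<close>

lemma schwartz_fourier_x: "schwartz u \<Longrightarrow> schwartz (fourier_x u \<xi>)"
proof (rule schwartz_coinduct[of "\<lambda>f. \<exists>u. schwartz u \<and> f = fourier_x u \<xi>"])
  fix g and b :: "real^3" assume "\<exists>u. schwartz u \<and> g = fourier_x u \<xi>" "b \<in> Basis"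
  then obtain u where u: "schwartz u" "g = fourier_x u \<xi>" by blast
  have "partial b g = fourier_x (partial (0, b) u) \<xi>"
    using fourier_x_partial(2)[OF u(1)] u(2) by blast
  then show "\<exists>u. schwartz u \<and> partial b g = fourier_x u \<xi>"
    using schwartz_partial[OF u(1) zero_prod_in_Basis[OF \<open>b \<in> Basis\<close>]] by blast
qed (use fourier_x_partial fourier_x_decay in blast)+

text \<open>The x-derivative of the character times \<open>u\<close> integrates to 0, and its two
  product-rule terms are the two sides of the claim up to a factor \<i>.\<close>

lemma fourier_x_Dx:
  assumes u: "schwartz u"
  shows "fourier_x (Dx j u) \<xi> v = complex_of_real (\<xi> $ j) * fourier_x u \<xi> v"
proof -
  have d: "u differentiable (at z)" for z using u by (rule schwartz_differentiable)
  let ?e = "axis j 1 :: real^3"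
  have e: "?e \<in> Basis" by (simp add: axis_in_Basis_iff)
  define c where "c x = cis (- (x \<bullet> \<xi>))" for x :: "real^3"
  have dc: "(c has_derivative (\<lambda>d. complex_of_real (- (d \<bullet> \<xi>)) * (\<i> * c x))) (at x)" for x
  proof -
    have "bounded_linear (\<lambda>x. \<i> * complex_of_real (- (x \<bullet> \<xi>)))"
      by (intro bounded_linear_const_mult bounded_linear_compose[OF bounded_linear_of_real]
        bounded_linear_minus bounded_linear_inner_left)
    from has_derivative_compose[OF bounded_linear_imp_has_derivative[OF this] DERIV_exp[unfolded has_field_derivative_def]]
    show ?thesis unfolding c_def cis_conv_exp by (simp add: mult_ac)
  qed
  have c1: "slow1 c"
  proof -
    have "continuous_on UNIV c"
      by (rule continuous_on_differentiable) (use dc in \<open>auto simp: differentiable_def\<close>)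
    moreover have "norm (c x) \<le> 1 * (1 + norm x) ^ 0" for x unfolding c_def by simp
    ultimately have nc: "slow c" unfolding slow_def by blast
    moreover have "partial b c = (\<lambda>x. complex_of_real (- (b \<bullet> \<xi>)) * (\<i> * c x))" for b
      using partial_eqI[OF dc] by blast
    ultimately show ?thesis unfolding slow1_def using dc nc
      by (auto simp: differentiable_def intro!: slow_minus slow_mult)
  qed
  have s1: "rapid1 (\<lambda>x. u (x, v))" by (rule schwartz_slice_rapid1[OF u])
  have r: "rapid1 (\<lambda>x. c x * u (x, v))" by (rule rapid1_mult[OF c1 s1])
  have p: "partial ?e (\<lambda>x. c x * u (x, v)) x = c x * partial (?e, 0) u (x, v) - \<i> * (\<xi> $ j) * (c x * u (x, v))" for x
    using partial_mult[OF slow1D(1)[OF c1] rapid1D(1)[OF s1], of ?e x] partial_slice_fst(2)[OF d]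
    by (simp add: partial_eqI[OF dc] inner_axis' mult_ac)
  have i1: "integrable lborel (\<lambda>x. c x * u (x, v))" by (intro integrable_rapid rapid1D(2) r)
  have i2: "integrable lborel (\<lambda>x. c x * partial (?e, 0) u (x, v))"
    unfolding c_def integrable_cis_mult_iff
    by (intro schwartz_slice_integrable schwartz_partial u prod_zero_in_Basis e)
  have "(LINT x|lborel. c x * partial (?e, 0) u (x, v)) - \<i> * (\<xi> $ j) * (LINT x|lborel. c x * u (x, v)) = 0"
    using integral_partial_eq_0[OF r e] i1 i2 unfolding p by simp
  then have "fourier_x (partial (?e, 0) u) \<xi> v = \<i> * (\<xi> $ j) * fourier_x u \<xi> v"
    unfolding fourier_x_def c_def by simp
  moreover have "fourier_x (Dx j u) \<xi> v = inverse \<i> * fourier_x (partial (?e, 0) u) \<xi> v"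
    unfolding fourier_x_eq_ft Dx_def by (rule ft_cmult)
  ultimately show ?thesis by (simp add: mult.assoc[symmetric])
qed

section \<open>The translation and rotation fields\<close>

text \<open>\<open>Inl j\<close> stands for \<open>\<partial>\<close> in direction \<open>j\<close> and \<open>Inr j\<close> for the rotation field, the \<open>j\<close>-th component of
  \<open>v \<and> \<nabla>\<close>; both kinds of fields are divergence-free.\<close>

definition fld :: "3 + 3 \<Rightarrow> real^3 \<Rightarrow> real^3" where
  "fld \<alpha> v = (case \<alpha> of Inl j \<Rightarrow> axis j 1 | Inr j \<Rightarrow> cross3 (axis j 1) v)"

definition tder :: "3 + 3 \<Rightarrow> (real^3 \<Rightarrow> 'b::real_normed_vector) \<Rightarrow> real^3 \<Rightarrow> 'b" where
  "tder \<alpha> f v = partial (fld \<alpha> v) f v"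

lemma sum_UNIV_Plus:
  fixes g :: "'a::finite + 'b::finite \<Rightarrow> 'c::comm_monoid_add"
  shows "(\<Sum>\<alpha>\<in>UNIV. g \<alpha>) = (\<Sum>j\<in>UNIV. g (Inl j)) + (\<Sum>j\<in>UNIV. g (Inr j))"
  by (simp add: UNIV_Plus_UNIV[symmetric] sum.Plus del: UNIV_Plus_UNIV)

lemma norm_cross3_le: "norm (cross3 x y) \<le> norm x * norm y"
proof (rule power2_le_imp_le)
  show "(norm (cross3 x y))\<^sup>2 \<le> (norm x * norm y)\<^sup>2"
    using norm_cross_dot[of x y] zero_le_power2[of "x \<bullet> y"] by linarith
qed simp

lemma bracket_ge_1: "1 \<le> bracket v" unfolding bracket_def by simp

lemma bracket_pos [simp]: "0 < bracket v" using bracket_ge_1[of v] by linarith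

lemma bracket_nonneg [simp]: "0 \<le> bracket v" using bracket_pos[of v] by linarith

lemma bracket_sq: "(bracket v)\<^sup>2 = 1 + (norm v)\<^sup>2" unfolding bracket_def by simp

lemma norm_le_bracket: "norm v \<le> bracket v"
  unfolding bracket_def by (rule real_le_rsqrt) simp

lemma norm_fld_le: "norm (fld \<alpha> v) \<le> bracket v"
proof (cases \<alpha>)
  case (Inl j) then show ?thesis using bracket_ge_1 by (simp add: fld_def)
next
  case (Inr j)
  have "norm (cross3 (axis j 1) v) \<le> norm (axis j 1 :: real^3) * norm v" by (rule norm_cross3_le)
  then show ?thesis using Inr norm_le_bracket[of v] by (simp add: fld_def)
qed

lemma bounded_linear_cross3: "bounded_linear (cross3 a)"
  using bilinear_cross unfolding bilinear_def by (auto simp: linear_conv_bounded_linear)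

lemma slow_fld [simp]: "slow (fld \<alpha>)"
  unfolding fld_def by (cases \<alpha>) (auto intro: slow_bounded_linear bounded_linear_cross3)

lemma slow1_fld_inner: "slow1 (\<lambda>v. fld \<alpha> v \<bullet> b)"
  unfolding fld_def
  by (cases \<alpha>) (auto intro!: slow1_bounded_linear bounded_linear_inner_left_comp bounded_linear_cross3)

lemma partial_fld_inner: "partial d (\<lambda>v. fld \<alpha> v \<bullet> b) v = (case \<alpha> of Inl j \<Rightarrow> 0 | Inr j \<Rightarrow> cross3 (axis j 1) d \<bullet> b)"
proof (cases \<alpha>)
  case (Inr j)
  have "bounded_linear (\<lambda>v. cross3 (axis j 1) v \<bullet> b)"
    by (intro bounded_linear_inner_left_comp bounded_linear_cross3)
  then show ?thesis using Inr by (simp add: fld_def partial_bounded_linear)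
qed (simp add: fld_def)

lemma rapid_tder: "rapid1 g \<Longrightarrow> rapid (tder \<alpha> g)"
  unfolding tder_def[abs_def] by (rule rapid_partial) simp_all

lemma slow_tder: "slow1 g \<Longrightarrow> slow (tder \<alpha> g)"
  unfolding tder_def[abs_def] by (rule slow_partial) simp_all

text \<open>The b-th component of a rotation field does not vary with the b-th coordinate, because a
  basis vector is orthogonal to its cross products. Hence a field derivative is a divergence, a sum
  of coordinate derivatives of rapidly decreasing functions.\<close>

lemma integral_tder_eq_0:
  fixes h :: "real^3 \<Rightarrow> real"
  assumes h: "rapid1 h"
  shows "(LINT v|lborel. tder \<alpha> h v) = 0"
proof -
  have r: "rapid1 (\<lambda>v. (fld \<alpha> v \<bullet> b) *\<^sub>R h v)" for b
    by (rule rapid1_scaleR[OF slow1_fld_inner h])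
  have "tder \<alpha> h v = (\<Sum>b\<in>Basis. partial b (\<lambda>v. (fld \<alpha> v \<bullet> b) *\<^sub>R h v) v)" for v
  proof -
    have "partial b (\<lambda>v. (fld \<alpha> v \<bullet> b) *\<^sub>R h v) v = (fld \<alpha> v \<bullet> b) *\<^sub>R partial b h v" for b
    proof -
      have "partial b (\<lambda>v. fld \<alpha> v \<bullet> b) v = 0"
        unfolding partial_fld_inner by (cases \<alpha>) (simp_all add: dot_cross_self)
      then show ?thesis
        using partial_scaleR[OF slow1D(1)[OF slow1_fld_inner] rapid1D(1)[OF h]] by simp
    qed
    then show ?thesis unfolding tder_def partial_sum_Basis[OF rapid1D(1)[OF h], of "fld \<alpha> v"] by simp
  qed
  then have "(LINT v|lborel. tder \<alpha> h v) = (\<Sum>b\<in>Basis. (LINT v|lborel. partial b (\<lambda>v. (fld \<alpha> v \<bullet> b) *\<^sub>R h v) v))"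
    using r by (simp add: Bochner_Integration.integral_sum integrable_rapid rapid1D del: real_scaleR_def)
  also have "\<dots> = 0" using integral_partial_eq_0[OF r] by (intro sum.neutral ballI)
  finally show ?thesis .
qed

text \<open>The form in which the integrations by parts of the energy method are done: the
  inequality is checked at each point with explicit fluxes \<open>h \<alpha>\<close>, and the field
  derivatives of the fluxes integrate to 0.\<close>

lemma integral_mono_divergence:
  assumes L: "rapid L" and R: "rapid R" and h: "\<And>\<alpha>. rapid1 (h \<alpha>)"
    and le: "\<And>v. L v \<le> R v + (\<Sum>\<alpha>\<in>UNIV. tder \<alpha> (h \<alpha>) v)"
  shows "(LINT v|lborel. L v :: real) \<le> (LINT v|lborel. R v)"
proof -
  have r: "rapid (\<lambda>v. \<Sum>\<alpha>\<in>UNIV. tder \<alpha> (h \<alpha>) v)" by (intro rapid_sum rapid_tder h)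
  have "(LINT v|lborel. L v) \<le> (LINT v|lborel. R v + (\<Sum>\<alpha>\<in>UNIV. tder \<alpha> (h \<alpha>) v))"
    by (intro Bochner_Integration.integral_mono integrable_rapid L rapid_add R r) (rule le)
  also have "\<dots> = (LINT v|lborel. R v)"
    using integral_tder_eq_0[OF h] by (simp add: integrable_rapid R r rapid_tder h Bochner_Integration.integral_sum)
  finally show ?thesis .
qed

lemma tder_scaleR:
  "slow1 a \<Longrightarrow> slow1 g \<Longrightarrow> tder \<alpha> (\<lambda>v. a v *\<^sub>R g v) v = a v *\<^sub>R tder \<alpha> g v + tder \<alpha> a v *\<^sub>R g v"
  unfolding tder_def by (intro partial_scaleR slow1D)

lemma tder_mult:
  fixes a g :: "real^3 \<Rightarrow> 'b::real_normed_algebra"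
  shows "slow1 a \<Longrightarrow> slow1 g \<Longrightarrow> tder \<alpha> (\<lambda>v. a v * g v) v = a v * tder \<alpha> g v + tder \<alpha> a v * g v"
  unfolding tder_def by (intro partial_mult slow1D)

lemma tder_inner:
  "slow1 f \<Longrightarrow> slow1 g \<Longrightarrow> tder \<alpha> (\<lambda>v. f v \<bullet> g v) v = f v \<bullet> tder \<alpha> g v + tder \<alpha> f v \<bullet> g v"
  unfolding tder_def by (intro partial_inner slow1D)

lemma tder_cmult: "slow1 g \<Longrightarrow> tder \<alpha> (\<lambda>v. c * g v) v = c * tder \<alpha> g v" for g :: "real^3 \<Rightarrow> 'b::real_normed_algebra"
  unfolding tder_def by (intro partial_cmult slow1D)

text \<open>Moves the cross product onto fixed vectors, so that the coefficient is visibly constant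
  or linear in v and \<open>schwartz_coord\<close> applies.\<close>

lemma fld_inner_affine: "fld \<alpha> v \<bullet> b = (case \<alpha> of Inl j \<Rightarrow> axis j 1 \<bullet> b | Inr j \<Rightarrow> v \<bullet> cross3 b (axis j 1))"
  unfolding fld_def by (auto split: sum.split simp: cross3_simps)

lemma schwartz_zero: "schwartz (\<lambda>z. 0)"
  by (rule schwartz_coinduct[of "\<lambda>f. f = (\<lambda>z. 0)"]) auto

lemma schwartz_sum: "(\<And>i. i \<in> I \<Longrightarrow> schwartz (f i)) \<Longrightarrow> schwartz (\<lambda>z. \<Sum>i\<in>I. f i z)"
  by (induction I rule: infinite_finite_induct) (auto intro: schwartz_add schwartz_zero)

lemma schwartz_tder:
  assumes "schwartz f" shows "schwartz (tder \<alpha> f)"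
proof -
  have "tder \<alpha> f = (\<lambda>v. \<Sum>b\<in>Basis. complex_of_real (fld \<alpha> v \<bullet> b) * partial b f v)"
    unfolding tder_def[abs_def] partial_sum_Basis[OF schwartz_differentiable[OF assms], of "fld \<alpha> _"]
    by (simp add: scaleR_conv_of_real)
  moreover have "schwartz (\<lambda>v. complex_of_real (fld \<alpha> v \<bullet> b) * partial b f v)" if "b \<in> Basis" for b
    using assms that unfolding fld_inner_affine
    by (cases \<alpha>) (auto intro: schwartz_cmult schwartz_coord schwartz_partial)
  ultimately show ?thesis by (simp add: schwartz_sum)
qed

section \<open>Weights\<close>

lemma slow_real_bound: "slow a \<Longrightarrow> continuous_on UNIV b \<Longrightarrow> (\<And>v. \<bar>b v\<bar> \<le> a v) \<Longrightarrow> slow b"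
  for a b :: "real^3 \<Rightarrow> real"
  unfolding slow_def by (metis abs_ge_self order_trans real_norm_def)

lemma slow1I_tder:
  assumes "\<And>v. f differentiable (at v)" "slow f" "\<And>j. slow (tder (Inl j) f)"
  shows "slow1 f"
proof -
  have "slow (partial b f)" if b: "b \<in> Basis" for b
  proof -
    obtain j where "b = axis j 1" using b unfolding Basis_vec_def Basis_real_def by auto
    then have "partial b f = tder (Inl j) f" by (simp add: tder_def[abs_def] fld_def)
    then show ?thesis using assms by simp
  qed
  then show ?thesis using assms unfolding slow1_def by blast
qed

text \<open>For s >= 0 polynomial growth survives after rounding s up to an integer; for s < 0 the
  positive lower bound of \<open>P\<close> makes the power bounded.\<close>

lemma slow_powr:
  fixes P :: "real^3 \<Rightarrow> real"
  assumes P: "slow P" and P0: "P0 > 0" "\<And>v. P0 \<le> P v"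
  shows "slow (\<lambda>v. P v powr s)"
proof -
  have pos: "P v > 0" for v using P0(1) P0(2)[of v] by linarith
  obtain k B where B: "B > 0" "\<And>v. norm (P v) \<le> B * (1 + norm v) ^ k" using slowD[OF P] by blast
  have cont: "continuous_on UNIV (\<lambda>v. P v powr s)"
    using P pos unfolding slow_def by (intro continuous_on_powr) (auto simp: less_imp_neq[symmetric])
  show ?thesis
  proof (cases "s \<ge> 0")
    case True
    define n where "n = nat \<lceil>s\<rceil>"
    have n: "s \<le> real n" unfolding n_def using True by (simp add: of_nat_ceiling)
    have "norm (P v powr s) \<le> (B powr s) * (1 + norm v) ^ (k * n)" for v
    proof -
      have v: "1 + norm v \<ge> 1" by simp
      have "P v powr s \<le> (B * (1 + norm v) ^ k) powr s"
        using B(2)[of v] pos[of v] True by (intro powr_mono2) auto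
      also have "\<dots> = B powr s * ((1 + norm v) ^ k) powr s"
        by (rule powr_mult)
      also have "\<dots> \<le> B powr s * ((1 + norm v) ^ k) powr real n"
        using n v by (intro mult_left_mono powr_mono) auto
      also have "((1 + norm v) ^ k) powr real n = (1 + norm v) ^ (k * n)"
        using powr_realpow[of "(1 + norm v) ^ k" n] by (simp add: power_mult add_pos_nonneg)
      finally show ?thesis by simp
    qed
    then show ?thesis unfolding slow_def using cont by blast
  next
    case False
    have "norm (P v powr s) \<le> P0 powr s * (1 + norm v) ^ 0" for v
      using False P0(1) P0(2)[of v] by (simp add: powr_mono2')
    then show ?thesis unfolding slow_def using cont by blast
  qed
qed

section \<open>First derivatives of powers of the weights\<close>

lemma tder_powr:
  fixes P :: "real^3 \<Rightarrow> real"
  assumes "P differentiable (at v)" "P v > 0"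
  shows "(\<lambda>v. P v powr s) differentiable (at v)"
    "tder \<alpha> (\<lambda>v. P v powr s) v = s * P v powr (s - 1) * tder \<alpha> P v"
proof -
  have "((\<lambda>v. P v powr s) has_derivative (\<lambda>d. P v powr s * (0 * ln (P v) + partial d P v * s / P v))) (at v)"
    by (rule has_derivative_powr[OF has_derivative_partial[OF assms(1)] has_derivative_const assms(2)]) simp
  then have *: "((\<lambda>v. P v powr s) has_derivative (\<lambda>d. s * P v powr (s - 1) * partial d P v)) (at v)"
    using assms(2) by (simp add: powr_diff mult_ac)
  then show "(\<lambda>v. P v powr s) differentiable (at v)" unfolding differentiable_def by blast
  show "tder \<alpha> (\<lambda>v. P v powr s) v = s * P v powr (s - 1) * tder \<alpha> P v"
    unfolding tder_def by (rule partial_eqI[OF *])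
qed

lemma slow1_powr:
  fixes P :: "real^3 \<Rightarrow> real"
  assumes P: "slow1 P" and P0: "P0 > 0" "\<And>v. P0 \<le> P v"
  shows "slow1 (\<lambda>v. P v powr s)"
proof (rule slow1I_tder)
  have pos: "P v > 0" for v using P0(1) P0(2)[of v] by linarith
  show "(\<lambda>v. P v powr s) differentiable (at v)" for v
    by (rule tder_powr[OF slow1D(1)[OF P] pos])
  show "slow (\<lambda>v. P v powr s)" by (rule slow_powr[OF slow1D(2)[OF P] P0])
  have "tder (Inl j) (\<lambda>v. P v powr s) = (\<lambda>v. (s * P v powr (s - 1)) * tder (Inl j) P v)" for j
    using tder_powr(2)[OF slow1D(1)[OF P] pos] by blast
  then show "slow (tder (Inl j) (\<lambda>v. P v powr s))" for j
    by (simp only:) (intro slow_mult slow_const slow_powr[OF slow1D(2)[OF P] P0] slow_tder P)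
qed

definition msq :: "real^3 \<Rightarrow> real^3 \<Rightarrow> real" where
  "msq \<xi> v = (norm \<xi>)\<^sup>2 + (norm (cross3 \<xi> v))\<^sup>2"

definition mm :: "real^3 \<Rightarrow> real^3 \<Rightarrow> real" where
  "mm \<xi> v = sqrt (msq \<xi> v)"

lemma has_derivative_norm_sq:
  fixes L :: "'a::euclidean_space \<Rightarrow> 'b::real_inner"
  assumes "bounded_linear L"
  shows "((\<lambda>v. (norm (L v))\<^sup>2) has_derivative (\<lambda>d. 2 * (L v \<bullet> L d))) (at v)"
proof -
  have "(L has_derivative L) (at v)" by (rule bounded_linear_imp_has_derivative[OF assms])
  from has_derivative_inner[OF this this] show ?thesis
    by (simp add: power2_norm_eq_inner inner_commute)
qed

lemma slow1_norm_sq: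
  fixes L :: "real^3 \<Rightarrow> real^3"
  assumes L: "bounded_linear L" shows "slow1 (\<lambda>v. c + (norm (L v))\<^sup>2)"
proof -
  have s: "slow1 L" using L by (rule slow1_bounded_linear)
  have "slow1 (\<lambda>v. c + L v \<bullet> L v)"
    by (intro slow1_add slow1_const slow1_bounded_bilinear[OF bounded_bilinear_inner] s)
  then show ?thesis by (simp add: power2_norm_eq_inner)
qed

lemma tder_norm_sq:
  fixes L :: "real^3 \<Rightarrow> real^3"
  assumes L: "bounded_linear L" shows "tder \<alpha> (\<lambda>v. c + (norm (L v))\<^sup>2) v = 2 * (L v \<bullet> L (fld \<alpha> v))"
  unfolding tder_def
  using partial_eqI[OF has_derivative_add[OF has_derivative_const has_derivative_norm_sq[OF L]]] by simp

lemma bracket_powr: "bracket v powr s = (1 + (norm v)\<^sup>2) powr (s / 2)"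
  unfolding bracket_def by (subst powr_half_sqrt[symmetric]) (simp_all add: powr_powr)

lemma msq_ge: "(norm \<xi>)\<^sup>2 \<le> msq \<xi> v" unfolding msq_def by simp

lemma msq_pos: "\<xi> \<noteq> 0 \<Longrightarrow> msq \<xi> v > 0" unfolding msq_def by (simp add: add_pos_nonneg)

lemma mm_pos: "\<xi> \<noteq> 0 \<Longrightarrow> mm \<xi> v > 0" unfolding mm_def by (simp add: msq_pos)

lemma mm_sq: "(mm \<xi> v)\<^sup>2 = msq \<xi> v" unfolding mm_def msq_def by simp

lemma mm_powr: "mm \<xi> v powr s = msq \<xi> v powr (s / 2)"
  unfolding mm_def by (subst powr_half_sqrt[symmetric]) (simp_all add: powr_powr msq_def)

lemma norm_le_mm: "norm \<xi> \<le> mm \<xi> v" "norm (cross3 \<xi> v) \<le> mm \<xi> v"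
  unfolding mm_def msq_def by (rule real_le_rsqrt; simp)+

lemma slow1_bracket_powr: "slow1 (\<lambda>v. bracket v powr s)"
  unfolding bracket_powr
  by (rule slow1_powr[where ?P0.0=1]) (use slow1_norm_sq[OF bounded_linear_ident] in auto)

text \<open>For \<xi> different from 0 the base \<open>msq \<xi> v\<close> is at least |\<xi>|^2 at
  every v, which admits the negative power in \<open>omega\<close>.\<close>

lemma slow1_mm_powr: "\<xi> \<noteq> 0 \<Longrightarrow> slow1 (\<lambda>v. mm \<xi> v powr s)"
  unfolding mm_powr
  by (rule slow1_powr[where ?P0.0="(norm \<xi>)\<^sup>2"])
    (use msq_ge slow1_norm_sq[OF bounded_linear_cross3] in \<open>auto simp: msq_def[abs_def]\<close>)

text \<open>No power of <v> is lost: a field of length up to <v> meets a gradient one order smaller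
  than the weight.\<close>

lemma tder_bracket_powr:
  "\<bar>tder \<alpha> (\<lambda>v. bracket v powr s) v\<bar> \<le> \<bar>s\<bar> * bracket v powr s"
proof -
  let ?P = "\<lambda>v::real^3. 1 + (norm v)\<^sup>2"
  have P: "?P v > 0" by (simp add: add_pos_nonneg)
  have d: "?P differentiable (at v)" using slow1D(1)[OF slow1_norm_sq[OF bounded_linear_ident]] .
  have eq: "tder \<alpha> (\<lambda>v. bracket v powr s) v = s / 2 * ?P v powr (s / 2 - 1) * (2 * (v \<bullet> fld \<alpha> v))"
    unfolding bracket_powr using tder_powr(2)[OF d P] tder_norm_sq[OF bounded_linear_ident] by simp
  have "\<bar>v \<bullet> fld \<alpha> v\<bar> \<le> norm v * norm (fld \<alpha> v)" by (rule Cauchy_Schwarz_ineq2)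
  also have "\<dots> \<le> bracket v * bracket v" by (intro mult_mono norm_le_bracket norm_fld_le) auto
  also have "\<dots> = ?P v" using bracket_sq[of v] by (simp add: power2_eq_square)
  finally have "\<bar>v \<bullet> fld \<alpha> v\<bar> \<le> ?P v" .
  then have "\<bar>s\<bar> * ?P v powr (s / 2 - 1) * \<bar>v \<bullet> fld \<alpha> v\<bar> \<le> \<bar>s\<bar> * ?P v powr (s / 2 - 1) * ?P v"
    by (intro mult_left_mono) auto
  also have "\<dots> = \<bar>s\<bar> * ?P v powr (s / 2)" using P by (simp add: powr_diff)
  finally show "\<bar>tder \<alpha> (\<lambda>v. bracket v powr s) v\<bar> \<le> \<bar>s\<bar> * bracket v powr s"
    unfolding eq by (simp add: abs_mult bracket_powr)
qed

text \<open>A factor <v> is lost: the field enters through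
  \<open>cross3 \<xi> (fld \<alpha> v)\<close>, of size at most |\<xi>| <v>, and |\<xi>| is all that
  is traded for \<open>mm\<close>. In the energy estimate the loss appears squared and matches the
  two extra powers of <v> in the lower bound for F.\<close>

lemma tder_mm_powr:
  assumes \<xi>: "\<xi> \<noteq> 0"
  shows "\<bar>tder \<alpha> (\<lambda>v. mm \<xi> v powr s) v\<bar> \<le> \<bar>s\<bar> * bracket v * mm \<xi> v powr s"
proof -
  let ?P = "\<lambda>v. (norm \<xi>)\<^sup>2 + (norm (cross3 \<xi> v))\<^sup>2"
  have P: "?P v > 0" using msq_pos[OF \<xi>] unfolding msq_def .
  have d: "?P differentiable (at v)" using slow1D(1)[OF slow1_norm_sq[OF bounded_linear_cross3]] .
  have eq: "tder \<alpha> (\<lambda>v. mm \<xi> v powr s) v = s / 2 * ?P v powr (s / 2 - 1) * (2 * (cross3 \<xi> v \<bullet> cross3 \<xi> (fld \<alpha> v)))"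
    unfolding mm_powr msq_def using tder_powr(2)[OF d P] tder_norm_sq[OF bounded_linear_cross3] by simp
  have "\<bar>cross3 \<xi> v \<bullet> cross3 \<xi> (fld \<alpha> v)\<bar> \<le> norm (cross3 \<xi> v) * norm (cross3 \<xi> (fld \<alpha> v))"
    by (rule Cauchy_Schwarz_ineq2)
  also have "\<dots> \<le> mm \<xi> v * (mm \<xi> v * bracket v)"
  proof (intro mult_mono norm_le_mm)
    have "norm (cross3 \<xi> (fld \<alpha> v)) \<le> norm \<xi> * norm (fld \<alpha> v)" by (rule norm_cross3_le)
    also have "\<dots> \<le> mm \<xi> v * bracket v"
      using norm_le_mm(1)[of \<xi> v] by (intro mult_mono norm_fld_le) (auto simp: mm_def msq_def)
    finally show "norm (cross3 \<xi> (fld \<alpha> v)) \<le> mm \<xi> v * bracket v" .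
  qed (auto simp: mm_def msq_def)
  also have "\<dots> = ?P v * bracket v" using mm_sq[of \<xi> v] by (simp add: power2_eq_square msq_def)
  finally have "\<bar>cross3 \<xi> v \<bullet> cross3 \<xi> (fld \<alpha> v)\<bar> \<le> ?P v * bracket v" .
  then have "\<bar>s\<bar> * ?P v powr (s / 2 - 1) * \<bar>cross3 \<xi> v \<bullet> cross3 \<xi> (fld \<alpha> v)\<bar> \<le> \<bar>s\<bar> * ?P v powr (s / 2 - 1) * (?P v * bracket v)"
    by (intro mult_left_mono) auto
  also have "\<dots> = \<bar>s\<bar> * bracket v * ?P v powr (s / 2)" using P by (simp add: powr_diff)
  finally show ?thesis
    unfolding eq by (simp add: abs_mult mm_powr msq_def)
qed

lemma fld_xi_sq: "(\<Sum>\<alpha>\<in>UNIV. (fld \<alpha> v \<bullet> \<xi>)\<^sup>2) = msq \<xi> v"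
  unfolding sum_UNIV_Plus msq_def fld_def power2_norm_eq_inner
  by (simp add: sum_3 cross3_simps power2_eq_square axis_def)

lemma fld_xi_le: "\<bar>fld \<alpha> v \<bullet> \<xi>\<bar> \<le> mm \<xi> v"
proof -
  have "(fld \<alpha> v \<bullet> \<xi>)\<^sup>2 \<le> (mm \<xi> v)\<^sup>2"
    unfolding mm_sq fld_xi_sq[symmetric] by (rule member_le_sum) auto
  then show ?thesis by (metis abs_le_square_iff abs_of_nonneg mm_def msq_def real_sqrt_ge_zero add_nonneg_nonneg zero_le_power2)
qed

lemma tder_fld_xi: "\<bar>tder \<alpha> (\<lambda>v. fld \<alpha> v \<bullet> \<xi>) v\<bar> \<le> bracket v * mm \<xi> v"
proof (cases \<alpha>)
  case (Inl j)
  then show ?thesis by (simp add: tder_def partial_fld_inner mm_def msq_def)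
next
  case (Inr j)
  have "\<bar>cross3 (axis j 1) (fld \<alpha> v) \<bullet> \<xi>\<bar> \<le> norm (cross3 (axis j 1) (fld \<alpha> v)) * norm \<xi>"
    by (rule Cauchy_Schwarz_ineq2)
  also have "\<dots> \<le> bracket v * mm \<xi> v"
  proof (intro mult_mono norm_le_mm)
    have "norm (cross3 (axis j 1) (fld \<alpha> v)) \<le> norm (axis j 1 :: real^3) * norm (fld \<alpha> v)" by (rule norm_cross3_le)
    then show "norm (cross3 (axis j 1) (fld \<alpha> v)) \<le> bracket v" using norm_fld_le[of \<alpha> v] by simp
  qed auto
  finally show ?thesis using Inr by (simp add: tder_def partial_fld_inner)
qed

section \<open>Energy estimates on a fibre\<close>

lemma rapid_real_mult_norm: "slow a \<Longrightarrow> rapid g \<Longrightarrow> rapid (\<lambda>v. a v * norm (g v))" for a :: "'a::euclidean_space \<Rightarrow> real"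
  by (intro rapid_mult rapid_norm)

lemma slow_norm: "slow g \<Longrightarrow> slow (\<lambda>v. norm (g v))"
  unfolding slow_def by (auto intro: continuous_on_norm)

lemma slow_power: "slow g \<Longrightarrow> slow (\<lambda>v. g v ^ n)" for g :: "'a::euclidean_space \<Rightarrow> real"
  by (induction n) (auto intro: slow_mult)

lemma rapid_power2: "rapid g \<Longrightarrow> rapid (\<lambda>v. (g v)\<^sup>2)" for g :: "'a::euclidean_space \<Rightarrow> real"
  unfolding power2_eq_square by (intro rapid_mult rapid_imp_slow)

lemma integral_rapid_mono:
  fixes a b :: "'a::euclidean_space \<Rightarrow> real"
  assumes "rapid a" "rapid b" "\<And>v. a v \<le> b v"
  shows "(LINT v|lborel. a v) \<le> (LINT v|lborel. b v)"
  using assms by (intro Bochner_Integration.integral_mono integrable_rapid)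

text \<open>The inequality of means with multipliers s and t, optimised at s = sqrt B and t = sqrt
  A.\<close>

lemma integral_Cauchy_Schwarz:
  fixes a b :: "'a::euclidean_space \<Rightarrow> real"
  assumes a: "rapid a" and b: "rapid b"
  shows "(LINT v|lborel. a v * b v) \<le> sqrt (LINT v|lborel. (a v)\<^sup>2) * sqrt (LINT v|lborel. (b v)\<^sup>2)"
proof -
  define A B P where "A = (LINT v|lborel. (a v)\<^sup>2)" and "B = (LINT v|lborel. (b v)\<^sup>2)" and "P = (LINT v|lborel. a v * b v)"
  have AB: "A \<ge> 0" "B \<ge> 0" unfolding A_def B_def by auto
  have ab: "rapid (\<lambda>v. a v * b v)" by (intro rapid_mult rapid_imp_slow a b)
  have quad: "2 * s * t * P \<le> s\<^sup>2 * A + t\<^sup>2 * B" for s t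
  proof -
    have "(LINT v|lborel. (2 * s * t) * (a v * b v)) \<le> (LINT v|lborel. s\<^sup>2 * (a v)\<^sup>2 + t\<^sup>2 * (b v)\<^sup>2)"
    proof (rule integral_rapid_mono)
      show "(2 * s * t) * (a v * b v) \<le> s\<^sup>2 * (a v)\<^sup>2 + t\<^sup>2 * (b v)\<^sup>2" for v
        using sum_squares_bound[of "s * a v" "t * b v"] by (simp add: power_mult_distrib mult_ac)
    qed (intro rapid_cmult rapid_add rapid_power2 a b ab)+
    then show ?thesis unfolding A_def B_def P_def
      by (simp add: integrable_rapid rapid_power2 a b)
  qed
  show ?thesis
  proof (cases "A = 0 \<or> B = 0")
    case True
    have "P \<le> 0"
    proof (rule ccontr)
      assume "\<not> P \<le> 0"
      then have P: "P > 0" by simp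
      \<comment> \<open>If A or B is 0, its multiplier costs nothing and may be taken large enough
        for a contradiction.\<close>
      have "2 * ((A + B + 1) / P) * 1 * P \<le> A + B"
        using quad[of "(A + B + 1) / P" 1] quad[of 1 "(A + B + 1) / P"] True by auto
      then show False using P AB by simp
    qed
    then show ?thesis using AB unfolding A_def[symmetric] B_def[symmetric] P_def[symmetric]
      by (meson mult_nonneg_nonneg order_trans real_sqrt_ge_zero)
  next
    case False
    then have pos: "A > 0" "B > 0" using AB by auto
    define x y where "x = sqrt A" and "y = sqrt B"
    have xy: "x > 0" "y > 0" "A = x\<^sup>2" "B = y\<^sup>2" using pos unfolding x_def y_def by auto
    have "2 * y * x * P \<le> y\<^sup>2 * A + x\<^sup>2 * B" by (rule quad)
    then have "(2 * y * x) * P \<le> (2 * y * x) * (x * y)" unfolding xy(3,4) by (simp add: power2_eq_square mult_ac)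
    then have "P \<le> x * y" using xy(1,2) by (subst (asm) mult_le_cancel_left_pos) auto
    then show ?thesis unfolding x_def y_def A_def B_def P_def .
  qed
qed

text \<open>The square of the third hypothesis, with the other two inserted, reads X^4 <= const X
  (q^3 + q X Z). Since Z^2 <= const X q, the term q X Z is at most const (q X)^(3/2), and half of
  X^3 absorbs it. The powers of \<open>C\<close> record how often each bound is inserted.\<close>

lemma closing_inequality:
  fixes X Y Z q C :: real
  assumes nn: "X \<ge> 0" "Y \<ge> 0" "Z \<ge> 0" "q \<ge> 0" and C: "C \<ge> 1"
    and Z: "Z\<^sup>2 \<le> C * (X * q)" and Y: "Y\<^sup>2 \<le> C * (q\<^sup>2 + X * Z)"
    and X: "X\<^sup>2 \<le> C * (sqrt (q\<^sup>2 + Y\<^sup>2) * Z)"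
  shows "X \<le> (5 * C ^ 9) * q" "Y\<^sup>2 \<le> C * (1 + 25 * C ^ 19) * q\<^sup>2"
proof -
  have C0: "C > 0" "C \<ge> 0" using C by auto
  have C1: "C ^ n \<ge> 1" for n using C by simp
  have X4: "X ^ 4 \<le> C\<^sup>2 * ((q\<^sup>2 + Y\<^sup>2) * Z\<^sup>2)"
  proof -
    have "(X\<^sup>2)\<^sup>2 \<le> (C * (sqrt (q\<^sup>2 + Y\<^sup>2) * Z))\<^sup>2" by (rule power_mono[OF X]) simp
    then show ?thesis by (simp add: power_mult_distrib)
  qed
  also have "\<dots> \<le> C\<^sup>2 * ((2 * C * q\<^sup>2 + C * (X * Z)) * (C * (X * q)))"
  proof (intro mult_left_mono mult_mono Z)
    have "1 * q\<^sup>2 \<le> C * q\<^sup>2" using C by (intro mult_right_mono) auto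
    then show "q\<^sup>2 + Y\<^sup>2 \<le> 2 * C * q\<^sup>2 + C * (X * Z)" using Y by (simp add: algebra_simps)
  qed (use nn C0 in auto)
  also have "\<dots> = X * (C ^ 4 * (2 * q ^ 3 + q * X * Z))"
    by (simp add: power2_eq_square power3_eq_cube power4_eq_xxxx algebra_simps)
  finally have "X * X ^ 3 \<le> X * (C ^ 4 * (2 * q ^ 3 + q * X * Z))"
    by (simp add: power3_eq_cube power4_eq_xxxx mult_ac)
  then have X3: "X ^ 3 \<le> C ^ 4 * (2 * q ^ 3 + q * X * Z)"
  proof (cases "X = 0")
    case True then show ?thesis using nn C0 by simp
  next
    case False
    then have "X > 0" using nn by simp
    then show ?thesis using \<open>X * X ^ 3 \<le> _\<close> by (subst (asm) mult_le_cancel_left_pos) auto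
  qed
  \<comment> \<open>Squaring turns C^4 into C^8, and the bound for Z^2 adds one more C. The
    geometric mean of X^3 and C^9 q^3 is then replaced by their arithmetic mean.\<close>
  have amgm: "C ^ 4 * (q * X * Z) \<le> (X ^ 3 + C ^ 9 * q ^ 3) / 2"
  proof (rule power2_le_imp_le)
    have "(C ^ 4 * (q * X * Z))\<^sup>2 = C ^ 8 * (q\<^sup>2 * X\<^sup>2 * Z\<^sup>2)"
      by (simp add: power_mult_distrib power_mult[symmetric])
    also have "\<dots> \<le> C ^ 8 * (q\<^sup>2 * X\<^sup>2 * (C * (X * q)))"
      using nn C0 by (intro mult_left_mono Z) auto
    also have "\<dots> = X ^ 3 * (C ^ 9 * q ^ 3)" by (simp add: eval_nat_numeral algebra_simps)
    also have "\<dots> \<le> ((X ^ 3 + C ^ 9 * q ^ 3) / 2)\<^sup>2"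
    proof -
      have "a * b \<le> ((a + b) / 2)\<^sup>2" for a b :: real
        using zero_le_power2[of "a - b"] by (simp add: power2_eq_square field_simps)
      then show ?thesis .
    qed
    finally show "(C ^ 4 * (q * X * Z))\<^sup>2 \<le> ((X ^ 3 + C ^ 9 * q ^ 3) / 2)\<^sup>2" .
  qed (use nn C0 in simp)
  have "X ^ 3 \<le> 2 * C ^ 4 * q ^ 3 + (X ^ 3 + C ^ 9 * q ^ 3) / 2"
    using X3 amgm unfolding distrib_left by linarith
  moreover have "C ^ 4 * q ^ 3 \<le> C ^ 9 * q ^ 3"
    using C nn by (intro mult_right_mono power_increasing) auto
  moreover have "x \<le> 5 * b" if "x \<le> 2 * a + (x + b) / 2" "a \<le> b" for x a b :: real
    using that by (simp add: field_simps)
  ultimately have "X ^ 3 \<le> 5 * C ^ 9 * q ^ 3" unfolding mult.assoc by blast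
  \<comment> \<open>Since 5 C^9 >= 1, it may be replaced by its cube; the right side becomes a
    perfect cube, and monotonicity gives the bound for X.\<close>
  also have "\<dots> \<le> (5 * C ^ 9) ^ 3 * q ^ 3"
  proof (rule mult_right_mono)
    have "(5 * C ^ 9) ^ 1 \<le> (5 * C ^ 9) ^ 3" using C1[of 9] by (intro power_increasing) auto
    then show "5 * C ^ 9 \<le> (5 * C ^ 9) ^ 3" by simp
  qed (use nn in simp)
  finally have "X ^ 3 \<le> (5 * C ^ 9 * q) ^ 3" by (simp add: power_mult_distrib)
  then show XB: "X \<le> (5 * C ^ 9) * q"
    using power_strict_mono[of "5 * C ^ 9 * q" X 3] nn C0 by (metis linorder_not_le mult_nonneg_nonneg
      zero_le_numeral zero_le_power zero_less_numeral)
  have "Z\<^sup>2 \<le> C * ((5 * C ^ 9) * q * q)"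
    using Z mult_left_mono[OF mult_right_mono[OF XB nn(4)] C0(2)] by linarith
  also have "\<dots> = (5 * C ^ 10) * q\<^sup>2" by (simp add: eval_nat_numeral algebra_simps)
  also have "\<dots> \<le> (5 * C ^ 10)\<^sup>2 * q\<^sup>2"
    using C1[of 10] by (intro mult_right_mono self_le_power) auto
  finally have "Z\<^sup>2 \<le> ((5 * C ^ 10) * q)\<^sup>2" by (simp add: power_mult_distrib)
  then have ZB: "Z \<le> (5 * C ^ 10) * q" by (rule power2_le_imp_le) (use nn C0 in simp)
  have "X * Z \<le> ((5 * C ^ 9) * q) * ((5 * C ^ 10) * q)"
    by (intro mult_mono XB ZB) (use nn C0 in auto)
  also have "\<dots> = 25 * C ^ 19 * q\<^sup>2" by (simp add: eval_nat_numeral algebra_simps)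
  finally have "q\<^sup>2 + X * Z \<le> (1 + 25 * C ^ 19) * q\<^sup>2" by (simp add: algebra_simps)
  then have "C * (q\<^sup>2 + X * Z) \<le> C * ((1 + 25 * C ^ 19) * q\<^sup>2)" using C0 by (intro mult_left_mono) auto
  then show "Y\<^sup>2 \<le> C * (1 + 25 * C ^ 19) * q\<^sup>2" using Y by (simp add: mult.assoc)
qed

section \<open>The elliptic operator, the fibre operator and the basic energy identity\<close>

definition coef :: "(real^3 \<Rightarrow> real) \<Rightarrow> (real^3 \<Rightarrow> real) \<Rightarrow> 3 + 3 \<Rightarrow> real^3 \<Rightarrow> real" where
  "coef lam mu \<alpha> v = (case \<alpha> of Inl j \<Rightarrow> lam v | Inr j \<Rightarrow> mu v)"

text \<open>The two factors 1/i in each second-order term produce the minus sign; with positive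
  coefficients the operator is nonnegative.\<close>

definition diffop where
  "diffop lam mu F f v = - (\<Sum>\<alpha>\<in>UNIV. tder \<alpha> (\<lambda>v. coef lam mu \<alpha> v *\<^sub>R tder \<alpha> f v) v) + F v *\<^sub>R (f v :: complex)"

text \<open>The operator \<open>P\<close> after a partial Fourier transform in \<open>x\<close>, with \<open>\<xi>\<close> as a parameter.\<close>
definition fibre_op where
  "fibre_op lam mu F \<xi> f v = diffop lam mu F f v + \<i> * complex_of_real (v \<bullet> \<xi>) * f v"

definition grad_sq :: "(real^3 \<Rightarrow> complex) \<Rightarrow> real^3 \<Rightarrow> real" where
  "grad_sq f v = (\<Sum>\<alpha>\<in>UNIV. (norm (tder \<alpha> f v))\<^sup>2)"

definition grad_sum :: "(real^3 \<Rightarrow> complex) \<Rightarrow> real^3 \<Rightarrow> real" where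
  "grad_sum f v = (\<Sum>\<alpha>\<in>UNIV. norm (tder \<alpha> f v))"

lemma grad_sum_sq: "(grad_sum f v)\<^sup>2 \<le> 6 * grad_sq f v"
  using sum_squared_le_sum_of_squares[of "\<lambda>\<alpha>. norm (tder \<alpha> f v)" "UNIV :: (3 + 3) set"]
  unfolding grad_sum_def grad_sq_def by (simp add: mult.commute)

lemma grad_sq_nonneg: "0 \<le> grad_sq f v" unfolding grad_sq_def by (intro sum_nonneg) auto

lemma grad_sum_nonneg: "0 \<le> grad_sum f v" unfolding grad_sum_def by (intro sum_nonneg) auto

lemma slow_bracket_powr: "slow (\<lambda>v. bracket v powr s)" by (rule slow1D(2)[OF slow1_bracket_powr])

lemma bracket_powr_mult: "bracket v powr s * bracket v powr t = bracket v powr (s + t)"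
  by (simp add: powr_add)

text \<open>Interpolates between the weights <v>^(2\<gamma>+4) and 1, splitting at <v>^2 = 1/e. In
  the low-velocity region \<gamma> <= 1 gives 2\<gamma> + 2 <= 4, whence the constant 1/e^2.\<close>

lemma bracket_powr_Young:
  assumes "\<gamma> \<le> 1" "e > 0"
  shows "bracket v powr (2 * \<gamma> + 2) \<le> e * bracket v powr (2 * \<gamma> + 4) + 1 / e\<^sup>2"
proof (cases "bracket v powr 2 \<ge> 1 / e")
  case True
  have "bracket v powr (2 * \<gamma> + 2) * 1 \<le> bracket v powr (2 * \<gamma> + 2) * (e * bracket v powr 2)"
    using True assms(2) by (intro mult_left_mono) (auto simp: field_simps)
  also have "\<dots> = e * bracket v powr (2 * \<gamma> + 4)"
    using bracket_powr_mult[of v "2 * \<gamma> + 2" 2] by (simp add: algebra_simps)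
  finally show ?thesis using assms(2) by (simp add: add_increasing2)
next
  case False
  have "bracket v powr (2 * \<gamma> + 2) \<le> bracket v powr (2 + 2)"
    using assms bracket_ge_1[of v] by (intro powr_mono) auto
  also have "\<dots> = bracket v powr 2 * bracket v powr 2" by (rule powr_add)
  also have "\<dots> \<le> (1 / e) * (1 / e)" using False assms by (intro mult_mono) auto
  also have "\<dots> = 1 / e\<^sup>2" by (simp add: power2_eq_square)
  finally show ?thesis using assms(2) by (simp add: add_increasing)
qed

lemma schwartz_tder_rapid1: "schwartz f \<Longrightarrow> rapid1 (tder \<alpha> f)"
  by (intro schwartz_rapid1 schwartz_tder)

lemma schwartz_tder_rapid: "schwartz f \<Longrightarrow> rapid (tder \<alpha> f)"
  by (intro schwartz_rapid schwartz_tder)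

lemma rapid_grad_sq: "schwartz f \<Longrightarrow> rapid (grad_sq f)"
  unfolding grad_sq_def[abs_def] by (intro rapid_sum rapid_norm_sq schwartz_tder_rapid)

lemma rapid_grad_sum: "schwartz f \<Longrightarrow> rapid (grad_sum f)"
  unfolding grad_sum_def[abs_def] by (intro rapid_sum rapid_norm schwartz_tder_rapid)

lemma slow1_inner_const: "slow1 (\<lambda>v. v \<bullet> \<xi>)"
  by (intro slow1_bounded_linear bounded_linear_inner_left)

lemma tder_inner_const: "tder \<alpha> (\<lambda>v. v \<bullet> \<xi>) v = fld \<alpha> v \<bullet> \<xi>"
  unfolding tder_def by (subst partial_bounded_linear) (auto intro: bounded_linear_inner_left)

text \<open>Coordinate derivatives of the coefficients gain a power <v>^(-1), and the length <v> of
  the rotation fields uses it up. One bound with exponent \<gamma> therefore serves all six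
  fields.\<close>

locale landau_coeffs =
  fixes \<gamma> :: real and lam mu F :: "real^3 \<Rightarrow> real" and c K :: real
  assumes gamma_le: "\<gamma> \<le> 1" and c_pos: "c > 0" and K_pos: "K > 0"
    and slow1_lam: "slow1 lam" and slow1_mu: "slow1 mu" and slow_F: "slow F"
    and lower: "c * bracket v powr \<gamma> \<le> lam v" "c * bracket v powr \<gamma> \<le> mu v" "c * bracket v powr (\<gamma> + 2) \<le> F v"
    and upper: "lam v \<le> K * bracket v powr \<gamma>" "mu v \<le> K * bracket v powr \<gamma>" "F v \<le> K * bracket v powr (\<gamma> + 2)"
    and upper_tder: "\<bar>tder \<alpha> lam v\<bar> \<le> K * bracket v powr \<gamma>" "\<bar>tder \<alpha> mu v\<bar> \<le> K * bracket v powr \<gamma>"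
begin

abbreviation cf where "cf \<equiv> coef lam mu"
abbreviation A where "A \<equiv> diffop lam mu F"
abbreviation P where "P \<equiv> fibre_op lam mu F"

lemma slow1_cf: "slow1 (cf \<alpha>)"
  using slow1_lam slow1_mu unfolding coef_def by (cases \<alpha>) simp_all

lemma cf_lower: "c * bracket v powr \<gamma> \<le> cf \<alpha> v"
  and cf_upper: "cf \<alpha> v \<le> K * bracket v powr \<gamma>"
  and cf_tder: "\<bar>tder \<alpha> (cf \<alpha>) v\<bar> \<le> K * bracket v powr \<gamma>"
  using lower upper upper_tder unfolding coef_def by (cases \<alpha>; simp)+

lemma cf_nonneg: "0 \<le> cf \<alpha> v"
  using cf_lower[of v \<alpha>] c_pos by (meson less_imp_le mult_nonneg_nonneg order_trans powr_ge_zero)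

lemma F_nonneg: "0 \<le> F v"
  using lower(3)[of v] c_pos by (meson less_imp_le mult_nonneg_nonneg order_trans powr_ge_zero)

lemma rapid1_flux: "schwartz f \<Longrightarrow> rapid1 (\<lambda>v. cf \<alpha> v *\<^sub>R tder \<alpha> f v)"
  by (intro rapid1_scaleR slow1_cf schwartz_tder_rapid1)

lemma rapid_A: "schwartz f \<Longrightarrow> rapid (A f)"
  unfolding diffop_def[abs_def]
  by (intro rapid_add rapid_minus rapid_sum rapid_tder rapid1_flux rapid_scaleR slow_F schwartz_rapid)

lemma rapid_P: "schwartz f \<Longrightarrow> rapid (P \<xi> f)"
  unfolding fibre_op_def[abs_def]
  by (intro rapid_add rapid_A rapid_mult slow_mult slow_const slow1D(2)[OF slow1_coord] schwartz_rapid)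

lemma inner_i_mult [simp]: "(\<i> * complex_of_real r * z) \<bullet> z = 0" "z \<bullet> (\<i> * complex_of_real r * z) = 0"
  by (simp_all add: inner_complex_def)

text \<open>Pairing with \<open>\<phi> f\<close> kills the skew-adjoint transport term.\<close>
lemma energy:
  assumes f: "schwartz f" and phi: "slow1 \<phi>" "\<And>v. \<phi> v > 0" and E: "slow E"
    and bound: "\<And>v. (\<Sum>\<alpha>\<in>UNIV. cf \<alpha> v * (tder \<alpha> \<phi> v)\<^sup>2) \<le> E v * \<phi> v"
  shows "(LINT v|lborel. \<phi> v * (c / 2 * bracket v powr \<gamma>) * grad_sq f v + \<phi> v * (c * bracket v powr (\<gamma> + 2)) * (norm (f v))\<^sup>2)
    \<le> (LINT v|lborel. \<phi> v * norm (P \<xi> f v) * norm (f v) + E v / 2 * (norm (f v))\<^sup>2)"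
proof (rule integral_mono_divergence[where h="\<lambda>\<alpha> v. \<phi> v *\<^sub>R ((cf \<alpha> v *\<^sub>R tder \<alpha> f v) \<bullet> f v)"])
  have rf: "rapid1 f" "rapid f" "slow1 f" using f by (auto intro: schwartz_rapid1 schwartz_rapid rapid1_imp_slow1)
  have sphi: "slow \<phi>" using phi(1) by (rule slow1D)
  show "rapid (\<lambda>v. \<phi> v * (c / 2 * bracket v powr \<gamma>) * grad_sq f v + \<phi> v * (c * bracket v powr (\<gamma> + 2)) * (norm (f v))\<^sup>2)"
    by (intro rapid_add rapid_mult slow_mult sphi slow_const slow_bracket_powr rapid_grad_sq f rapid_norm_sq rf)
  have "slow (\<lambda>v. E v / 2)" using slow_mult[OF slow_const E, of "1/2"] by simp
  then show "rapid (\<lambda>v. \<phi> v * norm (P \<xi> f v) * norm (f v) + E v / 2 * (norm (f v))\<^sup>2)"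
    by (intro rapid_add rapid_mult slow_mult sphi slow_norm rapid_imp_slow[OF rapid_P] rapid_norm rapid_norm_sq f rf)
  show r: "rapid1 (\<lambda>v. \<phi> v *\<^sub>R ((cf \<alpha> v *\<^sub>R tder \<alpha> f v) \<bullet> f v))" for \<alpha>
    by (intro rapid1_scaleR phi rapid1_inner rapid1_flux f rf)
  fix v
  define T where "T \<alpha> = tder \<alpha> f v" for \<alpha>
  define W where "W \<alpha> = tder \<alpha> (\<lambda>v. cf \<alpha> v *\<^sub>R tder \<alpha> f v) v" for \<alpha>
  have div: "tder \<alpha> (\<lambda>v. \<phi> v *\<^sub>R ((cf \<alpha> v *\<^sub>R tder \<alpha> f v) \<bullet> f v)) v
      = \<phi> v * (cf \<alpha> v * (norm (T \<alpha>))\<^sup>2) + \<phi> v * (W \<alpha> \<bullet> f v) + tder \<alpha> \<phi> v * cf \<alpha> v * (T \<alpha> \<bullet> f v)" for \<alpha>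
    unfolding tder_scaleR[OF phi(1) rapid1_imp_slow1[OF rapid1_inner[OF rapid1_flux[OF f] rf(1)]]]
      tder_inner[OF rapid1_imp_slow1[OF rapid1_flux[OF f]] rf(3)]
    by (simp add: T_def W_def power2_norm_eq_inner algebra_simps)
  \<comment> \<open>Young's inequality gives away half of the weighted dissipation, which is why the
    conclusion keeps \<open>c / 2\<close>. The other part becomes the error \<open>E\<close>
    prepared by the hypothesis \<open>bound\<close>.\<close>
  have each: "- (tder \<alpha> \<phi> v * cf \<alpha> v * (T \<alpha> \<bullet> f v))
      \<le> \<phi> v * (cf \<alpha> v * (norm (T \<alpha>))\<^sup>2) / 2 + (cf \<alpha> v * (tder \<alpha> \<phi> v)\<^sup>2) / (2 * \<phi> v) * (norm (f v))\<^sup>2" for \<alpha>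
  proof -
    let ?t = "tder \<alpha> \<phi> v" and ?p = "\<phi> v"
    have p: "?p > 0" by (rule phi)
    have "- (?t * (T \<alpha> \<bullet> f v)) \<le> \<bar>?t\<bar> * (norm (T \<alpha>) * norm (f v))"
      using Cauchy_Schwarz_ineq2[of "T \<alpha>" "f v"] abs_ge_minus_self[of "?t * (T \<alpha> \<bullet> f v)"]
        mult_left_mono[of "\<bar>T \<alpha> \<bullet> f v\<bar>" "norm (T \<alpha>) * norm (f v)" "\<bar>?t\<bar>"] by (simp add: abs_mult)
    also have "\<dots> \<le> (?p * (norm (T \<alpha>))\<^sup>2 + ?t\<^sup>2 / ?p * (norm (f v))\<^sup>2) / 2"
    proof -
      have "2 * (?p * norm (T \<alpha>)) * (\<bar>?t\<bar> * norm (f v)) \<le> (?p * norm (T \<alpha>))\<^sup>2 + (\<bar>?t\<bar> * norm (f v))\<^sup>2"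
        by (rule sum_squares_bound)
      then have "?p * (\<bar>?t\<bar> * (norm (T \<alpha>) * norm (f v)) * 2) \<le> ?p * (?p * (norm (T \<alpha>))\<^sup>2 + ?t\<^sup>2 / ?p * (norm (f v))\<^sup>2)"
        using p by (simp add: power_mult_distrib power2_eq_square algebra_simps)
      then show ?thesis using p by (subst (asm) mult_le_cancel_left_pos) auto
    qed
    finally have "cf \<alpha> v * - (?t * (T \<alpha> \<bullet> f v)) \<le> cf \<alpha> v * ((?p * (norm (T \<alpha>))\<^sup>2 + ?t\<^sup>2 / ?p * (norm (f v))\<^sup>2) / 2)"
      by (rule mult_left_mono) (rule cf_nonneg)
    then show ?thesis by (simp add: algebra_simps add_divide_distrib)
  qed
  have "- (\<Sum>\<alpha>\<in>UNIV. tder \<alpha> \<phi> v * cf \<alpha> v * (T \<alpha> \<bullet> f v))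
      \<le> (\<Sum>\<alpha>\<in>UNIV. \<phi> v * (cf \<alpha> v * (norm (T \<alpha>))\<^sup>2) / 2 + (cf \<alpha> v * (tder \<alpha> \<phi> v)\<^sup>2) / (2 * \<phi> v) * (norm (f v))\<^sup>2)"
    unfolding sum_negf[symmetric] by (rule sum_mono) (rule each)
  also have "\<dots> = \<phi> v / 2 * (\<Sum>\<alpha>\<in>UNIV. cf \<alpha> v * (norm (T \<alpha>))\<^sup>2)
      + (\<Sum>\<alpha>\<in>UNIV. cf \<alpha> v * (tder \<alpha> \<phi> v)\<^sup>2) / (2 * \<phi> v) * (norm (f v))\<^sup>2"
    by (simp add: sum.distrib sum_distrib_left sum_distrib_right sum_divide_distrib)
  also have "(\<Sum>\<alpha>\<in>UNIV. cf \<alpha> v * (tder \<alpha> \<phi> v)\<^sup>2) / (2 * \<phi> v) * (norm (f v))\<^sup>2 \<le> E v / 2 * (norm (f v))\<^sup>2"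
    using bound[of v] phi(2)[of v] by (intro mult_right_mono) (auto simp: pos_divide_le_eq mult_ac)
  finally have cross: "- (\<Sum>\<alpha>\<in>UNIV. tder \<alpha> \<phi> v * cf \<alpha> v * (T \<alpha> \<bullet> f v))
      \<le> \<phi> v / 2 * (\<Sum>\<alpha>\<in>UNIV. cf \<alpha> v * (norm (T \<alpha>))\<^sup>2) + E v / 2 * (norm (f v))\<^sup>2" by simp
  \<comment> \<open>The transport term is an imaginary multiple of \<open>f v\<close>, hence
    orthogonal to it in the real inner product; the estimate is therefore uniform in \<xi>.\<close>
  have "P \<xi> f v \<bullet> f v = - (\<Sum>\<alpha>\<in>UNIV. W \<alpha> \<bullet> f v) + F v * (norm (f v))\<^sup>2"
    unfolding fibre_op_def diffop_def W_def
    by (simp add: inner_add_left inner_diff_left inner_minus_left inner_sum_left power2_norm_eq_inner)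
  moreover have "P \<xi> f v \<bullet> f v \<le> norm (P \<xi> f v) * norm (f v)" by (rule norm_cauchy_schwarz)
  ultimately have *: "- (\<Sum>\<alpha>\<in>UNIV. W \<alpha> \<bullet> f v) + F v * (norm (f v))\<^sup>2 \<le> norm (P \<xi> f v) * norm (f v)" by simp
  have pair: "\<phi> v * (F v * (norm (f v))\<^sup>2) - \<phi> v * (\<Sum>\<alpha>\<in>UNIV. W \<alpha> \<bullet> f v) \<le> \<phi> v * norm (P \<xi> f v) * norm (f v)"
    using mult_left_mono[OF * less_imp_le[OF phi(2)]] by (simp add: right_diff_distrib mult.assoc)
  have divs: "(\<Sum>\<alpha>\<in>UNIV. tder \<alpha> (\<lambda>v. \<phi> v *\<^sub>R ((cf \<alpha> v *\<^sub>R tder \<alpha> f v) \<bullet> f v)) v)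
      = \<phi> v * (\<Sum>\<alpha>\<in>UNIV. cf \<alpha> v * (norm (T \<alpha>))\<^sup>2) + \<phi> v * (\<Sum>\<alpha>\<in>UNIV. W \<alpha> \<bullet> f v)
        + (\<Sum>\<alpha>\<in>UNIV. tder \<alpha> \<phi> v * cf \<alpha> v * (T \<alpha> \<bullet> f v))"
    unfolding div by (simp add: sum.distrib sum_distrib_left)
  have low1: "c * bracket v powr \<gamma> * grad_sq f v \<le> (\<Sum>\<alpha>\<in>UNIV. cf \<alpha> v * (norm (T \<alpha>))\<^sup>2)"
    unfolding grad_sq_def T_def sum_distrib_left by (intro sum_mono mult_right_mono cf_lower) auto
  have low1': "\<phi> v / 2 * (c * bracket v powr \<gamma> * grad_sq f v) \<le> \<phi> v / 2 * (\<Sum>\<alpha>\<in>UNIV. cf \<alpha> v * (norm (T \<alpha>))\<^sup>2)"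
    using phi(2)[of v] by (intro mult_left_mono low1) auto
  have low2: "\<phi> v * (c * bracket v powr (\<gamma> + 2) * (norm (f v))\<^sup>2) \<le> \<phi> v * (F v * (norm (f v))\<^sup>2)"
    using phi(2)[of v] by (intro mult_left_mono mult_right_mono lower) auto
  have "\<phi> v * (c / 2 * bracket v powr \<gamma>) * grad_sq f v + \<phi> v * (c * bracket v powr (\<gamma> + 2)) * (norm (f v))\<^sup>2
      = \<phi> v / 2 * (c * bracket v powr \<gamma> * grad_sq f v) + \<phi> v * (c * bracket v powr (\<gamma> + 2) * (norm (f v))\<^sup>2)"
    by (simp add: mult_ac)
  then show "\<phi> v * (c / 2 * bracket v powr \<gamma>) * grad_sq f v + \<phi> v * (c * bracket v powr (\<gamma> + 2)) * (norm (f v))\<^sup>2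
    \<le> \<phi> v * norm (P \<xi> f v) * norm (f v) + E v / 2 * (norm (f v))\<^sup>2
      + (\<Sum>\<alpha>\<in>UNIV. tder \<alpha> (\<lambda>v. \<phi> v *\<^sub>R ((cf \<alpha> v *\<^sub>R tder \<alpha> f v) \<bullet> f v)) v)"
    using low1' low2 pair cross unfolding divs by simp
qed

end

section \<open>Hypoelliptic estimates on a fibre\<close>

lemma bracket_nz [simp]: "bracket v \<noteq> 0" using bracket_pos[of v] by linarith

lemma mm_nz: "\<xi> \<noteq> 0 \<Longrightarrow> mm \<xi> v \<noteq> 0" using mm_pos[of \<xi> v] by linarith

context landau_coeffs
begin

text \<open>\<open>phi\<close> is the weight \<open>\<langle>v\<rangle>\<^bsup>\<gamma>/3\<^esup> (|\<xi>|\<^sup>2 + |v \<and> \<xi>|\<^sup>2)\<^bsup>1/3\<^esup>\<close> of the hypoelliptic gain, and \<open>psi\<close> is the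
  weight of the first derivatives for which \<open>\<langle>v\<rangle>\<^bsup>\<gamma>\<^esup> mm = phi psi\<close> and \<open>psi\<^sup>2 = \<langle>v\<rangle>\<^bsup>\<gamma>\<^esup> phi\<close>.\<close>

definition phi :: "real^3 \<Rightarrow> real^3 \<Rightarrow> real" where
  "phi \<xi> v = bracket v powr (\<gamma> / 3) * mm \<xi> v powr (2 / 3)"

definition psi :: "real^3 \<Rightarrow> real^3 \<Rightarrow> real" where
  "psi \<xi> v = bracket v powr (2 * \<gamma> / 3) * mm \<xi> v powr (1 / 3)"

text \<open>Scales the vector of the six numbers \<open>fld \<alpha> v \<bullet> \<xi>\<close>,
  whose length is \<open>mm \<xi> v\<close>, to length \<open>psi \<xi> v\<close>.\<close>

definition omega :: "real^3 \<Rightarrow> real^3 \<Rightarrow> real" where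
  "omega \<xi> v = bracket v powr (2 * \<gamma> / 3) * mm \<xi> v powr (- (2 / 3))"

definition data where
  "data \<xi> f = (LINT v|lborel. (norm (P \<xi> f v))\<^sup>2) + (LINT v|lborel. (norm (f v))\<^sup>2)"

definition gain where
  "gain \<xi> f = (LINT v|lborel. (phi \<xi> v * norm (f v :: complex))\<^sup>2)"

text \<open>The zero-order term accompanies the gradient because derivatives of the coefficients of
  the multiplier produce it, and the lower bound for F pays for it in the same energy
  estimate.\<close>

definition dissip where
  "dissip \<xi> f = (LINT v|lborel. (psi \<xi> v)\<^sup>2 * (grad_sq f v + bracket v powr 2 * (norm (f v))\<^sup>2))"

definition elliptic where
  "elliptic f = (LINT v|lborel. (norm (A f v))\<^sup>2)"

lemma phi_pos: "\<xi> \<noteq> 0 \<Longrightarrow> phi \<xi> v > 0" and psi_pos: "\<xi> \<noteq> 0 \<Longrightarrow> psi \<xi> v > 0"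
  and omega_pos: "\<xi> \<noteq> 0 \<Longrightarrow> omega \<xi> v > 0"
  unfolding phi_def psi_def omega_def by (auto simp: mm_nz)

lemma psi_sq: "(psi \<xi> v)\<^sup>2 = bracket v powr \<gamma> * phi \<xi> v"
proof -
  have "(bracket v powr (2 * \<gamma> / 3))\<^sup>2 = bracket v powr \<gamma> * bracket v powr (\<gamma> / 3)"
    unfolding power2_eq_square powr_add[symmetric] by simp
  moreover have "(mm \<xi> v powr (1 / 3))\<^sup>2 = mm \<xi> v powr (2 / 3)"
    unfolding power2_eq_square powr_add[symmetric] by simp
  ultimately show ?thesis unfolding psi_def phi_def by (simp add: power_mult_distrib)
qed

lemma phi_psi: assumes "\<xi> \<noteq> 0" shows "bracket v powr \<gamma> * mm \<xi> v = phi \<xi> v * psi \<xi> v"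
proof -
  have "bracket v powr (\<gamma> / 3) * bracket v powr (2 * \<gamma> / 3) = bracket v powr \<gamma>"
    unfolding powr_add[symmetric] by simp
  moreover have "mm \<xi> v powr (2 / 3) * mm \<xi> v powr (1 / 3) = mm \<xi> v"
    unfolding powr_add[symmetric] using mm_pos[OF assms, of v] by simp
  moreover have "phi \<xi> v * psi \<xi> v = (bracket v powr (\<gamma> / 3) * bracket v powr (2 * \<gamma> / 3))
      * (mm \<xi> v powr (2 / 3) * mm \<xi> v powr (1 / 3))"
    unfolding psi_def phi_def by (simp only: mult_ac)
  ultimately show ?thesis by simp
qed

lemma omega_mm: assumes "\<xi> \<noteq> 0" shows "omega \<xi> v * mm \<xi> v = psi \<xi> v"
proof -
  have "mm \<xi> v powr (- (2 / 3)) * mm \<xi> v = mm \<xi> v powr (1 / 3)"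
    using powr_add[of "mm \<xi> v" "- (2 / 3)" 1] mm_pos[OF assms, of v] by simp
  then show ?thesis unfolding omega_def psi_def by (simp add: mult.assoc)
qed

lemma omega_mm_sq: assumes "\<xi> \<noteq> 0" shows "omega \<xi> v * msq \<xi> v = (phi \<xi> v)\<^sup>2"
proof -
  have "omega \<xi> v * msq \<xi> v = psi \<xi> v * mm \<xi> v"
    unfolding omega_mm[OF assms, symmetric] mm_sq[symmetric] by (simp add: power2_eq_square)
  also have "\<dots> = (phi \<xi> v)\<^sup>2"
  proof -
    have "mm \<xi> v powr (1 / 3) * mm \<xi> v = mm \<xi> v powr (2 / 3) * mm \<xi> v powr (2 / 3)"
      using powr_add[of "mm \<xi> v" "1 / 3" 1] powr_add[of "mm \<xi> v" "2 / 3" "2 / 3"] mm_pos[OF assms, of v] by simp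
    moreover have "bracket v powr (2 * \<gamma> / 3) = bracket v powr (\<gamma> / 3) * bracket v powr (\<gamma> / 3)"
      unfolding powr_add[symmetric] by simp
    ultimately show ?thesis unfolding psi_def phi_def power2_eq_square by (simp add: mult_ac)
  qed
  finally show ?thesis .
qed

lemma slow1_phi: "\<xi> \<noteq> 0 \<Longrightarrow> slow1 (phi \<xi>)" and slow1_psi: "\<xi> \<noteq> 0 \<Longrightarrow> slow1 (psi \<xi>)"
  and slow1_omega: "\<xi> \<noteq> 0 \<Longrightarrow> slow1 (omega \<xi>)"
  unfolding phi_def[abs_def] psi_def[abs_def] omega_def[abs_def]
  by (intro slow1_mult slow1_bracket_powr slow1_mm_powr; assumption)+

lemma tder_weight:
  assumes "\<xi> \<noteq> 0" and W: "W = (\<lambda>v. bracket v powr s * mm \<xi> v powr t)"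
  shows "\<bar>tder \<alpha> W v\<bar> \<le> (\<bar>s\<bar> + \<bar>t\<bar>) * bracket v * W v"
proof -
  have "\<bar>tder \<alpha> W v\<bar> = \<bar>bracket v powr s * tder \<alpha> (\<lambda>v. mm \<xi> v powr t) v + tder \<alpha> (\<lambda>v. bracket v powr s) v * mm \<xi> v powr t\<bar>"
    unfolding W tder_mult[OF slow1_bracket_powr slow1_mm_powr[OF assms(1)]] ..
  also have "\<dots> \<le> bracket v powr s * \<bar>tder \<alpha> (\<lambda>v. mm \<xi> v powr t) v\<bar> + \<bar>tder \<alpha> (\<lambda>v. bracket v powr s) v\<bar> * mm \<xi> v powr t"
    by (rule order_trans[OF abs_triangle_ineq]) (simp add: abs_mult)
  also have "\<dots> \<le> bracket v powr s * (\<bar>t\<bar> * bracket v * mm \<xi> v powr t) + (\<bar>s\<bar> * bracket v powr s) * mm \<xi> v powr t"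
    by (intro add_mono mult_left_mono mult_right_mono tder_mm_powr tder_bracket_powr assms) auto
  also have "\<dots> \<le> bracket v powr s * (\<bar>t\<bar> * bracket v * mm \<xi> v powr t) + (\<bar>s\<bar> * bracket v powr s) * mm \<xi> v powr t * bracket v"
    using mult_left_mono[OF bracket_ge_1[of v], of "(\<bar>s\<bar> * bracket v powr s) * mm \<xi> v powr t"] by simp
  also have "\<dots> = (\<bar>s\<bar> + \<bar>t\<bar>) * bracket v * W v" unfolding W by (simp add: algebra_simps)
  finally show ?thesis .
qed

lemma sum_cf_tder_le:
  assumes "\<And>\<alpha>. \<bar>tder \<alpha> W v\<bar> \<le> D"
  shows "(\<Sum>\<alpha>\<in>UNIV. cf \<alpha> v * (tder \<alpha> W v)\<^sup>2) \<le> 6 * K * bracket v powr \<gamma> * D\<^sup>2"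
proof -
  have "(\<Sum>\<alpha>\<in>(UNIV :: (3 + 3) set). cf \<alpha> v * (tder \<alpha> W v)\<^sup>2) \<le> (\<Sum>\<alpha>\<in>(UNIV :: (3 + 3) set). K * bracket v powr \<gamma> * D\<^sup>2)"
  proof (rule sum_mono, rule mult_mono)
    show "(tder \<alpha> W v)\<^sup>2 \<le> D\<^sup>2" for \<alpha>
      using power_mono[OF assms abs_ge_zero, of \<alpha> 2] by simp
  qed (use cf_upper K_pos in auto)
  then show ?thesis by simp
qed

lemma data_nonneg: "0 \<le> data \<xi> f" unfolding data_def by simp

text \<open>The weight <v>^(\<gamma>+2) is chosen so that its product with the lower bound for F is
  <v>^(2\<gamma>+4). Its derivatives cost <v>^(2\<gamma>+2), two powers less, and
  \<open>bracket_powr_Young\<close> absorbs that.\<close>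

lemma weight_gain:
  "\<exists>C>0. \<forall>\<xi> f. schwartz f \<longrightarrow>
    (LINT v|lborel. bracket v powr (2 * \<gamma> + 2) * grad_sq f v) + (LINT v|lborel. bracket v powr (2 * \<gamma> + 4) * (norm (f v))\<^sup>2)
      \<le> C * data \<xi> f"
proof -
  define s where "s = \<gamma> + 2"
  define k where "k = 3 * K * s\<^sup>2"
  have k: "k \<ge> 0" unfolding k_def using K_pos by simp
  \<comment> \<open>Young's parameter, with k e <= c / 4 for every k >= 0, the value 0 included.
    Another c / 4 goes to the pairing with \<open>P \<xi> f\<close>, so c / 2 of the zero-order term
    survives.\<close>
  define e where "e = c / (4 * (k + 1))"
  have e: "e > 0" unfolding e_def using c_pos k by simp
  have ke: "k * e \<le> c / 4"
  proof -
    have "k * e = (c / 4) * (k / (k + 1))" unfolding e_def by (simp add: field_simps)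
    also have "\<dots> \<le> (c / 4) * 1" using k c_pos by (intro mult_left_mono) auto
    finally show ?thesis by simp
  qed
  define C where "C = 2 / c * (1 / c + k / e\<^sup>2)"
  have C: "C > 0" unfolding C_def using c_pos k by (intro mult_pos_pos add_pos_nonneg) auto
  have "(LINT v|lborel. bracket v powr (2 * \<gamma> + 2) * grad_sq f v) + (LINT v|lborel. bracket v powr (2 * \<gamma> + 4) * (norm (f v))\<^sup>2)
      \<le> C * data \<xi> f" if f: "schwartz f" for \<xi> f
  proof -
    have rf: "rapid f" using f by (rule schwartz_rapid)
    note ri = rapid_mult slow_bracket_powr rapid_grad_sq[OF f] rapid_norm_sq rf rapid_P[OF f] slow_const rapid_add
    define a1 where "a1 = (LINT v|lborel. bracket v powr (2 * \<gamma> + 2) * grad_sq f v)"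
    define a2 where "a2 = (LINT v|lborel. bracket v powr (2 * \<gamma> + 4) * (norm (f v))\<^sup>2)"
    define g where "g = (LINT v|lborel. (norm (P \<xi> f v))\<^sup>2)"
    define n where "n = (LINT v|lborel. (norm (f v))\<^sup>2)"
    have gn: "g \<ge> 0" "n \<ge> 0" unfolding g_def n_def by auto
    have r1: "rapid (\<lambda>v. bracket v powr (2 * \<gamma> + 2) * grad_sq f v)" and r2: "rapid (\<lambda>v. bracket v powr (2 * \<gamma> + 4) * (norm (f v))\<^sup>2)"
      and r3: "rapid (\<lambda>v. (norm (P \<xi> f v))\<^sup>2)" and r4: "rapid (\<lambda>v. (norm (f v))\<^sup>2)"
      by (intro ri)+
    have "(LINT v|lborel. bracket v powr s * (c / 2 * bracket v powr \<gamma>) * grad_sq f v + bracket v powr s * (c * bracket v powr (\<gamma> + 2)) * (norm (f v))\<^sup>2)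
      \<le> (LINT v|lborel. bracket v powr s * norm (P \<xi> f v) * norm (f v) + (2 * k * bracket v powr (2 * \<gamma> + 2)) / 2 * (norm (f v))\<^sup>2)"
    proof (rule energy[OF f slow1_bracket_powr])
      show "slow (\<lambda>v. 2 * k * bracket v powr (2 * \<gamma> + 2))" by (intro slow_mult slow_const slow_bracket_powr)
      fix v
      have "(\<Sum>\<alpha>\<in>UNIV. cf \<alpha> v * (tder \<alpha> (\<lambda>v. bracket v powr s) v)\<^sup>2) \<le> 6 * K * bracket v powr \<gamma> * (\<bar>s\<bar> * bracket v powr s)\<^sup>2"
        by (rule sum_cf_tder_le) (rule tder_bracket_powr)
      also have "\<dots> = 2 * k * (bracket v powr \<gamma> * bracket v powr s) * bracket v powr s"
        unfolding k_def by (simp add: power_mult_distrib power2_eq_square)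
      also have "bracket v powr \<gamma> * bracket v powr s = bracket v powr (2 * \<gamma> + 2)"
        unfolding bracket_powr_mult s_def by (simp add: algebra_simps)
      finally show "(\<Sum>\<alpha>\<in>UNIV. cf \<alpha> v * (tder \<alpha> (\<lambda>v. bracket v powr s) v)\<^sup>2)
          \<le> 2 * k * bracket v powr (2 * \<gamma> + 2) * bracket v powr s" .
    qed simp
    also have "(LINT v|lborel. bracket v powr s * (c / 2 * bracket v powr \<gamma>) * grad_sq f v + bracket v powr s * (c * bracket v powr (\<gamma> + 2)) * (norm (f v))\<^sup>2)
        = (LINT v|lborel. c / 2 * (bracket v powr (2 * \<gamma> + 2) * grad_sq f v) + c * (bracket v powr (2 * \<gamma> + 4) * (norm (f v))\<^sup>2))"
    proof (intro Bochner_Integration.integral_cong refl)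
      fix v
      have "bracket v powr s * bracket v powr \<gamma> = bracket v powr (2 * \<gamma> + 2)" "bracket v powr s * bracket v powr (\<gamma> + 2) = bracket v powr (2 * \<gamma> + 4)"
        unfolding bracket_powr_mult s_def by (simp_all add: algebra_simps)
      moreover have "S * (c / 2 * G) * g + S * (c * H) * n = c / 2 * ((S * G) * g) + c * ((S * H) * n)"
        for S G H g n :: real by (simp add: algebra_simps)
      ultimately show "bracket v powr s * (c / 2 * bracket v powr \<gamma>) * grad_sq f v + bracket v powr s * (c * bracket v powr (\<gamma> + 2)) * (norm (f v))\<^sup>2
          = c / 2 * (bracket v powr (2 * \<gamma> + 2) * grad_sq f v) + c * (bracket v powr (2 * \<gamma> + 4) * (norm (f v))\<^sup>2)"
        by (simp only:)
    qed
    also have "\<dots> = c / 2 * a1 + c * a2"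
      unfolding a1_def a2_def by (simp add: integrable_rapid r1 r2)
    also have "(LINT v|lborel. bracket v powr s * norm (P \<xi> f v) * norm (f v) + (2 * k * bracket v powr (2 * \<gamma> + 2)) / 2 * (norm (f v))\<^sup>2)
        \<le> (LINT v|lborel. 1 / c * (norm (P \<xi> f v))\<^sup>2 + c / 2 * (bracket v powr (2 * \<gamma> + 4) * (norm (f v))\<^sup>2) + k / e\<^sup>2 * (norm (f v))\<^sup>2)"
    proof (rule integral_rapid_mono)
      show "rapid (\<lambda>v. bracket v powr s * norm (P \<xi> f v) * norm (f v) + (2 * k * bracket v powr (2 * \<gamma> + 2)) / 2 * (norm (f v))\<^sup>2)"
        using slow_mult[OF slow_const slow_bracket_powr, of k "2 * \<gamma> + 2"]
        by (intro rapid_add rapid_mult slow_mult slow_bracket_powr slow_norm rapid_imp_slow[OF rapid_P] rapid_norm rapid_norm_sq f rf) simp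
      show "rapid (\<lambda>v. 1 / c * (norm (P \<xi> f v))\<^sup>2 + c / 2 * (bracket v powr (2 * \<gamma> + 4) * (norm (f v))\<^sup>2) + k / e\<^sup>2 * (norm (f v))\<^sup>2)"
        by (intro ri)
      fix v
      define p where "p = norm (P \<xi> f v)"
      define w where "w = norm (f v)"
      have "0 \<le> (p - c / 2 * (bracket v powr s * w))\<^sup>2" by simp
      then have "c * (bracket v powr s * p * w) \<le> c * (1 / c * p\<^sup>2 + c / 4 * (bracket v powr s * w)\<^sup>2)"
        using c_pos by (simp add: power2_eq_square algebra_simps)
      then have 1: "bracket v powr s * p * w \<le> 1 / c * p\<^sup>2 + c / 4 * (bracket v powr s * w)\<^sup>2"
        using c_pos by (subst (asm) mult_le_cancel_left_pos) auto
      have s2: "(bracket v powr s * w)\<^sup>2 = bracket v powr (2 * \<gamma> + 4) * w\<^sup>2"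
        unfolding power_mult_distrib by (simp add: power2_eq_square bracket_powr_mult s_def algebra_simps)
      have "k * bracket v powr (2 * \<gamma> + 2) \<le> k * (e * bracket v powr (2 * \<gamma> + 4) + 1 / e\<^sup>2)"
        by (intro mult_left_mono bracket_powr_Young gamma_le e k)
      also have "\<dots> = (k * e) * bracket v powr (2 * \<gamma> + 4) + k / e\<^sup>2" by (simp add: algebra_simps)
      also have "\<dots> \<le> c / 4 * bracket v powr (2 * \<gamma> + 4) + k / e\<^sup>2"
        using ke by (intro add_right_mono mult_right_mono) auto
      finally have "k * bracket v powr (2 * \<gamma> + 2) * w\<^sup>2 \<le> (c / 4 * bracket v powr (2 * \<gamma> + 4) + k / e\<^sup>2) * w\<^sup>2"
        by (rule mult_right_mono) simp
      then have 2: "k * bracket v powr (2 * \<gamma> + 2) * w\<^sup>2 \<le> c / 4 * (bracket v powr (2 * \<gamma> + 4) * w\<^sup>2) + k / e\<^sup>2 * w\<^sup>2"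
        by (simp only: distrib_right mult.assoc)
      show "bracket v powr s * norm (P \<xi> f v) * norm (f v) + (2 * k * bracket v powr (2 * \<gamma> + 2)) / 2 * (norm (f v))\<^sup>2
          \<le> 1 / c * (norm (P \<xi> f v))\<^sup>2 + c / 2 * (bracket v powr (2 * \<gamma> + 4) * (norm (f v))\<^sup>2) + k / e\<^sup>2 * (norm (f v))\<^sup>2"
        unfolding p_def[symmetric] w_def[symmetric] using 1 2 unfolding s2 by simp
    qed
    also have "\<dots> = 1 / c * g + c / 2 * a2 + k / e\<^sup>2 * n"
      unfolding g_def a2_def n_def by (simp add: integrable_rapid r2 r3 r4)
    finally have "c / 2 * (a1 + a2) \<le> 1 / c * g + k / e\<^sup>2 * n" unfolding distrib_left by linarith
    also have "\<dots> \<le> (1 / c + k / e\<^sup>2) * g + (1 / c + k / e\<^sup>2) * n"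
      using gn c_pos k by (intro add_mono mult_right_mono) auto
    also have "\<dots> = c / 2 * (C * (g + n))"
    proof -
      have "M * g + M * n = c / 2 * (2 / c * M * (g + n))" for M using c_pos by (simp add: distrib_left)
      then show ?thesis unfolding C_def .
    qed
    finally have "a1 + a2 \<le> C * (g + n)" using c_pos by (subst (asm) mult_le_cancel_left_pos) auto
    then show ?thesis unfolding a1_def a2_def g_def n_def data_def .
  qed
  then show ?thesis using C by blast
qed

lemma sq_add_le: "(a + b)\<^sup>2 \<le> 2 * a\<^sup>2 + 2 * b\<^sup>2" for a b :: real
  using sum_squares_bound[of a b] by (simp add: power2_sum)

lemma rapid_phi_norm: "\<xi> \<noteq> 0 \<Longrightarrow> schwartz f \<Longrightarrow> rapid (\<lambda>v. phi \<xi> v * norm (f v))"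
  by (intro rapid_real_mult_norm slow1D(2)[OF slow1_phi] schwartz_rapid)

lemma dissip_integrand_rapid:
  "\<xi> \<noteq> 0 \<Longrightarrow> schwartz f \<Longrightarrow> rapid (\<lambda>v. (psi \<xi> v)\<^sup>2 * (grad_sq f v + bracket v powr 2 * (norm (f v))\<^sup>2))"
  by (intro rapid_mult slow_power slow1D(2)[OF slow1_psi] rapid_add rapid_grad_sq rapid_norm_sq slow_bracket_powr schwartz_rapid)

text \<open>Two lost factors <v> from the derivative of \<open>phi\<close> make the error
  <v>^(\<gamma>+2) phi |f|^2. Split as phi |f| times <v>^(\<gamma>+2) |f|, it is handled like the
  pairing with \<open>P \<xi> f\<close>, by \<open>weight_gain\<close>.\<close>

lemma dissip_le:
  "\<exists>C>0. \<forall>\<xi> f. schwartz f \<longrightarrow> \<xi> \<noteq> 0 \<longrightarrow> dissip \<xi> f \<le> C * (sqrt (gain \<xi> f) * sqrt (data \<xi> f))"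
proof -
  obtain C0 where C0: "C0 > 0" "\<And>\<xi> f. schwartz f \<Longrightarrow>
    (LINT v|lborel. bracket v powr (2 * \<gamma> + 2) * grad_sq f v) + (LINT v|lborel. bracket v powr (2 * \<gamma> + 4) * (norm (f v))\<^sup>2)
      \<le> C0 * data \<xi> f" using weight_gain by blast
  \<comment> \<open>\<open>d\<close> sums the moduli of the exponents of \<open>phi\<close>, as in
    \<open>tder_weight\<close>. Six fields make the constant of the error function 6 K d^2 = 2 k,
    and \<open>energy\<close> halves it.\<close>
  define d where "d = \<bar>\<gamma> / 3\<bar> + 2 / 3"
  define k where "k = 3 * K * d\<^sup>2"
  have k: "k \<ge> 0" unfolding k_def using K_pos by simp
  define C where "C = 2 / c * sqrt (2 + 2 * k\<^sup>2 * C0)"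
  have C: "C > 0" unfolding C_def using c_pos C0(1) by (intro mult_pos_pos) (auto intro!: add_pos_nonneg)
  have "dissip \<xi> f \<le> C * (sqrt (gain \<xi> f) * sqrt (data \<xi> f))" if f: "schwartz f" and \<xi>: "\<xi> \<noteq> 0" for \<xi> f
  proof -
    have rf: "rapid f" using f by (rule schwartz_rapid)
    have sphi: "slow (phi \<xi>)" by (rule slow1D(2)[OF slow1_phi[OF \<xi>]])
    let ?R = "\<lambda>v. norm (P \<xi> f v) + k * (bracket v powr (\<gamma> + 2) * norm (f v))"
    have rR: "rapid ?R"
      by (intro rapid_add rapid_norm rapid_P f rapid_mult slow_const slow_bracket_powr rf)
    have "(LINT v|lborel. c / 2 * ((psi \<xi> v)\<^sup>2 * (grad_sq f v + bracket v powr 2 * (norm (f v))\<^sup>2)))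
      \<le> (LINT v|lborel. phi \<xi> v * (c / 2 * bracket v powr \<gamma>) * grad_sq f v + phi \<xi> v * (c * bracket v powr (\<gamma> + 2)) * (norm (f v))\<^sup>2)"
    proof (rule integral_rapid_mono)
      show "rapid (\<lambda>v. c / 2 * ((psi \<xi> v)\<^sup>2 * (grad_sq f v + bracket v powr 2 * (norm (f v))\<^sup>2)))"
        by (rule rapid_mult[OF slow_const dissip_integrand_rapid[OF \<xi> f]])
      show "rapid (\<lambda>v. phi \<xi> v * (c / 2 * bracket v powr \<gamma>) * grad_sq f v + phi \<xi> v * (c * bracket v powr (\<gamma> + 2)) * (norm (f v))\<^sup>2)"
        by (intro rapid_add rapid_mult slow_mult sphi slow_const slow_bracket_powr rapid_grad_sq f rapid_norm_sq rf)
      fix v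
      have "c / 2 * ((psi \<xi> v)\<^sup>2 * (grad_sq f v + bracket v powr 2 * (norm (f v))\<^sup>2))
          = phi \<xi> v * (c / 2 * bracket v powr \<gamma>) * grad_sq f v + phi \<xi> v * (c / 2 * (bracket v powr \<gamma> * bracket v powr 2)) * (norm (f v))\<^sup>2"
        unfolding psi_sq by (simp add: algebra_simps)
      also have "\<dots> \<le> phi \<xi> v * (c / 2 * bracket v powr \<gamma>) * grad_sq f v + phi \<xi> v * (c * bracket v powr (\<gamma> + 2)) * (norm (f v))\<^sup>2"
        unfolding bracket_powr_mult using phi_pos[OF \<xi>, of v] c_pos
        by (intro add_left_mono mult_right_mono mult_left_mono) auto
      finally show "c / 2 * ((psi \<xi> v)\<^sup>2 * (grad_sq f v + bracket v powr 2 * (norm (f v))\<^sup>2)) \<le> \<dots>" .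
    qed
    also have "\<dots> \<le> (LINT v|lborel. phi \<xi> v * norm (P \<xi> f v) * norm (f v) + (2 * k * bracket v powr (\<gamma> + 2) * phi \<xi> v) / 2 * (norm (f v))\<^sup>2)"
    proof (rule energy[OF f slow1_phi[OF \<xi>] phi_pos[OF \<xi>]])
      show "slow (\<lambda>v. 2 * k * bracket v powr (\<gamma> + 2) * phi \<xi> v)" by (intro slow_mult slow_const slow_bracket_powr sphi)
      fix v
      have "(\<Sum>\<alpha>\<in>UNIV. cf \<alpha> v * (tder \<alpha> (phi \<xi>) v)\<^sup>2) \<le> 6 * K * bracket v powr \<gamma> * (d * bracket v * phi \<xi> v)\<^sup>2"
      proof (rule sum_cf_tder_le)
        have W: "phi \<xi> = (\<lambda>v. bracket v powr (\<gamma> / 3) * mm \<xi> v powr (2 / 3))" by (rule ext) (rule phi_def)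
        show "\<bar>tder \<alpha> (phi \<xi>) v\<bar> \<le> d * bracket v * phi \<xi> v" for \<alpha>
          using tder_weight[OF \<xi> W] unfolding d_def by simp
      qed
      also have "\<dots> = 2 * k * (bracket v powr \<gamma> * bracket v powr 2) * phi \<xi> v * phi \<xi> v"
        unfolding k_def by (simp add: power_mult_distrib power2_eq_square)
      finally show "(\<Sum>\<alpha>\<in>UNIV. cf \<alpha> v * (tder \<alpha> (phi \<xi>) v)\<^sup>2) \<le> 2 * k * bracket v powr (\<gamma> + 2) * phi \<xi> v * phi \<xi> v"
        unfolding bracket_powr_mult .
    qed
    also have "\<dots> = (LINT v|lborel. (phi \<xi> v * norm (f v)) * ?R v)"
      by (intro Bochner_Integration.integral_cong refl) (simp add: power2_eq_square algebra_simps)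
    also have "\<dots> \<le> sqrt (gain \<xi> f) * sqrt (LINT v|lborel. (?R v)\<^sup>2)"
      unfolding gain_def by (rule integral_Cauchy_Schwarz[OF rapid_phi_norm[OF \<xi> f] rR])
    also have "\<dots> \<le> sqrt (gain \<xi> f) * sqrt ((2 + 2 * k\<^sup>2 * C0) * data \<xi> f)"
    proof (intro mult_left_mono real_sqrt_le_mono)
      have "(LINT v|lborel. (?R v)\<^sup>2) \<le> (LINT v|lborel. 2 * (norm (P \<xi> f v))\<^sup>2 + 2 * k\<^sup>2 * (bracket v powr (2 * \<gamma> + 4) * (norm (f v))\<^sup>2))"
      proof (rule integral_rapid_mono)
        fix v
        have "(bracket v powr (\<gamma> + 2))\<^sup>2 = bracket v powr (2 * \<gamma> + 4)"
          unfolding power2_eq_square bracket_powr_mult by (simp add: algebra_simps)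
        then show "(?R v)\<^sup>2 \<le> 2 * (norm (P \<xi> f v))\<^sup>2 + 2 * k\<^sup>2 * (bracket v powr (2 * \<gamma> + 4) * (norm (f v))\<^sup>2)"
          using sq_add_le[of "norm (P \<xi> f v)" "k * (bracket v powr (\<gamma> + 2) * norm (f v))"]
          by (simp add: power_mult_distrib mult.assoc)
      qed (intro rapid_power2 rR rapid_add rapid_mult slow_const slow_bracket_powr rapid_norm_sq rapid_P f rf)+
      also have "\<dots> = 2 * (LINT v|lborel. (norm (P \<xi> f v))\<^sup>2) + 2 * k\<^sup>2 * (LINT v|lborel. bracket v powr (2 * \<gamma> + 4) * (norm (f v))\<^sup>2)"
        by (simp add: integrable_rapid rapid_mult slow_bracket_powr rapid_norm_sq rapid_P f rf)
      also have "\<dots> \<le> 2 * data \<xi> f + 2 * k\<^sup>2 * (C0 * data \<xi> f)"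
      proof (intro add_mono mult_left_mono)
        show "(LINT v|lborel. (norm (P \<xi> f v))\<^sup>2) \<le> data \<xi> f" unfolding data_def by simp
        have "0 \<le> (LINT v|lborel. bracket v powr (2 * \<gamma> + 2) * grad_sq f v)"
          by (intro integral_nonneg_AE AE_I2 mult_nonneg_nonneg grad_sq_nonneg) auto
        then show "(LINT v|lborel. bracket v powr (2 * \<gamma> + 4) * (norm (f v))\<^sup>2) \<le> C0 * data \<xi> f"
          using C0(2)[OF f, of \<xi>] by linarith
      qed auto
      finally show "(LINT v|lborel. (?R v)\<^sup>2) \<le> (2 + 2 * k\<^sup>2 * C0) * data \<xi> f" by (simp add: algebra_simps)
    qed (simp add: gain_def)
    finally have "c / 2 * dissip \<xi> f \<le> sqrt (gain \<xi> f) * sqrt ((2 + 2 * k\<^sup>2 * C0) * data \<xi> f)"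
      unfolding dissip_def by simp
    also have "\<dots> = c / 2 * (C * (sqrt (gain \<xi> f) * sqrt (data \<xi> f)))"
      unfolding C_def using c_pos by (simp add: real_sqrt_mult)
    finally show ?thesis using c_pos by (subst (asm) mult_le_cancel_left_pos) auto
  qed
  then show ?thesis using C by blast
qed

end

section \<open>Commutators with the transport term\<close>

lemma tder_transport:
  assumes "slow1 f"
  shows "tder \<alpha> (\<lambda>v. \<i> * complex_of_real (v \<bullet> \<xi>) * f v) v
    = \<i> * complex_of_real (v \<bullet> \<xi>) * tder \<alpha> f v + \<i> * complex_of_real (fld \<alpha> v \<bullet> \<xi>) * f v"
proof -
  have s: "slow1 (\<lambda>v. \<i> * complex_of_real (v \<bullet> \<xi>))" by (intro slow1_mult slow1_const slow1_coord)
  have "tder \<alpha> (\<lambda>v. \<i> * complex_of_real (v \<bullet> \<xi>)) v = \<i> * complex_of_real (fld \<alpha> v \<bullet> \<xi>)"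
    unfolding tder_cmult[OF slow1_coord] by (simp add: tder_def partial_coord)
  then show ?thesis unfolding tder_mult[OF s assms] by simp
qed

lemma inner_i_both: "(\<i> * complex_of_real r * z) \<bullet> (\<i> * w) = r * (z \<bullet> w)"
  by (simp add: inner_complex_def algebra_simps)

context landau_coeffs
begin

text \<open>Pointwise size of a first-order operator with coefficients of order \<open>psi\<close>,
  together with the term <v> |f| left by differentiated coefficients. Its square is at most 12 times
  the integrand of \<open>dissip\<close>.\<close>

definition wgrad where
  "wgrad \<xi> f v = psi \<xi> v * (grad_sum f v + bracket v * norm (f v :: complex))"

lemma rapid_wgrad: "\<xi> \<noteq> 0 \<Longrightarrow> schwartz f \<Longrightarrow> rapid (wgrad \<xi> f)"
  unfolding wgrad_def[abs_def]
  using slow_bracket_powr[of 1] by (intro rapid_mult slow1D(2)[OF slow1_psi] rapid_add rapid_grad_sum rapid_norm schwartz_rapid) simp_all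

lemma wgrad_sq: "\<xi> \<noteq> 0 \<Longrightarrow> schwartz f \<Longrightarrow> (LINT v|lborel. (wgrad \<xi> f v)\<^sup>2) \<le> 12 * dissip \<xi> f"
proof -
  assume \<xi>: "\<xi> \<noteq> 0" and f: "schwartz f"
  have "(LINT v|lborel. (wgrad \<xi> f v)\<^sup>2) \<le> (LINT v|lborel. 12 * ((psi \<xi> v)\<^sup>2 * (grad_sq f v + bracket v powr 2 * (norm (f v))\<^sup>2)))"
  proof (rule integral_rapid_mono)
    fix v
    have "(grad_sum f v + bracket v * norm (f v))\<^sup>2 \<le> 2 * (grad_sum f v)\<^sup>2 + 2 * (bracket v * norm (f v))\<^sup>2" by (rule sq_add_le)
    also have "\<dots> \<le> 2 * (6 * grad_sq f v) + 12 * (bracket v * norm (f v))\<^sup>2"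
      by (intro add_mono mult_left_mono mult_right_mono grad_sum_sq) auto
    also have "\<dots> = 12 * (grad_sq f v + bracket v powr 2 * (norm (f v))\<^sup>2)" by (simp add: power_mult_distrib)
    finally have "(psi \<xi> v)\<^sup>2 * (grad_sum f v + bracket v * norm (f v))\<^sup>2
        \<le> (psi \<xi> v)\<^sup>2 * (12 * (grad_sq f v + bracket v powr 2 * (norm (f v))\<^sup>2))" by (rule mult_left_mono) simp
    then show "(wgrad \<xi> f v)\<^sup>2 \<le> 12 * ((psi \<xi> v)\<^sup>2 * (grad_sq f v + bracket v powr 2 * (norm (f v))\<^sup>2))"
      unfolding wgrad_def power_mult_distrib[of "psi \<xi> v"] mult.left_commute[of "(psi \<xi> v)\<^sup>2" 12] .
  qed (intro rapid_power2 rapid_wgrad \<xi> f rapid_mult[OF slow_const] dissip_integrand_rapid)+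
  then show ?thesis unfolding dissip_def by simp
qed

lemma gain_nonneg: "0 \<le> gain \<xi> f" and elliptic_nonneg: "0 \<le> elliptic f"
  unfolding gain_def elliptic_def by simp_all

lemma dissip_nonneg: "0 \<le> dissip \<xi> f"
  unfolding dissip_def by (intro integral_nonneg_AE AE_I2 mult_nonneg_nonneg add_nonneg_nonneg grad_sq_nonneg) auto

text \<open>The commutators of the fields with \<open>v \<cdot> \<xi>\<close> are the only obstruction to the orthogonality of the
  elliptic and the transport part.\<close>
lemma elliptic_le:
  assumes f: "schwartz f" and \<xi>: "\<xi> \<noteq> 0"
  shows "elliptic f \<le> data \<xi> f + 2 * K * sqrt 12 * (sqrt (gain \<xi> f) * sqrt (dissip \<xi> f))"
proof -
  have rf: "rapid1 f" "rapid f" "slow1 f" using f by (auto intro: schwartz_rapid1 schwartz_rapid rapid1_imp_slow1)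
  define U where "U v = \<i> * complex_of_real (v \<bullet> \<xi>) * f v" for v
  have U1: "rapid1 U" unfolding U_def[abs_def]
    by (intro rapid1_mult slow1_mult slow1_const slow1_coord rf)
  have "(LINT v|lborel. 1 / 2 * (norm (A f v))\<^sup>2)
      \<le> (LINT v|lborel. 1 / 2 * (norm (P \<xi> f v))\<^sup>2 + K * ((phi \<xi> v * norm (f v)) * wgrad \<xi> f v))"
  proof (rule integral_mono_divergence[where h="\<lambda>\<alpha> v. (cf \<alpha> v *\<^sub>R tder \<alpha> f v) \<bullet> U v"])
    show "rapid (\<lambda>v. 1 / 2 * (norm (A f v))\<^sup>2)" by (intro rapid_mult slow_const rapid_norm_sq rapid_A f)
    show "rapid (\<lambda>v. 1 / 2 * (norm (P \<xi> f v))\<^sup>2 + K * ((phi \<xi> v * norm (f v)) * wgrad \<xi> f v))"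
      by (intro rapid_add rapid_mult[OF slow_const] rapid_norm_sq rapid_P f
        rapid_mult[OF rapid_imp_slow[OF rapid_phi_norm[OF \<xi> f]]] rapid_wgrad \<xi>)
    show "rapid1 (\<lambda>v. (cf \<alpha> v *\<^sub>R tder \<alpha> f v) \<bullet> U v)" for \<alpha>
      by (intro rapid1_inner rapid1_flux f U1)
    fix v
    define T where "T \<alpha> = tder \<alpha> f v" for \<alpha>
    define W where "W \<alpha> = tder \<alpha> (\<lambda>v. cf \<alpha> v *\<^sub>R tder \<alpha> f v) v" for \<alpha>
    \<comment> \<open>The product of T_\<alpha> f with \<i> (v . \<xi>) T_\<alpha> f has vanishing
      real part. Besides \<open>W \<alpha> \<bullet> U v\<close>, which sums to minus the pairing of
      \<open>A f\<close> with \<open>U\<close>, only the commutator term remains.\<close>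
    have div: "tder \<alpha> (\<lambda>v. (cf \<alpha> v *\<^sub>R tder \<alpha> f v) \<bullet> U v) v
        = cf \<alpha> v * (fld \<alpha> v \<bullet> \<xi>) * (T \<alpha> \<bullet> (\<i> * f v)) + W \<alpha> \<bullet> U v" for \<alpha>
      unfolding tder_inner[OF rapid1_imp_slow1[OF rapid1_flux[OF f]] rapid1_imp_slow1[OF U1]]
      unfolding U_def[abs_def] tder_transport[OF rf(3)] T_def W_def
      by (simp add: inner_add_right inner_complex_def algebra_simps)
    have AU: "A f v \<bullet> U v = - (\<Sum>\<alpha>\<in>UNIV. W \<alpha> \<bullet> U v)"
      unfolding diffop_def W_def by (simp add: inner_diff_left inner_minus_left inner_add_left inner_sum_left U_def)
    \<comment> \<open>Coefficient and commutator together have size <v>^\<gamma> mm, and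
      \<open>phi_psi\<close> distributes this weight over |f| and |T_\<alpha> f|.\<close>
    have each: "cf \<alpha> v * (fld \<alpha> v \<bullet> \<xi>) * (T \<alpha> \<bullet> (\<i> * f v)) \<ge> - (K * (bracket v powr \<gamma> * mm \<xi> v) * norm (f v) * norm (T \<alpha>))" for \<alpha>
    proof -
      have "\<bar>cf \<alpha> v * (fld \<alpha> v \<bullet> \<xi>) * (T \<alpha> \<bullet> (\<i> * f v))\<bar> \<le> (K * bracket v powr \<gamma>) * mm \<xi> v * (norm (T \<alpha>) * norm (f v))"
        unfolding abs_mult using cf_nonneg[of \<alpha> v] cf_upper[of \<alpha> v] fld_xi_le[of \<alpha> v \<xi>] Cauchy_Schwarz_ineq2[of "T \<alpha>" "\<i> * f v"] K_pos
        by (intro mult_mono) (auto simp: norm_mult mm_def msq_def)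
      then show ?thesis by (simp add: mult_ac)
    qed
    have "- (\<Sum>\<alpha>\<in>UNIV. K * (bracket v powr \<gamma> * mm \<xi> v) * norm (f v) * norm (T \<alpha>))
        \<le> (\<Sum>\<alpha>\<in>UNIV. cf \<alpha> v * (fld \<alpha> v \<bullet> \<xi>) * (T \<alpha> \<bullet> (\<i> * f v)))"
      unfolding sum_negf[symmetric] by (rule sum_mono) (rule each)
    moreover have "(\<Sum>\<alpha>\<in>UNIV. K * (bracket v powr \<gamma> * mm \<xi> v) * norm (f v) * norm (T \<alpha>))
        = K * ((phi \<xi> v * norm (f v)) * (psi \<xi> v * grad_sum f v))"
      unfolding phi_psi[OF \<xi>] sum_distrib_left[symmetric] grad_sum_def T_def by (simp add: mult_ac)
    moreover have "K * ((phi \<xi> v * norm (f v)) * (psi \<xi> v * grad_sum f v)) \<le> K * ((phi \<xi> v * norm (f v)) * wgrad \<xi> f v)"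
      unfolding wgrad_def using K_pos phi_pos[OF \<xi>, of v] psi_pos[OF \<xi>, of v]
      by (intro mult_left_mono) auto
    ultimately have cross: "- (\<Sum>\<alpha>\<in>UNIV. cf \<alpha> v * (fld \<alpha> v \<bullet> \<xi>) * (T \<alpha> \<bullet> (\<i> * f v))) \<le> K * ((phi \<xi> v * norm (f v)) * wgrad \<xi> f v)"
      by linarith
    \<comment> \<open>\<open>A f\<close> is paired with \<open>P \<xi> f\<close> instead of
      expanding the square of the sum. Half of |A f|^2 is absorbed, so both sides keep the factor 1
      / 2.\<close>
    have "(norm (A f v))\<^sup>2 = A f v \<bullet> P \<xi> f v - A f v \<bullet> U v"
      unfolding fibre_op_def U_def by (simp add: inner_add_right power2_norm_eq_inner)
    also have "A f v \<bullet> P \<xi> f v \<le> norm (A f v) * norm (P \<xi> f v)" by (rule norm_cauchy_schwarz)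
    also have "norm (A f v) * norm (P \<xi> f v) \<le> 1 / 2 * (norm (A f v))\<^sup>2 + 1 / 2 * (norm (P \<xi> f v))\<^sup>2"
      using sum_squares_bound[of "norm (A f v)" "norm (P \<xi> f v)"] by simp
    finally have "1 / 2 * (norm (A f v))\<^sup>2 \<le> 1 / 2 * (norm (P \<xi> f v))\<^sup>2 + (\<Sum>\<alpha>\<in>UNIV. W \<alpha> \<bullet> U v)"
      unfolding AU by simp
    then show "1 / 2 * (norm (A f v))\<^sup>2 \<le> 1 / 2 * (norm (P \<xi> f v))\<^sup>2 + K * ((phi \<xi> v * norm (f v)) * wgrad \<xi> f v)
        + (\<Sum>\<alpha>\<in>UNIV. tder \<alpha> (\<lambda>v. (cf \<alpha> v *\<^sub>R tder \<alpha> f v) \<bullet> U v) v)"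
      using cross unfolding div sum.distrib by linarith
  qed
  also have "\<dots> = 1 / 2 * (LINT v|lborel. (norm (P \<xi> f v))\<^sup>2) + K * (LINT v|lborel. (phi \<xi> v * norm (f v)) * wgrad \<xi> f v)"
    by (simp add: integrable_rapid rapid_norm_sq rapid_P f
        rapid_mult[OF rapid_imp_slow[OF rapid_phi_norm[OF \<xi> f]]] rapid_wgrad \<xi>)
  also have "\<dots> \<le> 1 / 2 * data \<xi> f + K * (sqrt (gain \<xi> f) * (sqrt 12 * sqrt (dissip \<xi> f)))"
  proof (intro add_mono mult_left_mono)
    show "(LINT v|lborel. (norm (P \<xi> f v))\<^sup>2) \<le> data \<xi> f" unfolding data_def by simp
    have "(LINT v|lborel. (phi \<xi> v * norm (f v)) * wgrad \<xi> f v) \<le> sqrt (gain \<xi> f) * sqrt (LINT v|lborel. (wgrad \<xi> f v)\<^sup>2)"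
      unfolding gain_def by (rule integral_Cauchy_Schwarz[OF rapid_phi_norm[OF \<xi> f] rapid_wgrad[OF \<xi> f]])
    also have "\<dots> \<le> sqrt (gain \<xi> f) * sqrt (12 * dissip \<xi> f)"
      by (intro mult_left_mono real_sqrt_le_mono wgrad_sq \<xi> f) (simp add: gain_nonneg)
    finally show "(LINT v|lborel. (phi \<xi> v * norm (f v)) * wgrad \<xi> f v) \<le> sqrt (gain \<xi> f) * (sqrt 12 * sqrt (dissip \<xi> f))"
      by (simp only: real_sqrt_mult)
  qed (use K_pos in auto)
  finally show ?thesis unfolding elliptic_def by (simp add: mult_ac)
qed

text \<open>The multiplier \<open>\<omega> \<Sum> (T\<^sub>\<alpha>(v \<cdot> \<xi>)) T\<^sub>\<alpha>\<close> has the commutator \<open>\<omega> \<Sum> (T\<^sub>\<alpha>(v \<cdot> \<xi>))\<^sup>2 = phi\<^sup>2\<close> with the transport term.\<close>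
lemma gain_le:
  "\<exists>C>0. \<forall>\<xi> f. schwartz f \<longrightarrow> \<xi> \<noteq> 0 \<longrightarrow> gain \<xi> f \<le> C * (sqrt (data \<xi> f + elliptic f) * sqrt (dissip \<xi> f))"
proof -
  define d where "d = \<bar>2 * \<gamma> / 3\<bar> + 2 / 3"
  \<comment> \<open>Six fields, and for each the derivative of its coefficient is at most (1 + d)
    <v> psi: 1 from differentiating the field, d from differentiating \<open>omega\<close>. The same
    \<open>k\<close> covers the factor 2 of the first-order part.\<close>
  define k where "k = 6 * (1 + d)"
  have d: "d \<ge> 0" unfolding d_def by simp
  have k: "k \<ge> 2" unfolding k_def using d by simp
  have "gain \<xi> f \<le> k * sqrt 24 * (sqrt (data \<xi> f + elliptic f) * sqrt (dissip \<xi> f))" if f: "schwartz f" and \<xi>: "\<xi> \<noteq> 0" for \<xi> f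
  proof -
    have rf: "rapid1 f" "rapid f" "slow1 f" using f by (auto intro: schwartz_rapid1 schwartz_rapid rapid1_imp_slow1)
    define b where "b \<alpha> v = omega \<xi> v * (fld \<alpha> v \<bullet> \<xi>)" for \<alpha> v
    have sb: "slow1 (b \<alpha>)" for \<alpha> unfolding b_def[abs_def] by (intro slow1_mult slow1_omega \<xi> slow1_fld_inner)
    let ?R = "\<lambda>v. norm (P \<xi> f v) + norm (A f v)"
    have rR: "rapid ?R" by (intro rapid_add rapid_norm rapid_P rapid_A f)
    have "(LINT v|lborel. (phi \<xi> v * norm (f v))\<^sup>2) \<le> (LINT v|lborel. k * (?R v * wgrad \<xi> f v))"
    \<comment> \<open>The flux carries the multiplier coefficient and also v . \<xi>. A derivative
      falling on v . \<xi> produces phi^2 |f|^2 after summation; the two other terms still contain v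
      . \<xi> as a factor.\<close>
    proof (rule integral_mono_divergence[where h="\<lambda>\<alpha> v. (b \<alpha> v * (v \<bullet> \<xi>)) *\<^sub>R (f v \<bullet> f v)"])
      show "rapid (\<lambda>v. (phi \<xi> v * norm (f v))\<^sup>2)" by (intro rapid_power2 rapid_phi_norm \<xi> f)
      show "rapid (\<lambda>v. k * (?R v * wgrad \<xi> f v))"
        by (intro rapid_mult[OF slow_const] rapid_mult[OF rapid_imp_slow[OF rR]] rapid_wgrad \<xi> f)
      show "rapid1 (\<lambda>v. (b \<alpha> v * (v \<bullet> \<xi>)) *\<^sub>R (f v \<bullet> f v))" for \<alpha>
        by (intro rapid1_scaleR rapid1_inner slow1_mult sb slow1_inner_const rf)
      fix v
      define T where "T \<alpha> = tder \<alpha> f v" for \<alpha>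
      define V where "V = v \<bullet> \<xi>"
      \<comment> \<open>The antisymmetrised multiplier applied to \<open>f\<close>: twice the
        first-order part plus the divergence of its coefficients.\<close>
      define g where "g = 2 *\<^sub>R (\<Sum>\<alpha>\<in>UNIV. b \<alpha> v *\<^sub>R T \<alpha>) + (\<Sum>\<alpha>\<in>UNIV. tder \<alpha> (b \<alpha>) v) *\<^sub>R f v"
      have div: "tder \<alpha> (\<lambda>v. (b \<alpha> v * (v \<bullet> \<xi>)) *\<^sub>R (f v \<bullet> f v)) v
          = 2 * V * (b \<alpha> v * (f v \<bullet> T \<alpha>)) + V * (tder \<alpha> (b \<alpha>) v * (f v \<bullet> f v)) + b \<alpha> v * (fld \<alpha> v \<bullet> \<xi>) * (norm (f v))\<^sup>2" for \<alpha>
        unfolding tder_scaleR[OF slow1_mult[OF sb slow1_inner_const] rapid1_imp_slow1[OF rapid1_inner[OF rf(1) rf(1)]]]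
          tder_inner[OF rf(3) rf(3)] tder_mult[OF sb slow1_inner_const] tder_inner_const
        by (simp add: T_def V_def power2_norm_eq_inner inner_commute algebra_simps)
      have "(\<Sum>\<alpha>\<in>UNIV. b \<alpha> v * (fld \<alpha> v \<bullet> \<xi>)) = (phi \<xi> v)\<^sup>2"
        unfolding b_def omega_mm_sq[OF \<xi>, symmetric] fld_xi_sq[symmetric] sum_distrib_left
        by (simp add: power2_eq_square mult_ac)
      then have bs: "(\<Sum>\<alpha>\<in>UNIV. b \<alpha> v * (fld \<alpha> v \<bullet> \<xi>) * (norm (f v))\<^sup>2) = (phi \<xi> v * norm (f v))\<^sup>2"
        unfolding sum_distrib_right[symmetric] by (simp add: power_mult_distrib)
      have fg: "f v \<bullet> g = 2 * (\<Sum>\<alpha>\<in>UNIV. b \<alpha> v * (f v \<bullet> T \<alpha>)) + (\<Sum>\<alpha>\<in>UNIV. tder \<alpha> (b \<alpha>) v * (f v \<bullet> f v))"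
        unfolding g_def by (simp add: inner_add_right inner_sum_right sum_distrib_right)
      have divs: "(\<Sum>\<alpha>\<in>UNIV. tder \<alpha> (\<lambda>v. (b \<alpha> v * (v \<bullet> \<xi>)) *\<^sub>R (f v \<bullet> f v)) v) = V * (f v \<bullet> g) + (phi \<xi> v * norm (f v))\<^sup>2"
        unfolding div sum.distrib bs fg by (simp add: sum_distrib_left[symmetric] distrib_left mult_ac)
      \<comment> \<open>The unbounded factor v . \<xi> is eliminated by \<i> (v . \<xi>) f = P f - A
        f, whose two parts are measured by \<open>data\<close> and \<open>elliptic\<close>.\<close>
      have "V * (f v \<bullet> g) = (P \<xi> f v - A f v) \<bullet> (\<i> * g)"
        unfolding fibre_op_def V_def by (simp add: inner_i_both)
      also have "\<dots> \<ge> - (norm (P \<xi> f v - A f v) * norm (\<i> * g))"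
        using Cauchy_Schwarz_ineq2[of "P \<xi> f v - A f v" "\<i> * g"] by linarith
      finally have Vg: "V * (f v \<bullet> g) \<ge> - (norm (P \<xi> f v - A f v) * norm g)" by (simp add: norm_mult)
      have wpos: "omega \<xi> v > 0" "psi \<xi> v > 0" "mm \<xi> v > 0" using omega_pos psi_pos mm_pos \<xi> by auto
      have b_le: "\<bar>b \<alpha> v\<bar> \<le> psi \<xi> v" for \<alpha>
        unfolding b_def omega_mm[OF \<xi>, symmetric] abs_mult using wpos fld_xi_le[of \<alpha> v \<xi>]
        by (simp add: mult_left_mono)
      have tb_le: "\<bar>tder \<alpha> (b \<alpha>) v\<bar> \<le> (1 + d) * bracket v * psi \<xi> v" for \<alpha>
      proof -
        have W: "omega \<xi> = (\<lambda>v. bracket v powr (2 * \<gamma> / 3) * mm \<xi> v powr (- (2 / 3)))" by (rule ext) (rule omega_def)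
        have to: "\<bar>tder \<alpha> (omega \<xi>) v\<bar> \<le> d * bracket v * omega \<xi> v"
          using tder_weight[OF \<xi> W, of \<alpha> v] unfolding d_def by simp
        have "\<bar>tder \<alpha> (b \<alpha>) v\<bar> = \<bar>omega \<xi> v * tder \<alpha> (\<lambda>v. fld \<alpha> v \<bullet> \<xi>) v + tder \<alpha> (omega \<xi>) v * (fld \<alpha> v \<bullet> \<xi>)\<bar>"
          unfolding b_def[abs_def] tder_mult[OF slow1_omega[OF \<xi>] slow1_fld_inner] ..
        also have "\<dots> \<le> omega \<xi> v * \<bar>tder \<alpha> (\<lambda>v. fld \<alpha> v \<bullet> \<xi>) v\<bar> + \<bar>tder \<alpha> (omega \<xi>) v\<bar> * \<bar>fld \<alpha> v \<bullet> \<xi>\<bar>"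
          using wpos by (intro order_trans[OF abs_triangle_ineq]) (simp add: abs_mult)
        also have "\<dots> \<le> omega \<xi> v * (bracket v * mm \<xi> v) + (d * bracket v * omega \<xi> v) * mm \<xi> v"
          using wpos d by (intro add_mono mult_mono tder_fld_xi to fld_xi_le) auto
        also have "\<dots> = (1 + d) * bracket v * psi \<xi> v" unfolding omega_mm[OF \<xi>, symmetric] by (simp add: algebra_simps)
        finally show ?thesis .
      qed
      have "norm g \<le> 2 * norm (\<Sum>\<alpha>\<in>UNIV. b \<alpha> v *\<^sub>R T \<alpha>) + \<bar>\<Sum>\<alpha>\<in>UNIV. tder \<alpha> (b \<alpha>) v\<bar> * norm (f v)"
        unfolding g_def by (rule order_trans[OF norm_triangle_ineq]) simp
      also have "\<dots> \<le> 2 * (psi \<xi> v * grad_sum f v) + (6 * ((1 + d) * bracket v * psi \<xi> v)) * norm (f v)"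
      proof (intro add_mono mult_left_mono mult_right_mono)
        show "norm (\<Sum>\<alpha>\<in>UNIV. b \<alpha> v *\<^sub>R T \<alpha>) \<le> psi \<xi> v * grad_sum f v"
          unfolding grad_sum_def sum_distrib_left T_def[symmetric]
          by (rule sum_norm_le) (simp add: b_le mult_right_mono)
        have "\<bar>\<Sum>\<alpha>\<in>(UNIV :: (3 + 3) set). tder \<alpha> (b \<alpha>) v\<bar> \<le> (\<Sum>\<alpha>\<in>(UNIV :: (3 + 3) set). (1 + d) * bracket v * psi \<xi> v)"
          by (rule order_trans[OF sum_abs sum_mono[OF tb_le]])
        then show "\<bar>\<Sum>\<alpha>\<in>UNIV. tder \<alpha> (b \<alpha>) v\<bar> \<le> 6 * ((1 + d) * bracket v * psi \<xi> v)" by simp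
      qed auto
      also have "\<dots> \<le> k * (psi \<xi> v * grad_sum f v) + k * bracket v * psi \<xi> v * norm (f v)"
        using k wpos grad_sum_nonneg[of f v] by (intro add_mono mult_right_mono) (auto simp: k_def mult_ac)
      also have "\<dots> = k * wgrad \<xi> f v" unfolding wgrad_def by (simp add: algebra_simps)
      finally have ng: "norm g \<le> k * wgrad \<xi> f v" .
      have "norm (P \<xi> f v - A f v) * norm g \<le> ?R v * (k * wgrad \<xi> f v)"
        by (intro mult_mono norm_triangle_ineq4 ng) auto
      then show "(phi \<xi> v * norm (f v))\<^sup>2 \<le> k * (?R v * wgrad \<xi> f v)
          + (\<Sum>\<alpha>\<in>UNIV. tder \<alpha> (\<lambda>v. (b \<alpha> v * (v \<bullet> \<xi>)) *\<^sub>R (f v \<bullet> f v)) v)"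
        unfolding divs using Vg by (simp add: mult.left_commute)
    qed
    also have "\<dots> = k * (LINT v|lborel. ?R v * wgrad \<xi> f v)" by (rule integral_mult_right_zero)
    also have "\<dots> \<le> k * (sqrt (LINT v|lborel. (?R v)\<^sup>2) * sqrt (LINT v|lborel. (wgrad \<xi> f v)\<^sup>2))"
      using k by (intro mult_left_mono integral_Cauchy_Schwarz rR rapid_wgrad \<xi> f) auto
    also have "\<dots> \<le> k * (sqrt (2 * (data \<xi> f + elliptic f)) * sqrt (12 * dissip \<xi> f))"
    proof (intro mult_left_mono mult_mono real_sqrt_le_mono wgrad_sq \<xi> f)
      have "(LINT v|lborel. (?R v)\<^sup>2) \<le> (LINT v|lborel. 2 * (norm (P \<xi> f v))\<^sup>2 + 2 * (norm (A f v))\<^sup>2)"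
        by (rule integral_rapid_mono) (intro rapid_power2 rR rapid_add rapid_mult[OF slow_const] rapid_norm_sq rapid_P rapid_A f sq_add_le)+
      also have "\<dots> = 2 * (LINT v|lborel. (norm (P \<xi> f v))\<^sup>2) + 2 * elliptic f"
        unfolding elliptic_def by (simp add: integrable_rapid rapid_norm_sq rapid_P rapid_A f)
      also have "\<dots> \<le> 2 * (data \<xi> f + elliptic f)" unfolding data_def by simp
      finally show "(LINT v|lborel. (?R v)\<^sup>2) \<le> 2 * (data \<xi> f + elliptic f)" .
    qed (use k data_nonneg elliptic_nonneg in \<open>auto intro!: integral_nonneg_AE\<close>)
    also have "\<dots> = k * sqrt 24 * (sqrt (data \<xi> f + elliptic f) * sqrt (dissip \<xi> f))"
    proof -
      have "sqrt 24 = sqrt 2 * sqrt 12" by (simp add: real_sqrt_mult[symmetric])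
      then show ?thesis by (simp only: real_sqrt_mult mult_ac)
    qed
    finally show ?thesis unfolding gain_def .
  qed
  then show ?thesis using k by (intro exI[of _ "k * sqrt 24"]) auto
qed

lemma hypoelliptic:
  "\<exists>C>0. \<forall>\<xi> f. schwartz f \<longrightarrow> \<xi> \<noteq> 0 \<longrightarrow> gain \<xi> f \<le> C * data \<xi> f \<and> elliptic f \<le> C * data \<xi> f"
proof -
  obtain C1 where C1: "C1 > 0" "\<And>\<xi> f. schwartz f \<Longrightarrow> \<xi> \<noteq> 0 \<Longrightarrow> dissip \<xi> f \<le> C1 * (sqrt (gain \<xi> f) * sqrt (data \<xi> f))"
    using dissip_le by blast
  obtain C2 where C2: "C2 > 0" "\<And>\<xi> f. schwartz f \<Longrightarrow> \<xi> \<noteq> 0 \<Longrightarrow> gain \<xi> f \<le> C2 * (sqrt (data \<xi> f + elliptic f) * sqrt (dissip \<xi> f))"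
    using gain_le by blast
  \<comment> \<open>One constant for the three inequalities, at least 1 as
    \<open>closing_inequality\<close> requires and independent of \<xi> and
    \<open>f\<close>.\<close>
  define C where "C = 1 + C1 + C2 + 2 * K * sqrt 12"
  have C: "C \<ge> 1" "C1 \<le> C" "C2 \<le> C" "2 * K * sqrt 12 \<le> C" unfolding C_def using C1(1) C2(1) K_pos by auto
  have "gain \<xi> f \<le> (5 * C ^ 9)\<^sup>2 * data \<xi> f \<and> elliptic f \<le> C * (1 + 25 * C ^ 19) * data \<xi> f"
    if f: "schwartz f" and \<xi>: "\<xi> \<noteq> 0" for \<xi> f
  proof -
    define X Y Z q where "X = sqrt (gain \<xi> f)" and "Y = sqrt (elliptic f)" and "Z = sqrt (dissip \<xi> f)" and "q = sqrt (data \<xi> f)"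
    have nn: "X \<ge> 0" "Y \<ge> 0" "Z \<ge> 0" "q \<ge> 0" unfolding X_def Y_def Z_def q_def
      by (simp_all add: gain_nonneg elliptic_nonneg dissip_nonneg data_nonneg)
    have sq: "X\<^sup>2 = gain \<xi> f" "Y\<^sup>2 = elliptic f" "Z\<^sup>2 = dissip \<xi> f" "q\<^sup>2 = data \<xi> f" unfolding X_def Y_def Z_def q_def
      by (simp_all add: gain_nonneg elliptic_nonneg dissip_nonneg data_nonneg)
    have 1: "Z\<^sup>2 \<le> C * (X * q)"
      using C1(2)[OF f \<xi>] mult_right_mono[OF C(2), of "X * q"] nn unfolding sq unfolding X_def q_def by auto
    have "Y\<^sup>2 \<le> q\<^sup>2 + 2 * K * sqrt 12 * (X * Z)"
      using elliptic_le[OF f \<xi>] unfolding sq unfolding X_def Z_def .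
    also have "\<dots> \<le> C * q\<^sup>2 + C * (X * Z)"
      using C nn mult_right_mono[OF C(1), of "q\<^sup>2"] by (intro add_mono mult_right_mono) auto
    finally have 2: "Y\<^sup>2 \<le> C * (q\<^sup>2 + X * Z)" by (simp add: distrib_left)
    have 3: "X\<^sup>2 \<le> C * (sqrt (q\<^sup>2 + Y\<^sup>2) * Z)"
    proof -
      have "0 \<le> sqrt (q\<^sup>2 + Y\<^sup>2) * Z" using nn by simp
      from mult_right_mono[OF C(3) this] C2(2)[OF f \<xi>] show ?thesis unfolding sq unfolding Z_def by linarith
    qed
    note cl = closing_inequality[OF nn C(1) 1 2 3]
    have "X\<^sup>2 \<le> ((5 * C ^ 9) * q)\<^sup>2" by (rule power_mono[OF cl(1) nn(1)])
    then show ?thesis using cl(2) unfolding power_mult_distrib sq by simp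
  qed
  moreover have "(5 * C ^ 9)\<^sup>2 * data \<xi> f \<le> ((5 * C ^ 9)\<^sup>2 + C * (1 + 25 * C ^ 19)) * data \<xi> f"
    "C * (1 + 25 * C ^ 19) * data \<xi> f \<le> ((5 * C ^ 9)\<^sup>2 + C * (1 + 25 * C ^ 19)) * data \<xi> f" for \<xi> f
    using C(1) data_nonneg[of \<xi> f] by (auto intro!: mult_right_mono)
  moreover have "(5 * C ^ 9)\<^sup>2 + C * (1 + 25 * C ^ 19) > 0" using C(1) by (auto intro!: add_nonneg_pos mult_pos_pos add_pos_nonneg)
  ultimately show ?thesis
    by (intro exI[of _ "(5 * C ^ 9)\<^sup>2 + C * (1 + 25 * C ^ 19)"]) (meson order_trans)
qed

end

section \<open>Second derivatives\<close>

definition trans_sq where "trans_sq f v = (\<Sum>j\<in>UNIV. tder (Inl j) (tder (Inl j) f) v)"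

definition rot_sq where "rot_sq f v = (\<Sum>j\<in>UNIV. tder (Inr j) (tder (Inr j) f) v)"

lemma schwartz_partial_vec: "schwartz f \<Longrightarrow> schwartz (partial w f)"
proof -
  assume f: "schwartz f"
  have "partial w f = (\<lambda>v. \<Sum>b\<in>Basis. complex_of_real (w \<bullet> b) * partial b f v)"
    using partial_sum_Basis[OF schwartz_differentiable[OF f], of w] by (auto simp: scaleR_conv_of_real)
  then show ?thesis using f by (simp add: schwartz_sum schwartz_cmult schwartz_partial)
qed

lemma schwartz_partial_commute: "schwartz f \<Longrightarrow> partial a (partial b f) v = partial b (partial a f) v"
  by (intro partial_commute schwartz_differentiable schwartz_partial_vec)

lemma tder_Inl: "tder (Inl j) f = partial (axis j 1) f"
  unfolding tder_def[abs_def] fld_def by simp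

text \<open>The rotation field is linear in v, so its commutator with a translation is the constant
  field obtained by inserting the direction of the translation.\<close>

lemma tder_Inl_Inr:
  assumes f: "schwartz f"
  shows "tder (Inl j) (tder (Inr k) f) v = tder (Inr k) (tder (Inl j) f) v + partial (cross3 (axis k 1) (axis j 1)) f v"
proof -
  let ?e = "axis j 1 :: real^3"
  have d: "f differentiable (at v)" "partial b f differentiable (at v)" for b v
    using f by (auto intro: schwartz_differentiable schwartz_partial_vec)
  have sd: "(\<lambda>v. fld (Inr k) v \<bullet> b) differentiable (at v)" for b v by (rule slow1D(1)[OF slow1_fld_inner])
  have "tder (Inr k) f = (\<lambda>v. \<Sum>b\<in>Basis. (fld (Inr k) v \<bullet> b) *\<^sub>R partial b f v)"
    unfolding tder_def[abs_def] using partial_sum_Basis[OF d(1)] by blast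
  then have "tder (Inl j) (tder (Inr k) f) v = partial ?e (\<lambda>v. \<Sum>b\<in>Basis. (fld (Inr k) v \<bullet> b) *\<^sub>R partial b f v) v"
    unfolding tder_Inl by simp
  also have "\<dots> = (\<Sum>b\<in>Basis. partial ?e (\<lambda>v. (fld (Inr k) v \<bullet> b) *\<^sub>R partial b f v) v)"
    by (rule partial_sum) (intro differentiable_scaleR sd d)
  also have "\<dots> = (\<Sum>b\<in>Basis. (fld (Inr k) v \<bullet> b) *\<^sub>R partial b (partial ?e f) v + (cross3 (axis k 1) ?e \<bullet> b) *\<^sub>R partial b f v)"
    by (intro sum.cong refl) (simp add: partial_scaleR[OF sd d(2)] partial_fld_inner schwartz_partial_commute[OF f, of ?e])
  also have "\<dots> = partial (fld (Inr k) v) (partial ?e f) v + partial (cross3 (axis k 1) ?e) f v"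
    unfolding partial_sum_Basis[OF d(2), of "fld (Inr k) v"] partial_sum_Basis[OF d(1), of "cross3 (axis k 1) ?e"] by (simp add: sum.distrib)
  finally show ?thesis unfolding tder_Inl tder_def .
qed

text \<open>Commuting past both translations leaves twice the sum over j of the derivatives along
  e_k x e_j and e_j. This contracts an antisymmetric matrix with the symmetric Hessian and
  vanishes.\<close>

lemma tder_Inr_trans_sq:
  assumes f: "schwartz f"
  shows "tder (Inr k) (trans_sq f) v = trans_sq (tder (Inr k) f) v"
proof -
  let ?w = "\<lambda>j. cross3 (axis k 1) (axis j 1) :: real^3"
  let ?D = "\<lambda>j. partial (axis j 1) :: (real^3 \<Rightarrow> complex) \<Rightarrow> real^3 \<Rightarrow> complex"
  have s: "schwartz (?D j f)" for j using f by (rule schwartz_partial_vec)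
  have each: "tder (Inl j) (tder (Inl j) (tder (Inr k) f)) v = tder (Inr k) (?D j (?D j f)) v + 2 *\<^sub>R partial (?w j) (?D j f) v" for j
  proof -
    have "tder (Inl j) (tder (Inr k) f) = (\<lambda>v. tder (Inr k) (?D j f) v + partial (?w j) f v)"
      by (rule ext, subst tder_Inl_Inr[OF f], simp only: tder_Inl)
    then have "tder (Inl j) (tder (Inl j) (tder (Inr k) f)) v = tder (Inl j) (\<lambda>v. tder (Inr k) (?D j f) v + partial (?w j) f v) v"
      by simp
    also have "\<dots> = tder (Inl j) (tder (Inr k) (?D j f)) v + ?D j (partial (?w j) f) v"
      unfolding tder_Inl by (rule partial_add) (intro schwartz_differentiable schwartz_tder schwartz_partial_vec f)+
    also have "\<dots> = tder (Inr k) (?D j (?D j f)) v + partial (?w j) (?D j f) v + partial (?w j) (?D j f) v"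
      unfolding tder_Inl_Inr[OF s] schwartz_partial_commute[OF f, of "axis j 1" "?w j"] unfolding tder_Inl ..
    finally show ?thesis by (simp add: scaleR_2)
  qed
  have lin: "linear (\<lambda>w. partial w (?D j f) v)" for j by (intro linear_partial schwartz_differentiable s)
  have comm: "?D i (?D j f) v = ?D j (?D i f) v" for i j by (rule schwartz_partial_commute[OF f])
  have "k = 1 \<or> k = 2 \<or> k = 3" by (rule exhaust_3)
  then have zero: "(\<Sum>j\<in>UNIV. partial (?w j) (?D j f) v) = 0"
    unfolding sum_3
    by (elim disjE) (simp_all add: cross_basis linear_neg[OF lin] linear_0[OF lin] comm[of 2 1] comm[of 3 1] comm[of 3 2])
  have "trans_sq (tder (Inr k) f) v = (\<Sum>j\<in>UNIV. tder (Inr k) (?D j (?D j f)) v) + 2 *\<^sub>R (\<Sum>j\<in>UNIV. partial (?w j) (?D j f) v)"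
    unfolding trans_sq_def each by (simp add: sum.distrib scaleR_sum_right)
  also have "\<dots> = (\<Sum>j\<in>UNIV. tder (Inr k) (?D j (?D j f)) v)" unfolding zero by simp
  also have "\<dots> = tder (Inr k) (trans_sq f) v"
    unfolding tder_def trans_sq_def[abs_def] fld_def[of "Inl _"] 
    by (subst partial_sum) (auto intro!: schwartz_differentiable schwartz_partial_vec f)
  finally show ?thesis by simp
qed

lemma schwartz_trans_sq: "schwartz f \<Longrightarrow> schwartz (trans_sq f)" and schwartz_rot_sq: "schwartz f \<Longrightarrow> schwartz (rot_sq f)"
  unfolding trans_sq_def[abs_def] rot_sq_def[abs_def] by (intro schwartz_sum schwartz_tder; assumption)+

section \<open>Elliptic regularity with variable coefficients\<close>

context landau_coeffs
begin

definition princ where "princ f v = lam v *\<^sub>R trans_sq f v + mu v *\<^sub>R rot_sq f v"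

text \<open>Leaving divergence form differentiates the coefficients once. The resulting first-order
  term and the term with F are within reach of \<open>weight_gain\<close>.\<close>

lemma princ_bound:
  assumes f: "schwartz f"
  shows "norm (princ f v) \<le> norm (A f v) + K * (bracket v powr (\<gamma> + 2) * norm (f v)) + K * (bracket v powr \<gamma> * grad_sum f v)"
proof -
  have e: "tder \<alpha> (\<lambda>v. cf \<alpha> v *\<^sub>R tder \<alpha> f v) v = cf \<alpha> v *\<^sub>R tder \<alpha> (tder \<alpha> f) v + tder \<alpha> (cf \<alpha>) v *\<^sub>R tder \<alpha> f v" for \<alpha>
    by (rule tder_scaleR[OF slow1_cf rapid1_imp_slow1[OF schwartz_tder_rapid1[OF f]]])
  have "princ f v = (\<Sum>\<alpha>\<in>UNIV. cf \<alpha> v *\<^sub>R tder \<alpha> (tder \<alpha> f) v)"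
    unfolding princ_def sum_UNIV_Plus coef_def trans_sq_def rot_sq_def by (simp add: scaleR_sum_right)
  then have "princ f v = (F v *\<^sub>R f v - A f v) - (\<Sum>\<alpha>\<in>UNIV. tder \<alpha> (cf \<alpha>) v *\<^sub>R tder \<alpha> f v)"
    unfolding diffop_def e sum.distrib by simp
  then have "norm (princ f v) \<le> (norm (F v *\<^sub>R f v) + norm (A f v)) + norm (\<Sum>\<alpha>\<in>UNIV. tder \<alpha> (cf \<alpha>) v *\<^sub>R tder \<alpha> f v)"
    by (simp only:) (intro order_trans[OF norm_triangle_ineq4] add_right_mono norm_triangle_ineq4)
  moreover have "norm (\<Sum>\<alpha>\<in>UNIV. tder \<alpha> (cf \<alpha>) v *\<^sub>R tder \<alpha> f v) \<le> K * (bracket v powr \<gamma> * grad_sum f v)"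
    unfolding grad_sum_def sum_distrib_left mult.assoc[symmetric]
    by (rule sum_norm_le) (use cf_tder in \<open>simp add: mult_right_mono\<close>)
  moreover have "norm (F v *\<^sub>R f v) \<le> K * (bracket v powr (\<gamma> + 2) * norm (f v))"
    using mult_right_mono[OF upper(3)[of v] norm_ge_zero[of "f v"]] F_nonneg[of v] by (simp add: mult.assoc)
  ultimately show ?thesis by simp
qed

text \<open>Half the coefficient of the cross term when the squared norm of \<open>princ f v\<close>
  is expanded.\<close>

definition rho where "rho v = lam v * mu v"

lemma slow1_rho: "slow1 rho" unfolding rho_def[abs_def] by (intro slow1_mult slow1_lam slow1_mu)

lemma rho_lower: "c\<^sup>2 * bracket v powr (2 * \<gamma>) \<le> rho v"
proof -
  have "(c * bracket v powr \<gamma>) * (c * bracket v powr \<gamma>) \<le> lam v * mu v"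
    using c_pos by (intro mult_mono lower order_trans[OF _ lower(1)]) auto
  then show ?thesis unfolding rho_def by (simp add: power2_eq_square mult_ac bracket_powr_mult)
qed

lemma rho_pos: "rho v > 0"
  using rho_lower[of v] c_pos by (intro less_le_trans[OF _ rho_lower]) simp

lemma rho_tder: "\<bar>tder \<alpha> rho v\<bar> \<le> 2 * K\<^sup>2 * bracket v powr (2 * \<gamma>)"
proof -
  let ?k = "K * bracket v powr \<gamma>"
  have l: "\<bar>lam v\<bar> \<le> ?k" "\<bar>mu v\<bar> \<le> ?k"
    using upper(1,2)[of v] cf_nonneg[of "Inl 1" v] cf_nonneg[of "Inr 1" v] by (auto simp: coef_def)
  have "\<bar>tder \<alpha> rho v\<bar> \<le> \<bar>lam v\<bar> * \<bar>tder \<alpha> mu v\<bar> + \<bar>tder \<alpha> lam v\<bar> * \<bar>mu v\<bar>"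
    unfolding rho_def[abs_def] tder_mult[OF slow1_lam slow1_mu] abs_mult[symmetric] by (rule abs_triangle_ineq)
  also have "\<dots> \<le> ?k * ?k + ?k * ?k"
    using K_pos by (intro add_mono mult_mono l upper_tder) auto
  also have "\<dots> = 2 * K\<^sup>2 * bracket v powr (2 * \<gamma>)"
    using bracket_powr_mult[of v \<gamma> \<gamma>] by (simp add: power2_eq_square mult_ac)
  finally show ?thesis .
qed

text \<open>Integrating by parts in \<open>Re \<integral> \<lambda>\<mu> \<Delta>f (v \<and> \<nabla>)\<^sup>2 f\<close> gives \<open>\<integral> \<lambda>\<mu> |\<nabla>(v \<and> \<nabla>)f|\<^sup>2\<close> up to first-order terms.\<close>
lemma second_order:
  "\<exists>C>0. \<forall>\<xi> f. schwartz f \<longrightarrow> \<xi> \<noteq> 0 \<longrightarrow>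
    (LINT v|lborel. bracket v powr (2 * \<gamma>) * ((norm (trans_sq f v))\<^sup>2 + (norm (rot_sq f v))\<^sup>2)) \<le> C * data \<xi> f"
proof -
  obtain C1 where C1: "C1 > 0" "\<And>\<xi> f. schwartz f \<Longrightarrow>
    (LINT v|lborel. bracket v powr (2 * \<gamma> + 2) * grad_sq f v) + (LINT v|lborel. bracket v powr (2 * \<gamma> + 4) * (norm (f v))\<^sup>2)
      \<le> C1 * data \<xi> f" using weight_gain by blast
  obtain C2 where C2: "C2 > 0" "\<And>\<xi> f. schwartz f \<Longrightarrow> \<xi> \<noteq> 0 \<Longrightarrow> elliptic f \<le> C2 * data \<xi> f"
    using hypoelliptic by blast
  \<comment> \<open>The three rotation fields contribute 2 e each, so 6 e = c^2 / 2: half of the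
    lower bound c^2 for the Laplacian term is given up.\<close>
  define e where "e = c\<^sup>2 / 12"
  have e: "e > 0" unfolding e_def using c_pos by simp
  define k1 where "k1 = 4 * K ^ 4 / e"
  define k2 where "k2 = K ^ 4 / c\<^sup>2"
  have k: "k1 \<ge> 0" "k2 \<ge> 0" unfolding k1_def k2_def using e K_pos by auto
  \<comment> \<open>18 = 3 * 6, from the three terms in \<open>princ_bound\<close> and the six
    fields in \<open>grad_sum_sq\<close>; the rest collects the first-order errors of the
    integration by parts.\<close>
  define M where "M = 18 * K\<^sup>2 + 2 * k1 + 6 * k2"
  have M: "M \<ge> 0" unfolding M_def using k by simp
  define C where "C = 2 / c\<^sup>2 * (3 * C2 + (3 * K\<^sup>2 + M) * C1 + 1)"
  have Cpos: "C > 0" unfolding C_def using c_pos C1(1) C2(1) M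
    by (intro mult_pos_pos add_nonneg_pos add_nonneg_nonneg mult_nonneg_nonneg) auto
  have "(LINT v|lborel. bracket v powr (2 * \<gamma>) * ((norm (trans_sq f v))\<^sup>2 + (norm (rot_sq f v))\<^sup>2)) \<le> C * data \<xi> f"
    if f: "schwartz f" and \<xi>: "\<xi> \<noteq> 0" for \<xi> f
  proof -
    define g where "g k = tder (Inr k) f" for k
    have sg: "schwartz (g k)" for k unfolding g_def by (rule schwartz_tder[OF f])
    have sT: "schwartz (trans_sq f)" "schwartz (rot_sq f)" using f by (auto intro: schwartz_trans_sq schwartz_rot_sq)
    \<comment> \<open>\<open>h1\<close> moves one rotation from \<open>rot_sq f\<close> onto the
      Laplacian, and \<open>h2\<close> then splits the Laplacian of \<open>g k\<close>. The terms
      with \<open>trans_sq (g k)\<close> cancel because rotations commute with the Laplacian; the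
      squared translation derivatives of \<open>g k\<close> with weight \<open>rho\<close> are left
      with a favourable sign.\<close>
    define h1 where "h1 k v = rho v *\<^sub>R (trans_sq f v \<bullet> g k v)" for k v
    define h2 where "h2 j k v = rho v *\<^sub>R (tder (Inl j) (g k) v \<bullet> g k v)" for j k v
    define h where "h \<alpha> v = (case \<alpha> of Inl j \<Rightarrow> \<Sum>k\<in>UNIV. 2 *\<^sub>R h2 j k v | Inr k \<Rightarrow> (-2) *\<^sub>R h1 k v)" for \<alpha> v
    have r1: "rapid1 (h1 k)" for k unfolding h1_def[abs_def]
      by (intro rapid1_scaleR slow1_rho rapid1_inner schwartz_rapid1 sg sT)
    have r2: "rapid1 (h2 j k)" for j k unfolding h2_def[abs_def]
      by (intro rapid1_scaleR slow1_rho rapid1_inner schwartz_rapid1 sg schwartz_tder)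
    have rh: "rapid1 (h \<alpha>)" for \<alpha>
    proof (cases \<alpha>)
      case (Inl j)
      then have "h \<alpha> = (\<lambda>v. \<Sum>k\<in>UNIV. 2 *\<^sub>R h2 j k v)" by (simp add: h_def fun_eq_iff)
      then show ?thesis by (simp only:) (intro rapid1_sum rapid1_scaleR slow1_const r2)
    next
      case (Inr k)
      then have "h \<alpha> = (\<lambda>v. (-2) *\<^sub>R h1 k v)" by (simp add: h_def fun_eq_iff)
      then show ?thesis by (simp only:) (intro rapid1_scaleR slow1_const r1)
    qed
    have "(LINT v|lborel. c\<^sup>2 / 2 * (bracket v powr (2 * \<gamma>) * ((norm (trans_sq f v))\<^sup>2 + (norm (rot_sq f v))\<^sup>2)))
      \<le> (LINT v|lborel. 3 * (norm (A f v))\<^sup>2 + 3 * K\<^sup>2 * (bracket v powr (2 * \<gamma> + 4) * (norm (f v))\<^sup>2) + M * (bracket v powr (2 * \<gamma> + 2) * grad_sq f v))"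
    proof (rule integral_mono_divergence[OF _ _ rh])
      show "rapid (\<lambda>v. c\<^sup>2 / 2 * (bracket v powr (2 * \<gamma>) * ((norm (trans_sq f v))\<^sup>2 + (norm (rot_sq f v))\<^sup>2)))"
        by (intro rapid_mult slow_const slow_bracket_powr rapid_add rapid_norm_sq schwartz_rapid sT)
      show "rapid (\<lambda>v. 3 * (norm (A f v))\<^sup>2 + 3 * K\<^sup>2 * (bracket v powr (2 * \<gamma> + 4) * (norm (f v))\<^sup>2) + M * (bracket v powr (2 * \<gamma> + 2) * grad_sq f v))"
        by (intro rapid_add rapid_mult slow_const slow_bracket_powr rapid_norm_sq rapid_A schwartz_rapid rapid_grad_sq f)
      fix v
      define B where "B = bracket v powr (2 * \<gamma>)"
      define L where "L = trans_sq f v"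
      define R where "R = rot_sq f v"
      have B: "B > 0" unfolding B_def by simp
      have rho: "rho v > 0" by (rule rho_pos)
      have d1: "tder (Inr k) (h1 k) v = rho v * (L \<bullet> tder (Inr k) (g k) v) + rho v * (trans_sq (g k) v \<bullet> g k v) + tder (Inr k) rho v * (L \<bullet> g k v)" for k
        unfolding h1_def[abs_def]
          tder_scaleR[OF slow1_rho rapid1_imp_slow1[OF rapid1_inner[OF schwartz_rapid1[OF sT(1)] schwartz_rapid1[OF sg]]]]
          tder_inner[OF rapid1_imp_slow1[OF schwartz_rapid1[OF sT(1)]] rapid1_imp_slow1[OF schwartz_rapid1[OF sg]]]
          tder_Inr_trans_sq[OF f] g_def[symmetric] L_def by (simp add: distrib_left)
      have d2: "tder (Inl j) (h2 j k) v = rho v * (norm (tder (Inl j) (g k) v))\<^sup>2 + rho v * (tder (Inl j) (tder (Inl j) (g k)) v \<bullet> g k v)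
          + tder (Inl j) rho v * (tder (Inl j) (g k) v \<bullet> g k v)" for j k
        unfolding h2_def[abs_def]
          tder_scaleR[OF slow1_rho rapid1_imp_slow1[OF rapid1_inner[OF schwartz_tder_rapid1[OF sg] schwartz_rapid1[OF sg]]]]
          tder_inner[OF rapid1_imp_slow1[OF schwartz_tder_rapid1[OF sg]] rapid1_imp_slow1[OF schwartz_rapid1[OF sg]]]
        by (simp add: distrib_left power2_norm_eq_inner)
      have divs: "(\<Sum>\<alpha>\<in>UNIV. tder \<alpha> (h \<alpha>) v) = (\<Sum>k\<in>UNIV. 2 * (\<Sum>j\<in>UNIV. tder (Inl j) (h2 j k) v) - 2 * tder (Inr k) (h1 k) v)"
      proof -
        have "h (Inl j) = (\<lambda>v. \<Sum>k\<in>UNIV. 2 * h2 j k v)" "h (Inr k) = (\<lambda>v. - 2 * h1 k v)" for j k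
          by (simp_all add: h_def fun_eq_iff)
        moreover have "tder (Inl j) (\<lambda>v. \<Sum>k\<in>UNIV. 2 * h2 j k v) v = (\<Sum>k\<in>UNIV. tder (Inl j) (\<lambda>v. 2 * h2 j k v) v)" for j
          unfolding tder_def by (rule partial_sum) (rule rapid1D(1)[OF rapid1_cmult[OF r2]])
        ultimately have "tder (Inl j) (h (Inl j)) v = (\<Sum>k\<in>UNIV. 2 * tder (Inl j) (h2 j k) v)" "tder (Inr k) (h (Inr k)) v = - 2 * tder (Inr k) (h1 k) v" for j k
          by (simp_all add: tder_cmult[OF rapid1_imp_slow1[OF r2]] tder_cmult[OF rapid1_imp_slow1[OF r1], of _ "-2", simplified])
        then show ?thesis unfolding sum_UNIV_Plus
          by (simp add: sum_subtractf sum_negf sum_distrib_left sum.swap[of "\<lambda>j k. 2 * tder (Inl j) (h2 j k) v"])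
      qed
      have per_k: "2 * (\<Sum>j\<in>UNIV. tder (Inl j) (h2 j k) v) - 2 * tder (Inr k) (h1 k) v
          \<ge> - 2 * (rho v * (L \<bullet> tder (Inr k) (g k) v)) - 2 * e * B * (norm L)\<^sup>2 - (2 * k1 + 6 * k2) * B * (norm (g k v))\<^sup>2" for k
      proof -
        \<comment> \<open>The gradient term absorbs the derivative of \<open>rho\<close>, since
          \<open>rho_lower\<close> gives it at least the weight c^2 B.\<close>
        have q: "rho v * (norm (tder (Inl j) (g k) v))\<^sup>2 + tder (Inl j) rho v * (tder (Inl j) (g k) v \<bullet> g k v) \<ge> - (k2 * B * (norm (g k v))\<^sup>2)" for j
        proof -
          define t where "t = tder (Inl j) rho v"
          define a where "a = norm (tder (Inl j) (g k) v)"
          define w where "w = norm (g k v)"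
          have t: "\<bar>t\<bar> \<le> 2 * K\<^sup>2 * B" unfolding t_def B_def by (rule rho_tder)
          have "\<bar>t * (tder (Inl j) (g k) v \<bullet> g k v)\<bar> \<le> \<bar>t\<bar> * (a * w)"
            unfolding abs_mult a_def w_def by (intro mult_left_mono Cauchy_Schwarz_ineq2) simp
          also have "\<dots> \<le> (2 * K\<^sup>2 * B) * (a * w)" using t by (intro mult_right_mono) (auto simp: a_def w_def)
          also have "\<dots> \<le> c\<^sup>2 * B * a\<^sup>2 + k2 * B * w\<^sup>2"
          proof -
            have "0 \<le> (c * a - K\<^sup>2 / c * w)\<^sup>2" by simp
            then have "2 * K\<^sup>2 * (a * w) \<le> c\<^sup>2 * a\<^sup>2 + k2 * w\<^sup>2"
              using c_pos unfolding k2_def by (simp add: power2_diff power_mult_distrib power_divide mult_ac)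
            then have "B * (2 * K\<^sup>2 * (a * w)) \<le> B * (c\<^sup>2 * a\<^sup>2 + k2 * w\<^sup>2)" using B by (intro mult_left_mono) auto
            then show ?thesis by (simp add: distrib_left mult_ac)
          qed
          also have "c\<^sup>2 * B * a\<^sup>2 \<le> rho v * a\<^sup>2" using rho_lower[of v] unfolding B_def by (intro mult_right_mono) auto
          finally show ?thesis unfolding t_def a_def w_def by simp
        qed
        have "(\<Sum>j\<in>(UNIV :: 3 set). - (k2 * B * (norm (g k v))\<^sup>2)) \<le> (\<Sum>j\<in>(UNIV :: 3 set). rho v * (norm (tder (Inl j) (g k) v))\<^sup>2 + tder (Inl j) rho v * (tder (Inl j) (g k) v \<bullet> g k v))"
          by (rule sum_mono) (rule q)
        then have q3: "- 3 * (k2 * B * (norm (g k v))\<^sup>2) \<le> (\<Sum>j\<in>(UNIV :: 3 set). rho v * (norm (tder (Inl j) (g k) v))\<^sup>2 + tder (Inl j) rho v * (tder (Inl j) (g k) v \<bullet> g k v))"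
          by simp
        have s2: "(\<Sum>j\<in>UNIV. tder (Inl j) (h2 j k) v) = (\<Sum>j\<in>UNIV. rho v * (norm (tder (Inl j) (g k) v))\<^sup>2 + tder (Inl j) rho v * (tder (Inl j) (g k) v \<bullet> g k v))
            + rho v * (trans_sq (g k) v \<bullet> g k v)"
          unfolding d2 trans_sq_def by (simp add: sum.distrib inner_sum_left sum_distrib_left)
        have p: "tder (Inr k) rho v * (L \<bullet> g k v) \<le> e * B * (norm L)\<^sup>2 + k1 * B * (norm (g k v))\<^sup>2"
        proof -
          define w where "w = norm (g k v)"
          have "tder (Inr k) rho v * (L \<bullet> g k v) \<le> \<bar>tder (Inr k) rho v\<bar> * \<bar>L \<bullet> g k v\<bar>" by (metis abs_ge_self abs_mult)
          also have "\<dots> \<le> (2 * K\<^sup>2 * B) * (norm L * w)"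
            unfolding B_def w_def by (intro mult_mono rho_tder Cauchy_Schwarz_ineq2) auto
          also have "\<dots> \<le> e * B * (norm L)\<^sup>2 + k1 * B * w\<^sup>2"
          proof -
            have "0 \<le> (e * norm L - K\<^sup>2 * w)\<^sup>2" by simp
            then have "e * (2 * K\<^sup>2 * (norm L * w)) \<le> e * (e * (norm L)\<^sup>2 + K ^ 4 / e * w\<^sup>2)"
              using e by (simp add: power2_diff power_mult_distrib power2_eq_square power4_eq_xxxx algebra_simps)
            then have "2 * K\<^sup>2 * (norm L * w) \<le> e * (norm L)\<^sup>2 + K ^ 4 / e * w\<^sup>2"
              using e by (subst (asm) mult_le_cancel_left_pos) auto
            also have "\<dots> \<le> e * (norm L)\<^sup>2 + k1 * w\<^sup>2"
              unfolding k1_def using e by (intro add_left_mono mult_right_mono divide_right_mono) auto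
            finally have "B * (2 * K\<^sup>2 * (norm L * w)) \<le> B * (e * (norm L)\<^sup>2 + k1 * w\<^sup>2)" using B by (intro mult_left_mono) auto
            then show ?thesis by (simp add: distrib_left mult_ac)
          qed
          finally show ?thesis unfolding w_def .
        qed
        have "2 * e * B * (norm L)\<^sup>2 = 2 * (e * B * (norm L)\<^sup>2)"
          "(2 * k1 + 6 * k2) * B * (norm (g k v))\<^sup>2 = 2 * (k1 * B * (norm (g k v))\<^sup>2) + 6 * (k2 * B * (norm (g k v))\<^sup>2)"
          by (simp_all add: algebra_simps)
        \<comment> \<open>Arithmetic in abstract variables; \<open>y\<close> stands for the term
          that cancels between \<open>h1\<close> and \<open>h2\<close>.\<close>
        moreover have "- 2 * x - E' - G \<le> 2 * (S + y) - 2 * (x + y + p')"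
          if "E' = 2 * E" "G = 2 * a + 6 * b" "- 3 * b \<le> S" "p' \<le> E + a" for x y S E E' G a b p' :: real
          using that by simp
        ultimately show ?thesis unfolding s2 d1 using q3 p by blast
      qed
      have "(\<Sum>k\<in>(UNIV :: 3 set). - 2 * (rho v * (L \<bullet> tder (Inr k) (g k) v)) - 2 * e * B * (norm L)\<^sup>2 - (2 * k1 + 6 * k2) * B * (norm (g k v))\<^sup>2)
          \<le> (\<Sum>\<alpha>\<in>UNIV. tder \<alpha> (h \<alpha>) v)"
        unfolding divs by (rule sum_mono) (rule per_k)
      also have "(\<Sum>k\<in>(UNIV :: 3 set). - 2 * (rho v * (L \<bullet> tder (Inr k) (g k) v)) - 2 * e * B * (norm L)\<^sup>2 - (2 * k1 + 6 * k2) * B * (norm (g k v))\<^sup>2)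
          = - 2 * (rho v * (L \<bullet> R)) - c\<^sup>2 / 2 * (B * (norm L)\<^sup>2) - (2 * k1 + 6 * k2) * B * (\<Sum>k\<in>UNIV. (norm (g k v))\<^sup>2)"
        unfolding R_def rot_sq_def g_def[symmetric] e_def
        by (simp add: sum_subtractf sum_distrib_left[symmetric] sum_negf inner_sum_right)
      finally have div_ge: "- 2 * (rho v * (L \<bullet> R)) \<le> c\<^sup>2 / 2 * (B * (norm L)\<^sup>2) + (2 * k1 + 6 * k2) * B * (\<Sum>k\<in>UNIV. (norm (g k v))\<^sup>2) + (\<Sum>\<alpha>\<in>UNIV. tder \<alpha> (h \<alpha>) v)"
        by simp
      have gk: "(\<Sum>k\<in>UNIV. (norm (g k v))\<^sup>2) \<le> grad_sq f v"
        unfolding grad_sq_def sum_UNIV_Plus g_def by (simp add: sum_nonneg)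
      have B2: "B \<le> bracket v powr (2 * \<gamma> + 2)" unfolding B_def using bracket_ge_1[of v] by (intro powr_mono) auto
      have "(2 * k1 + 6 * k2) * B * (\<Sum>k\<in>UNIV. (norm (g k v))\<^sup>2) \<le> (2 * k1 + 6 * k2) * bracket v powr (2 * \<gamma> + 2) * grad_sq f v"
        using k B2 by (intro mult_mono gk mult_left_mono) (auto intro: sum_nonneg)
      then have low: "(2 * k1 + 6 * k2) * B * (\<Sum>k\<in>UNIV. (norm (g k v))\<^sup>2) \<le> (2 * k1 + 6 * k2) * (bracket v powr (2 * \<gamma> + 2) * grad_sq f v)"
        by (simp add: mult.assoc)
      \<comment> \<open>The last summand is the cross term of unknown sign, and
        \<open>div_ge\<close> bounds it from below.\<close>
      have princ: "(norm (princ f v))\<^sup>2 = (lam v)\<^sup>2 * (norm L)\<^sup>2 + (mu v)\<^sup>2 * (norm R)\<^sup>2 + 2 * (rho v * (L \<bullet> R))"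
        unfolding princ_def L_def R_def rho_def power2_norm_eq_inner
        by (simp add: inner_add_left inner_add_right power2_eq_square inner_commute algebra_simps)
      have sqs: "c\<^sup>2 * B \<le> (lam v)\<^sup>2" "c\<^sup>2 * B \<le> (mu v)\<^sup>2"
      proof -
        have "c\<^sup>2 * B = (c * bracket v powr \<gamma>)\<^sup>2" unfolding B_def by (simp add: power2_eq_square mult_ac bracket_powr_mult)
        then show "c\<^sup>2 * B \<le> (lam v)\<^sup>2" "c\<^sup>2 * B \<le> (mu v)\<^sup>2" using c_pos lower[of v] by (auto intro!: power_mono)
      qed
      have "c\<^sup>2 * B * (norm L)\<^sup>2 \<le> (lam v)\<^sup>2 * (norm L)\<^sup>2" "c\<^sup>2 * B * (norm R)\<^sup>2 \<le> (mu v)\<^sup>2 * (norm R)\<^sup>2"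
        using sqs by (auto intro!: mult_right_mono)
      moreover have "(norm (princ f v))\<^sup>2 \<le> 3 * (norm (A f v))\<^sup>2 + 3 * K\<^sup>2 * (bracket v powr (2 * \<gamma> + 4) * (norm (f v))\<^sup>2) + 18 * K\<^sup>2 * (bracket v powr (2 * \<gamma> + 2) * grad_sq f v)"
      proof -
        let ?x = "norm (A f v)" and ?y = "K * (bracket v powr (\<gamma> + 2) * norm (f v))" and ?z = "K * (bracket v powr \<gamma> * grad_sum f v)"
        have "(norm (princ f v))\<^sup>2 \<le> (?x + ?y + ?z)\<^sup>2" by (intro power_mono princ_bound f) simp
        also have "\<dots> \<le> 3 * ?x\<^sup>2 + 3 * ?y\<^sup>2 + 3 * ?z\<^sup>2"
        proof -
          have "(x + y + z)\<^sup>2 \<le> 3 * x\<^sup>2 + 3 * y\<^sup>2 + 3 * z\<^sup>2" for x y z :: real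
            using zero_le_power2[of "x - y"] zero_le_power2[of "y - z"] zero_le_power2[of "x - z"]
            by (simp add: power2_eq_square algebra_simps)
          then show ?thesis .
        qed
        also have "?y\<^sup>2 = K\<^sup>2 * (bracket v powr (2 * \<gamma> + 4) * (norm (f v))\<^sup>2)"
        proof -
          have "(bracket v powr (\<gamma> + 2))\<^sup>2 = bracket v powr (2 * \<gamma> + 4)"
            unfolding power2_eq_square bracket_powr_mult by (simp add: algebra_simps)
          then show ?thesis by (simp add: power_mult_distrib)
        qed
        also have "?z\<^sup>2 \<le> K\<^sup>2 * (bracket v powr (2 * \<gamma> + 2) * (6 * grad_sq f v))"
        proof -
          have "(bracket v powr \<gamma>)\<^sup>2 = B" unfolding B_def power2_eq_square bracket_powr_mult by simp
          then show ?thesis unfolding power_mult_distrib using B2 grad_sum_sq[of f v]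
            by (intro mult_left_mono mult_mono) auto
        qed
        finally show ?thesis by (simp add: mult_ac)
      qed
      ultimately have "c\<^sup>2 * B * (norm L)\<^sup>2 + c\<^sup>2 * B * (norm R)\<^sup>2
          \<le> 3 * (norm (A f v))\<^sup>2 + 3 * K\<^sup>2 * (bracket v powr (2 * \<gamma> + 4) * (norm (f v))\<^sup>2) + 18 * K\<^sup>2 * (bracket v powr (2 * \<gamma> + 2) * grad_sq f v)
          + (c\<^sup>2 / 2 * (B * (norm L)\<^sup>2) + (2 * k1 + 6 * k2) * (bracket v powr (2 * \<gamma> + 2) * grad_sq f v) + (\<Sum>\<alpha>\<in>UNIV. tder \<alpha> (h \<alpha>) v))"
        using div_ge low princ by linarith
      moreover have "c\<^sup>2 * B * (norm L)\<^sup>2 = 2 * (c\<^sup>2 / 2 * (B * (norm L)\<^sup>2))" "c\<^sup>2 * B * (norm R)\<^sup>2 = 2 * (c\<^sup>2 / 2 * (B * (norm R)\<^sup>2))" by simp_all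
      moreover have "0 \<le> c\<^sup>2 / 2 * (B * (norm R)\<^sup>2)" using B by simp
      moreover have "M * (bracket v powr (2 * \<gamma> + 2) * grad_sq f v)
          = 18 * K\<^sup>2 * (bracket v powr (2 * \<gamma> + 2) * grad_sq f v) + (2 * k1 + 6 * k2) * (bracket v powr (2 * \<gamma> + 2) * grad_sq f v)"
        unfolding M_def by (simp only: distrib_right add.assoc)
      ultimately show "c\<^sup>2 / 2 * (bracket v powr (2 * \<gamma>) * ((norm (trans_sq f v))\<^sup>2 + (norm (rot_sq f v))\<^sup>2))
          \<le> 3 * (norm (A f v))\<^sup>2 + 3 * K\<^sup>2 * (bracket v powr (2 * \<gamma> + 4) * (norm (f v))\<^sup>2) + M * (bracket v powr (2 * \<gamma> + 2) * grad_sq f v)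
            + (\<Sum>\<alpha>\<in>UNIV. tder \<alpha> (h \<alpha>) v)"
        unfolding B_def[symmetric] L_def[symmetric] R_def[symmetric] distrib_left by linarith
    qed
    also have "\<dots> = 3 * elliptic f + 3 * K\<^sup>2 * (LINT v|lborel. bracket v powr (2 * \<gamma> + 4) * (norm (f v))\<^sup>2) + M * (LINT v|lborel. bracket v powr (2 * \<gamma> + 2) * grad_sq f v)"
      unfolding elliptic_def by (simp add: integrable_rapid rapid_norm_sq rapid_A f rapid_mult slow_bracket_powr rapid_grad_sq schwartz_rapid)
    also have "\<dots> \<le> 3 * (C2 * data \<xi> f) + 3 * K\<^sup>2 * (C1 * data \<xi> f) + M * (C1 * data \<xi> f)"
    proof (intro add_mono mult_left_mono C2(2) f \<xi>)
      have nn: "0 \<le> (LINT v|lborel. bracket v powr (2 * \<gamma> + 2) * grad_sq f v)" "0 \<le> (LINT v|lborel. bracket v powr (2 * \<gamma> + 4) * (norm (f v))\<^sup>2)"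
        by (intro integral_nonneg_AE AE_I2 mult_nonneg_nonneg grad_sq_nonneg; simp)+
      show "(LINT v|lborel. bracket v powr (2 * \<gamma> + 4) * (norm (f v))\<^sup>2) \<le> C1 * data \<xi> f"
        "(LINT v|lborel. bracket v powr (2 * \<gamma> + 2) * grad_sq f v) \<le> C1 * data \<xi> f"
        using C1(2)[OF f, of \<xi>] nn by linarith+
    qed (use M in auto)
    also have "\<dots> \<le> c\<^sup>2 / 2 * (C * data \<xi> f)"
    proof -
      have "Q * data \<xi> f \<le> c\<^sup>2 / 2 * (2 / c\<^sup>2 * (Q + 1) * data \<xi> f)" for Q
        using c_pos data_nonneg[of \<xi> f] by (simp add: distrib_right)
      from this[of "3 * C2 + (3 * K\<^sup>2 + M) * C1"] show ?thesis unfolding C_def by (simp add: algebra_simps)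
    qed
    finally show ?thesis using c_pos unfolding integral_mult_right_zero by (subst (asm) mult_le_cancel_left_pos) auto
  qed
  then show ?thesis using Cpos by blast
qed

end

section \<open>The operators on phase space\<close>

definition pder :: "3 + 3 \<Rightarrow> (phase \<Rightarrow> complex) \<Rightarrow> phase \<Rightarrow> complex" where
  "pder \<alpha> u z = partial (0, fld \<alpha> (snd z)) u z"

lemma schwartz_pder:
  assumes u: "schwartz u" shows "schwartz (pder \<alpha> u)"
proof -
  have "pder \<alpha> u = (\<lambda>z. \<Sum>b\<in>Basis. complex_of_real (fld \<alpha> (snd z) \<bullet> b) * partial (0, b) u z)"
    unfolding pder_def[abs_def] partial_Pair_sum[OF schwartz_differentiable[OF u], of "fld \<alpha> _"]
    by (simp add: scaleR_conv_of_real)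
  moreover have "schwartz (\<lambda>z. complex_of_real (fld \<alpha> (snd z) \<bullet> b) * partial (0, b) u z)" if "b \<in> Basis" for b
  proof -
    have s: "schwartz (partial (0, b) u)" by (intro schwartz_partial u zero_prod_in_Basis that)
    have "snd z \<bullet> a = z \<bullet> (0, a)" for z :: phase and a by (cases z) simp
    then show ?thesis
      using schwartz_coord[OF s] schwartz_cmult[OF s] unfolding fld_inner_affine
      by (cases \<alpha>) simp_all
  qed
  ultimately show ?thesis by (simp add: schwartz_sum)
qed

lemma fourier_x_pder: "schwartz u \<Longrightarrow> fourier_x (pder \<alpha> u) \<xi> v = tder \<alpha> (fourier_x u \<xi>) v"
  unfolding tder_def fourier_x_partial(2) by (simp add: fourier_x_def pder_def)

lemma Dv_eq: "Dv j u z = inverse \<i> * pder (Inl j) u z"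
  unfolding Dv_def pder_def fld_def by simp

lemma sum_Basis_vec3: "(\<Sum>b\<in>(Basis :: (real^3) set). g b) = g (axis 1 1) + g (axis 2 1) + g (axis 3 1)"
proof -
  have B: "(Basis :: (real^3) set) = range (\<lambda>j. axis j 1)" by (auto simp: Basis_vec_def)
  have i: "inj (\<lambda>j. axis j (1::real) :: real^3)" by (auto simp: inj_def axis_eq_axis)
  show ?thesis unfolding B sum.reindex[OF i] by (simp add: sum_3)
qed

text \<open>\<open>Q\<close> is built from coordinate derivatives and \<open>pder\<close> from one
  directional derivative; linearity of the total derivative identifies them, hence the
  differentiability hypothesis.\<close>

lemma Q_eq:
  assumes "u differentiable (at z)" shows "Q j u z = inverse \<i> * pder (Inr j) u z"
proof -
  obtain x v where z: "z = (x, v)" by (cases z)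
  have "j = 1 \<or> j = 2 \<or> j = 3" by (rule exhaust_3)
  then show ?thesis
    unfolding Q_def pder_def partial_Pair_sum[OF assms, of "fld (Inr j) (snd z)"] sum_Basis_vec3 inner_axis
    by (elim disjE) (simp_all add: z fld_def mult_v_def Dv_def vector_3 cross3_def scaleR_conv_of_real
      axis_def algebra_simps)
qed

lemma pder_mult_v:
  assumes a: "a differentiable (at (snd z))" and h: "h differentiable (at z)"
  shows "mult_v a h differentiable (at z)"
    "pder \<alpha> (mult_v a h) z = complex_of_real (a (snd z)) * pder \<alpha> h z + complex_of_real (tder \<alpha> a (snd z)) * h z"
proof -
  have m: "mult_v a h = (\<lambda>z. complex_of_real (a (snd z)) * h z)" unfolding mult_v_def by auto
  have s: "(snd has_derivative snd) (at z)" by (rule bounded_linear_imp_has_derivative[OF bounded_linear_snd])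
  have "((\<lambda>z. a (snd z)) has_derivative (\<lambda>d. partial (snd d) a (snd z))) (at z)"
    using has_derivative_compose[OF s has_derivative_partial[OF a]] .
  then have "((\<lambda>z. complex_of_real (a (snd z))) has_derivative (\<lambda>d. complex_of_real (partial (snd d) a (snd z)))) (at z)"
    by (rule has_derivative_of_real)
  from has_derivative_mult[OF this has_derivative_partial[OF h]]
  have *: "(mult_v a h has_derivative (\<lambda>d. complex_of_real (a (snd z)) * partial d h z + complex_of_real (partial (snd d) a (snd z)) * h z)) (at z)"
    unfolding m .
  then show "mult_v a h differentiable (at z)" unfolding differentiable_def by blast
  show "pder \<alpha> (mult_v a h) z = complex_of_real (a (snd z)) * pder \<alpha> h z + complex_of_real (tder \<alpha> a (snd z)) * h z"
    unfolding pder_def tder_def by (rule trans[OF partial_eqI[OF *]]) simp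
qed

lemma pder_cmult: "h differentiable (at z) \<Longrightarrow> pder \<alpha> (\<lambda>z. c * h z) z = c * pder \<alpha> h z"
  unfolding pder_def by (rule partial_cmult)

lemma inverse_i_sq: "inverse \<i> * (inverse \<i> * z) = - z" by (simp add: mult.assoc[symmetric])

lemma second_order_term:
  assumes u: "schwartz u" and a: "a differentiable (at v)"
  shows "inverse \<i> * pder \<alpha> (mult_v a (\<lambda>z. inverse \<i> * pder \<alpha> u z)) (x, v)
    = - (complex_of_real (a v) * pder \<alpha> (pder \<alpha> u) (x, v) + complex_of_real (tder \<alpha> a v) * pder \<alpha> u (x, v))"
proof -
  have d: "pder \<alpha> u differentiable (at z)" for z by (intro schwartz_differentiable schwartz_pder u)
  have d': "(\<lambda>z. inverse \<i> * pder \<alpha> u z) differentiable (at z)" for z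
    by (intro schwartz_differentiable schwartz_cmult schwartz_pder u)
  have a': "a differentiable (at (snd (x, v)))" for x :: "real^3" using a by simp
  have eq: "pder \<alpha> (mult_v a (\<lambda>z. inverse \<i> * pder \<alpha> u z)) (x, v)
      = complex_of_real (a v) * (inverse \<i> * pder \<alpha> (pder \<alpha> u) (x, v)) + complex_of_real (tder \<alpha> a v) * (inverse \<i> * pder \<alpha> u (x, v))"
    unfolding pder_mult_v(2)[OF a' d'] pder_cmult[OF d] snd_conv ..
  have "inverse \<i> * (r * (inverse \<i> * p) + s * (inverse \<i> * q)) = - (r * p + s * q)" for r p s q :: complex
    by (simp add: algebra_simps)
  then show ?thesis unfolding eq .
qed

lemma Dv_sq_eq: "schwartz u \<Longrightarrow> Dv_sq u = (\<lambda>z. - (\<Sum>j\<in>UNIV. pder (Inl j) (pder (Inl j) u) z))"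
  unfolding Dv_sq_def[abs_def] Dv_eq[abs_def]
  by (simp add: pder_cmult schwartz_differentiable schwartz_pder inverse_i_sq sum_negf del: inverse_i)

lemma Q_sq_eq: assumes u: "schwartz u" shows "Q_sq u = (\<lambda>z. - (\<Sum>j\<in>UNIV. pder (Inr j) (pder (Inr j) u) z))"
proof -
  have Qu: "Q j u = (\<lambda>z. inverse \<i> * pder (Inr j) u z)" for j
    using Q_eq[OF schwartz_differentiable[OF u]] by blast
  have "Q j (Q j u) z = - pder (Inr j) (pder (Inr j) u) z" for j z
    unfolding Qu by (subst Q_eq)
      (auto simp: pder_cmult schwartz_differentiable schwartz_pder u inverse_i_sq schwartz_cmult simp del: inverse_i)
  then show ?thesis unfolding Q_sq_def[abs_def] by (simp add: sum_negf)
qed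

lemma schwartz_Dv_sq: "schwartz u \<Longrightarrow> schwartz (Dv_sq u)" and schwartz_Q_sq: "schwartz u \<Longrightarrow> schwartz (Q_sq u)"
  using schwartz_cmult[OF schwartz_sum[OF schwartz_pder[OF schwartz_pder]], where c="-1"]
  by (simp_all add: Dv_sq_eq Q_sq_eq)

lemma fourier_x_neg_sum:
  assumes "\<And>j. schwartz (h j)"
  shows "fourier_x (\<lambda>z. - (\<Sum>j\<in>UNIV. h j z)) \<xi> v = - (\<Sum>j\<in>(UNIV :: 'j::finite set). fourier_x (h j) \<xi> v)"
  unfolding fourier_x_eq_ft
  using ft_cmult[of "-1" "\<lambda>x. \<Sum>j\<in>UNIV. h j (x, v)" \<xi>] ft_sum[of UNIV "\<lambda>j x. h j (x, v)" \<xi>] schwartz_slice_integrable[OF assms]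
  by simp

lemma fourier_x_Dv_sq: "schwartz u \<Longrightarrow> fourier_x (Dv_sq u) \<xi> v = - trans_sq (fourier_x u \<xi>) v"
  and fourier_x_Q_sq: "schwartz u \<Longrightarrow> fourier_x (Q_sq u) \<xi> v = - rot_sq (fourier_x u \<xi>) v"
proof -
  assume u: "schwartz u"
  have "fourier_x (pder \<alpha> (pder \<alpha> u)) \<xi> v = tder \<alpha> (tder \<alpha> (fourier_x u \<xi>)) v" for \<alpha>
    unfolding fourier_x_pder[OF schwartz_pder[OF u]] using fourier_x_pder[OF u] by (metis ext)
  then show "fourier_x (Dv_sq u) \<xi> v = - trans_sq (fourier_x u \<xi>) v" "fourier_x (Q_sq u) \<xi> v = - rot_sq (fourier_x u \<xi>) v"
    unfolding Dv_sq_eq[OF u] Q_sq_eq[OF u] trans_sq_def rot_sq_def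
    by (subst fourier_x_neg_sum; simp add: schwartz_pder u)+
qed

lemma schwartz_Dx: "schwartz u \<Longrightarrow> schwartz (Dx j u)"
  unfolding Dx_def[abs_def] by (intro schwartz_cmult schwartz_partial prod_zero_in_Basis) (simp_all add: axis_in_Basis_iff)

text \<open>The non-divergence form. For fixed v every summand is a constant times a slice of a
  Schwartz function, so the transform in x can be taken term by term with the coefficients pulled
  out.\<close>

lemma landau_op_eq:
  assumes u: "schwartz u" and lam: "slow1 lam" and mu: "slow1 mu"
  shows "landau_op lam mu F u (x, v) = (\<Sum>j\<in>UNIV. (\<i> * complex_of_real (v $ j)) * Dx j u (x, v))
    - (\<Sum>\<alpha>\<in>UNIV. complex_of_real (coef lam mu \<alpha> v) * pder \<alpha> (pder \<alpha> u) (x, v)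
        + complex_of_real (tder \<alpha> (coef lam mu \<alpha>) v) * pder \<alpha> u (x, v))
    + complex_of_real (F v) * u (x, v)"
proof -
  have D: "Dv j (mult_v lam (Dv j u)) (x, v) = - (complex_of_real (lam v) * pder (Inl j) (pder (Inl j) u) (x, v)
      + complex_of_real (tder (Inl j) lam v) * pder (Inl j) u (x, v))" for j
    unfolding Dv_eq[abs_def] using second_order_term[OF u slow1D(1)[OF lam]] .
  have Qu: "Q j u = (\<lambda>z. inverse \<i> * pder (Inr j) u z)" for j
    using Q_eq[OF schwartz_differentiable[OF u]] by blast
  have "mult_v mu (Q j u) differentiable (at (x, v))" for j
    unfolding Qu by (intro pder_mult_v slow1D(1)[OF mu] schwartz_differentiable schwartz_cmult schwartz_pder u)
  then have R: "Q j (mult_v mu (Q j u)) (x, v) = - (complex_of_real (mu v) * pder (Inr j) (pder (Inr j) u) (x, v)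
      + complex_of_real (tder (Inr j) mu v) * pder (Inr j) u (x, v))" for j
    using second_order_term[OF u slow1D(1)[OF mu]] by (simp add: Q_eq Qu)
  have c: "coef lam mu (Inl j) = lam" "coef lam mu (Inr j) = mu" for j
    by (simp_all add: coef_def fun_eq_iff)
  show ?thesis
    unfolding landau_op_def D R sum_UNIV_Plus c
    by (simp add: mult_v_def sum.distrib sum_subtractf sum_negf sum_distrib_left mult.assoc)
qed

lemma fourier_x_landau_op:
  assumes u: "schwartz u" and lam: "slow1 lam" and mu: "slow1 mu"
  shows "fourier_x (landau_op lam mu F u) \<xi> v = fibre_op lam mu F \<xi> (fourier_x u \<xi>) v"
proof -
  let ?f = "fourier_x u \<xi>"
  have i: "integrable lborel (\<lambda>x. h (x, v))" if "schwartz h" for h :: "phase \<Rightarrow> complex"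
    using that by (rule schwartz_slice_integrable)
  have ic: "integrable lborel (\<lambda>x. k * h (x, v))" if "schwartz h" for h :: "phase \<Rightarrow> complex" and k :: complex
    using i[OF that] by simp
  have s: "schwartz (pder \<alpha> u)" "schwartz (pder \<alpha> (pder \<alpha> u))" "schwartz (Dx j u)" for \<alpha> j
    by (intro schwartz_pder schwartz_Dx u)+
  have sl: "slow1 (coef lam mu \<alpha>)" for \<alpha> using lam mu unfolding coef_def by (cases \<alpha>) simp_all
  have sf: "schwartz ?f" by (rule schwartz_fourier_x[OF u])
  have pp: "fourier_x (pder \<alpha> (pder \<alpha> u)) \<xi> v = tder \<alpha> (tder \<alpha> ?f) v" for \<alpha>
    unfolding fourier_x_pder[OF s(1)] using fourier_x_pder[OF u] by (metis ext)
  have e: "tder \<alpha> (\<lambda>v. coef lam mu \<alpha> v *\<^sub>R tder \<alpha> ?f v) v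
      = complex_of_real (coef lam mu \<alpha> v) * tder \<alpha> (tder \<alpha> ?f) v + complex_of_real (tder \<alpha> (coef lam mu \<alpha>) v) * tder \<alpha> ?f v" for \<alpha>
    unfolding scaleR_conv_of_real[symmetric]
    by (rule tder_scaleR[OF sl rapid1_imp_slow1[OF schwartz_tder_rapid1[OF sf]]])
  have t: "\<i> * complex_of_real (v \<bullet> \<xi>) * ?f v = (\<Sum>j\<in>UNIV. (\<i> * complex_of_real (v $ j)) * (complex_of_real (\<xi> $ j) * ?f v))"
    by (simp add: inner_vec_def sum_distrib_left sum_distrib_right mult_ac)
  have "fourier_x (landau_op lam mu F u) \<xi> v
      = (\<Sum>j\<in>UNIV. (\<i> * complex_of_real (v $ j)) * fourier_x (Dx j u) \<xi> v)
      - (\<Sum>\<alpha>\<in>UNIV. complex_of_real (coef lam mu \<alpha> v) * fourier_x (pder \<alpha> (pder \<alpha> u)) \<xi> v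
        + complex_of_real (tder \<alpha> (coef lam mu \<alpha>) v) * fourier_x (pder \<alpha> u) \<xi> v)
      + complex_of_real (F v) * ?f v"
    unfolding fourier_x_eq_ft landau_op_eq[OF u lam mu]
    by (simp add: ft_add ft_diff ft_sum ft_cmult ic s u Bochner_Integration.integrable_sum Bochner_Integration.integrable_diff
      Bochner_Integration.integrable_add)
  then show ?thesis
    unfolding fibre_op_def diffop_def e t pp fourier_x_pder[OF u] fourier_x_Dx[OF u]
    by (simp add: scaleR_conv_of_real)
qed

section \<open>Reduction to the fibres\<close>

lemma L2_norm_sq_tonelli:
  assumes [measurable]: "g \<in> borel_measurable borel"
  shows "L2_norm_sq g = (\<integral>\<^sup>+ v. (\<integral>\<^sup>+ x. ennreal ((norm (g (x, v)))\<^sup>2) \<partial>lborel) \<partial>lborel)"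
proof -
  have "(\<lambda>z. ennreal ((norm (g z))\<^sup>2)) \<in> borel_measurable (lborel \<Otimes>\<^sub>M lborel)" by (simp add: borel_prod lborel_prod)
  from lborel_pair.nn_integral_snd[OF this] show ?thesis unfolding L2_norm_sq_def lborel_prod by simp
qed

lemma measurable_slice_norm:
  fixes g :: "phase \<Rightarrow> complex"
  assumes g: "g \<in> borel_measurable borel"
  shows "(\<lambda>v. \<integral>\<^sup>+ x. ennreal ((norm (g (x, v)))\<^sup>2) \<partial>lborel) \<in> borel_measurable lborel"
proof (rule lborel.borel_measurable_nn_integral)
  have "(\<lambda>(v, x). (x, v)) \<in> lborel \<Otimes>\<^sub>M lborel \<rightarrow>\<^sub>M (borel :: phase measure)"
    unfolding borel_prod[symmetric] by measurable
  from measurable_compose[OF this g] have "(\<lambda>(v, x). g (x, v)) \<in> borel_measurable (lborel \<Otimes>\<^sub>M lborel)"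
    by (simp add: case_prod_unfold)
  then show "(\<lambda>(v, x). ennreal ((norm (g (x, v)))\<^sup>2)) \<in> borel_measurable (lborel \<Otimes>\<^sub>M lborel)"
    by (simp add: case_prod_unfold)
qed

lemma nn_integral_swap:
  fixes t :: "real^3 \<Rightarrow> real^3 \<Rightarrow> ennreal"
  assumes "(\<lambda>(\<xi>, v). t \<xi> v) \<in> borel_measurable borel"
  shows "(\<integral>\<^sup>+ v. (\<integral>\<^sup>+ \<xi>. t \<xi> v \<partial>lborel) \<partial>lborel) = (\<integral>\<^sup>+ \<xi>. (\<integral>\<^sup>+ v. t \<xi> v \<partial>lborel) \<partial>lborel)"
proof (rule lborel_pair.Fubini')
  show "(\<lambda>(\<xi>, v). t \<xi> v) \<in> borel_measurable (lborel \<Otimes>\<^sub>M lborel)" using assms by (simp add: borel_prod lborel_prod)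
qed

lemma measurable_fourier_x [measurable (raw)]:
  assumes u [measurable]: "u \<in> borel_measurable borel" and [measurable]: "f \<in> borel_measurable M" "g \<in> borel_measurable M"
  shows "(\<lambda>w. fourier_x u (f w) (g w)) \<in> borel_measurable M"
proof -
  have "(\<lambda>(w, x). (x, g w)) \<in> M \<Otimes>\<^sub>M lborel \<rightarrow>\<^sub>M borel" unfolding borel_prod[symmetric] by measurable
  from measurable_compose[OF this u] have [measurable]: "(\<lambda>(w, x). u (x, g w)) \<in> borel_measurable (M \<Otimes>\<^sub>M lborel)"
    by (simp add: case_prod_unfold)
  show ?thesis unfolding fourier_x_def by measurable
qed

lemma slow_measurable: "slow g \<Longrightarrow> g \<in> borel_measurable borel"
  unfolding slow_def by (auto intro: borel_measurable_continuous_onI)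

lemma schwartz_measurable: "schwartz u \<Longrightarrow> u \<in> borel_measurable borel"
  by (intro rapid_measurable schwartz_rapid)

lemma measurable_mult_v:
  assumes a: "a \<in> borel_measurable borel" and [measurable]: "h \<in> borel_measurable borel"
  shows "mult_v a h \<in> borel_measurable borel"
proof -
  have [measurable]: "(\<lambda>z::phase. a (snd z)) \<in> borel_measurable borel"
    by (rule measurable_compose[OF _ a]) (simp add: borel_prod[symmetric])
  show ?thesis unfolding mult_v_def by (simp add: case_prod_unfold)
qed

abbreviation fourier_const :: ennreal where "fourier_const \<equiv> ennreal ((2 * pi) ^ 3)"

text \<open>Plancherel's lower bound at each fixed v, where the weight is a constant. Slices of
  Schwartz functions are integrable, continuous and bounded, as \<open>plancherel_ge\<close>
  demands.\<close>

lemma L2_mult_v_le: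
  assumes g: "schwartz g" and a [measurable]: "a \<in> borel_measurable borel"
  shows "fourier_const * L2_norm_sq (mult_v a g)
    \<le> (\<integral>\<^sup>+ v. (\<integral>\<^sup>+ \<xi>. ennreal ((a v * norm (fourier_x g \<xi> v))\<^sup>2) \<partial>lborel) \<partial>lborel)"
proof -
  have [measurable]: "g \<in> borel_measurable borel" using g by (rule schwartz_measurable)
  have [measurable]: "(\<lambda>x. g (x, v)) \<in> borel_measurable borel" for v
    by (intro rapid_measurable rapid_slice schwartz_rapid g)
  have "fourier_const * L2_norm_sq (mult_v a g)
      = (\<integral>\<^sup>+ v. fourier_const * (\<integral>\<^sup>+ x. ennreal ((norm (mult_v a g (x, v)))\<^sup>2) \<partial>lborel) \<partial>lborel)"
    unfolding L2_norm_sq_tonelli[OF measurable_mult_v[OF a \<open>g \<in> borel_measurable borel\<close>]]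
    by (rule nn_integral_cmult[symmetric], rule measurable_slice_norm)
      (rule measurable_mult_v[OF a \<open>g \<in> borel_measurable borel\<close>])
  also have "\<dots> \<le> (\<integral>\<^sup>+ v. (\<integral>\<^sup>+ \<xi>. ennreal ((a v * norm (fourier_x g \<xi> v))\<^sup>2) \<partial>lborel) \<partial>lborel)"
  proof (rule nn_integral_mono)
    fix v
    obtain B where B: "\<And>z. (1 + norm z) ^ 0 * norm (g z) \<le> B" using rapidD[OF schwartz_rapid[OF g]] by blast
    have "fourier_const * (\<integral>\<^sup>+ x. ennreal ((norm (g (x, v)))\<^sup>2) \<partial>lborel) \<le> (\<integral>\<^sup>+ \<xi>. ennreal ((norm (fourier_x g \<xi> v))\<^sup>2) \<partial>lborel)"
      using plancherel_ge[OF schwartz_slice_integrable[OF g], of v B] B rapid_slice[OF schwartz_rapid[OF g], of v]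
      unfolding fourier_x_eq_ft rapid_def by simp
    then have "ennreal ((a v)\<^sup>2) * (fourier_const * (\<integral>\<^sup>+ x. ennreal ((norm (g (x, v)))\<^sup>2) \<partial>lborel))
        \<le> ennreal ((a v)\<^sup>2) * (\<integral>\<^sup>+ \<xi>. ennreal ((norm (fourier_x g \<xi> v))\<^sup>2) \<partial>lborel)" by (rule mult_left_mono) simp
    then show "fourier_const * (\<integral>\<^sup>+ x. ennreal ((norm (mult_v a g (x, v)))\<^sup>2) \<partial>lborel)
        \<le> (\<integral>\<^sup>+ \<xi>. ennreal ((a v * norm (fourier_x g \<xi> v))\<^sup>2) \<partial>lborel)"
      by (simp add: mult_v_def norm_mult power_mult_distrib ennreal_mult' nn_integral_cmult mult.left_commute)
  qed
  finally show ?thesis .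
qed

lemma nn_integral_reflect:
  fixes h :: "real^3 \<Rightarrow> ennreal"
  assumes "h \<in> borel_measurable borel"
  shows "(\<integral>\<^sup>+ x. h (- x) \<partial>lborel) = (\<integral>\<^sup>+ x. h x \<partial>lborel)"
  using nn_integral_affine[OF assms, of "-1" 0] by simp

text \<open>The inversion integral is a reflected forward transform divided by (2 pi)^3. Hence
  \<open>plancherel_le\<close> applies to the symbol times \<open>fourier_x u\<close>, and it covers
  the fractional symbols, which are not smooth at their zeros.\<close>

lemma L2_fourier_mult_le:
  assumes u: "schwartz u" and a [measurable]: "a \<in> borel_measurable borel"
    and m: "(\<lambda>(v, \<xi>). m v \<xi>) \<in> borel_measurable borel"
  shows "fourier_const * L2_norm_sq (mult_v a (fourier_mult_x m u))
    \<le> (\<integral>\<^sup>+ v. (\<integral>\<^sup>+ \<xi>. ennreal ((a v * m v \<xi> * norm (fourier_x u \<xi> v))\<^sup>2) \<partial>lborel) \<partial>lborel)"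
proof -
  have [measurable]: "u \<in> borel_measurable borel" using u by (rule schwartz_measurable)
  have m' [measurable (raw)]: "f \<in> borel_measurable M \<Longrightarrow> g \<in> borel_measurable M \<Longrightarrow> (\<lambda>w. m (f w) (g w)) \<in> borel_measurable M" for f g M
  proof -
    assume "f \<in> borel_measurable M" "g \<in> borel_measurable M"
    then have "(\<lambda>w. (f w, g w)) \<in> M \<rightarrow>\<^sub>M borel" unfolding borel_prod[symmetric] by measurable
    from measurable_compose[OF this m] show "(\<lambda>w. m (f w) (g w)) \<in> borel_measurable M" by simp
  qed
  define h where "h v \<xi> = complex_of_real (m v \<xi>) * fourier_x u \<xi> v" for v \<xi>
  have hm [measurable]: "h v \<in> borel_measurable borel" for v unfolding h_def[abs_def] by measurable
  have fm: "fourier_mult_x m u (x, v) = complex_of_real (1 / (2 * pi) ^ 3) * ft (h v) (- x)" for x v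
    unfolding fourier_mult_x_def ft_def h_def by (simp add: mult.assoc inner_commute)
  have M [measurable]: "fourier_mult_x m u \<in> borel_measurable borel"
  proof -
    have "(\<lambda>z. complex_of_real (1 / (2 * pi) ^ 3) * (LINT \<xi>|lborel. cis (fst z \<bullet> \<xi>) * complex_of_real (m (snd z) \<xi>) * fourier_x u \<xi> (snd z)))
        \<in> borel_measurable (borel \<Otimes>\<^sub>M borel)" by measurable
    then show ?thesis unfolding fourier_mult_x_def borel_prod by (simp add: case_prod_unfold)
  qed
  have "fourier_const * L2_norm_sq (mult_v a (fourier_mult_x m u))
      = (\<integral>\<^sup>+ v. fourier_const * (\<integral>\<^sup>+ x. ennreal ((norm (mult_v a (fourier_mult_x m u) (x, v)))\<^sup>2) \<partial>lborel) \<partial>lborel)"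
    unfolding L2_norm_sq_tonelli[OF measurable_mult_v[OF a M]]
    by (rule nn_integral_cmult[symmetric], rule measurable_slice_norm) (rule measurable_mult_v[OF a M])
  also have "\<dots> \<le> (\<integral>\<^sup>+ v. (\<integral>\<^sup>+ \<xi>. ennreal ((a v * m v \<xi> * norm (fourier_x u \<xi> v))\<^sup>2) \<partial>lborel) \<partial>lborel)"
  proof (rule nn_integral_mono)
    fix v
    define D :: real where "D = (2 * pi) ^ 3"
    have D: "D > 0" unfolding D_def by simp
    have fc: "fourier_const = ennreal D" unfolding D_def ..
    have fmD: "fourier_mult_x m u (x, v) = complex_of_real (1 / D) * ft (h v) (- x)" for x
      unfolding fm D_def ..
    have "(\<integral>\<^sup>+ x. ennreal ((norm (mult_v a (fourier_mult_x m u) (x, v)))\<^sup>2) \<partial>lborel)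
        = (\<integral>\<^sup>+ x. ennreal ((a v / D)\<^sup>2) * ennreal ((norm (ft (h v) (- x)))\<^sup>2) \<partial>lborel)"
      unfolding mult_v_def by (simp add: fmD norm_mult norm_divide power_mult_distrib power_divide ennreal_mult'[symmetric])
    also have "\<dots> = ennreal ((a v / D)\<^sup>2) * (\<integral>\<^sup>+ x. ennreal ((norm (ft (h v) (- x)))\<^sup>2) \<partial>lborel)"
      by (rule nn_integral_cmult) measurable
    also have "(\<integral>\<^sup>+ x. ennreal ((norm (ft (h v) (- x)))\<^sup>2) \<partial>lborel) = (\<integral>\<^sup>+ x. ennreal ((norm (ft (h v) x))\<^sup>2) \<partial>lborel)"
      by (rule nn_integral_reflect) measurable
    also have "\<dots> \<le> ennreal D * (\<integral>\<^sup>+ \<xi>. ennreal ((norm (h v \<xi>))\<^sup>2) \<partial>lborel)"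
      using plancherel_le[of "h v"] by (simp add: D_def)
    finally have "ennreal D * (\<integral>\<^sup>+ x. ennreal ((norm (mult_v a (fourier_mult_x m u) (x, v)))\<^sup>2) \<partial>lborel)
        \<le> ennreal D * (ennreal ((a v / D)\<^sup>2) * (ennreal D * (\<integral>\<^sup>+ \<xi>. ennreal ((norm (h v \<xi>))\<^sup>2) \<partial>lborel)))"
      by (meson mult_left_mono order_trans zero_le)
    \<comment> \<open>The normalisation 1 / D of the inversion integral enters squared; one D comes
      from Plancherel's inequality and one from the left side, so all of them cancel.\<close>
    also have "\<dots> = ennreal (D * (a v / D)\<^sup>2 * D) * (\<integral>\<^sup>+ \<xi>. ennreal ((norm (h v \<xi>))\<^sup>2) \<partial>lborel)"
      using D by (simp add: ennreal_mult' mult.assoc)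
    also have "D * (a v / D)\<^sup>2 * D = (a v)\<^sup>2" using D by (simp add: power2_eq_square)
    also have "ennreal ((a v)\<^sup>2) * (\<integral>\<^sup>+ \<xi>. ennreal ((norm (h v \<xi>))\<^sup>2) \<partial>lborel) = (\<integral>\<^sup>+ \<xi>. ennreal ((a v)\<^sup>2) * ennreal ((norm (h v \<xi>))\<^sup>2) \<partial>lborel)"
      by (rule nn_integral_cmult[symmetric]) measurable
    also have "\<dots> = (\<integral>\<^sup>+ \<xi>. ennreal ((a v * m v \<xi> * norm (fourier_x u \<xi> v))\<^sup>2) \<partial>lborel)"
      unfolding h_def by (simp add: norm_mult power_mult_distrib ennreal_mult'[symmetric] mult.assoc)
    finally show "fourier_const * (\<integral>\<^sup>+ x. ennreal ((norm (mult_v a (fourier_mult_x m u) (x, v)))\<^sup>2) \<partial>lborel)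
        \<le> (\<integral>\<^sup>+ \<xi>. ennreal ((a v * m v \<xi> * norm (fourier_x u \<xi> v))\<^sup>2) \<partial>lborel)" unfolding fc .
  qed
  finally show ?thesis .
qed

text \<open>Stated for measurable \<open>g\<close> because it is applied to
  \<open>landau_op lam mu F u\<close>, whose coefficients are controlled only up to first
  derivatives.\<close>

lemma fourier_x_L2_le:
  assumes [measurable]: "g \<in> borel_measurable borel"
  shows "(\<integral>\<^sup>+ \<xi>. (\<integral>\<^sup>+ v. ennreal ((norm (fourier_x g \<xi> v))\<^sup>2) \<partial>lborel) \<partial>lborel) \<le> fourier_const * L2_norm_sq g"
proof -
  have "(\<lambda>(\<xi>, v). ennreal ((norm (fourier_x g \<xi> v))\<^sup>2)) \<in> borel_measurable (borel \<Otimes>\<^sub>M borel)" by measurable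
  then have "(\<integral>\<^sup>+ \<xi>. (\<integral>\<^sup>+ v. ennreal ((norm (fourier_x g \<xi> v))\<^sup>2) \<partial>lborel) \<partial>lborel)
      = (\<integral>\<^sup>+ v. (\<integral>\<^sup>+ \<xi>. ennreal ((norm (fourier_x g \<xi> v))\<^sup>2) \<partial>lborel) \<partial>lborel)"
    by (intro nn_integral_swap[symmetric]) (simp only: borel_prod)
  also have "\<dots> \<le> (\<integral>\<^sup>+ v. fourier_const * (\<integral>\<^sup>+ x. ennreal ((norm (g (x, v)))\<^sup>2) \<partial>lborel) \<partial>lborel)"
    unfolding fourier_x_eq_ft using plancherel_le[where 'a="real^3"] by (intro nn_integral_mono) simp
  also have "\<dots> = fourier_const * L2_norm_sq g"
    unfolding L2_norm_sq_tonelli[OF assms]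
    by (rule nn_integral_cmult, rule measurable_slice_norm) (rule assms)
  finally show ?thesis .
qed

lemma nn_integral_rapid:
  "rapid h \<Longrightarrow> (\<And>v. 0 \<le> h v) \<Longrightarrow> (\<integral>\<^sup>+ v. ennreal (h v) \<partial>lborel) = ennreal (LINT v|lborel. h v)"
  by (intro nn_integral_eq_integral integrable_rapid) auto

section \<open>Integration of the fibre estimates over the frequencies\<close>

context landau_coeffs
begin

lemma data_eq:
  assumes f: "schwartz f"
  shows "ennreal (data \<xi> f) = (\<integral>\<^sup>+ v. ennreal ((norm (P \<xi> f v))\<^sup>2) \<partial>lborel) + (\<integral>\<^sup>+ v. ennreal ((norm (f v))\<^sup>2) \<partial>lborel)"
  unfolding data_def
  by (subst (1 2) nn_integral_rapid) (auto intro: rapid_norm_sq rapid_P schwartz_rapid f simp: ennreal_plus)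

text \<open>The fibre estimates are collected with integrals valued in [0, infinity], the form in
  which the order of integration over v and \<xi> can be exchanged freely.\<close>

lemma fibre_estimate:
  "\<exists>C>0. \<forall>\<xi> f. schwartz f \<longrightarrow> \<xi> \<noteq> 0 \<longrightarrow>
     (\<integral>\<^sup>+ v. ennreal ((bracket v powr (\<gamma> + 2) * norm (f v))\<^sup>2) \<partial>lborel)
   + (\<integral>\<^sup>+ v. ennreal ((bracket v powr \<gamma> * norm (trans_sq f v))\<^sup>2) \<partial>lborel)
   + (\<integral>\<^sup>+ v. ennreal ((bracket v powr \<gamma> * norm (rot_sq f v))\<^sup>2) \<partial>lborel)
   + (\<integral>\<^sup>+ v. ennreal ((bracket v powr (\<gamma> / 3) * norm \<xi> powr (2 / 3) * norm (f v))\<^sup>2) \<partial>lborel)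
   + (\<integral>\<^sup>+ v. ennreal ((bracket v powr (\<gamma> / 3) * norm (cross3 v \<xi>) powr (2 / 3) * norm (f v))\<^sup>2) \<partial>lborel)
   \<le> ennreal (C * data \<xi> f)"
proof -
  obtain C1 where C1: "C1 > 0" "\<And>\<xi> f. schwartz f \<Longrightarrow>
    (LINT v|lborel. bracket v powr (2 * \<gamma> + 2) * grad_sq f v) + (LINT v|lborel. bracket v powr (2 * \<gamma> + 4) * (norm (f v))\<^sup>2)
      \<le> C1 * data \<xi> f" using weight_gain by blast
  obtain C2 where C2: "C2 > 0" "\<And>\<xi> f. schwartz f \<Longrightarrow> \<xi> \<noteq> 0 \<Longrightarrow> gain \<xi> f \<le> C2 * data \<xi> f"
    using hypoelliptic by blast
  obtain C3 where C3: "C3 > 0" "\<And>\<xi> f. schwartz f \<Longrightarrow> \<xi> \<noteq> 0 \<Longrightarrow>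
    (LINT v|lborel. bracket v powr (2 * \<gamma>) * ((norm (trans_sq f v))\<^sup>2 + (norm (rot_sq f v))\<^sup>2)) \<le> C3 * data \<xi> f"
    using second_order by blast
  have "(\<integral>\<^sup>+ v. ennreal ((bracket v powr (\<gamma> + 2) * norm (f v))\<^sup>2) \<partial>lborel)
   + (\<integral>\<^sup>+ v. ennreal ((bracket v powr \<gamma> * norm (trans_sq f v))\<^sup>2) \<partial>lborel)
   + (\<integral>\<^sup>+ v. ennreal ((bracket v powr \<gamma> * norm (rot_sq f v))\<^sup>2) \<partial>lborel)
   + (\<integral>\<^sup>+ v. ennreal ((bracket v powr (\<gamma> / 3) * norm \<xi> powr (2 / 3) * norm (f v))\<^sup>2) \<partial>lborel)
   + (\<integral>\<^sup>+ v. ennreal ((bracket v powr (\<gamma> / 3) * norm (cross3 v \<xi>) powr (2 / 3) * norm (f v))\<^sup>2) \<partial>lborel)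
   \<le> ennreal ((C1 + C3 + 2 * C2) * data \<xi> f)" (is "?I1 + ?I2 + ?I3 + ?I4 + ?I5 \<le> _") if f: "schwartz f" and \<xi>: "\<xi> \<noteq> 0" for \<xi> f
  proof -
    have rf: "rapid f" "rapid (trans_sq f)" "rapid (rot_sq f)"
      using f by (auto intro: schwartz_rapid schwartz_trans_sq schwartz_rot_sq)
    have d: "data \<xi> f \<ge> 0" by (rule data_nonneg)
    have sq: "(bracket v powr s * w)\<^sup>2 = bracket v powr (2 * s) * w\<^sup>2" for v s w
      by (simp add: power_mult_distrib power2_eq_square bracket_powr_mult)
    have "?I1 = (\<integral>\<^sup>+ v. ennreal (bracket v powr (2 * \<gamma> + 4) * (norm (f v))\<^sup>2) \<partial>lborel)"
      unfolding sq by (simp add: distrib_left)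
    also have "\<dots> = ennreal (LINT v|lborel. bracket v powr (2 * \<gamma> + 4) * (norm (f v))\<^sup>2)"
      by (rule nn_integral_rapid, intro rapid_mult slow_bracket_powr rapid_norm_sq rf) simp
    also have "\<dots> \<le> ennreal (C1 * data \<xi> f)"
    proof (rule ennreal_leI)
      have "0 \<le> (LINT v|lborel. bracket v powr (2 * \<gamma> + 2) * grad_sq f v)"
        by (intro integral_nonneg_AE AE_I2 mult_nonneg_nonneg grad_sq_nonneg) simp
      then show "(LINT v|lborel. bracket v powr (2 * \<gamma> + 4) * (norm (f v))\<^sup>2) \<le> C1 * data \<xi> f"
        using C1(2)[OF f, of \<xi>] by linarith
    qed
    finally have 1: "?I1 \<le> ennreal (C1 * data \<xi> f)" .
    have "?I2 + ?I3 = (\<integral>\<^sup>+ v. ennreal (bracket v powr (2 * \<gamma>) * ((norm (trans_sq f v))\<^sup>2 + (norm (rot_sq f v))\<^sup>2)) \<partial>lborel)"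
      unfolding sq distrib_left
      using rapid_measurable[OF rapid_mult[OF slow_bracket_powr rapid_norm_sq[OF rf(2)]]] rapid_measurable[OF rapid_mult[OF slow_bracket_powr rapid_norm_sq[OF rf(3)]]]
      by (subst nn_integral_add[symmetric]) (auto simp: ennreal_plus)
    also have "\<dots> = ennreal (LINT v|lborel. bracket v powr (2 * \<gamma>) * ((norm (trans_sq f v))\<^sup>2 + (norm (rot_sq f v))\<^sup>2))"
      by (rule nn_integral_rapid, intro rapid_mult slow_bracket_powr rapid_add rapid_norm_sq rf) simp
    also have "\<dots> \<le> ennreal (C3 * data \<xi> f)" by (intro ennreal_leI C3(2) f \<xi>)
    finally have 23: "?I2 + ?I3 \<le> ennreal (C3 * data \<xi> f)" .
    \<comment> \<open>Both |\<xi>| and the length of its cross product with v are at most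
      \<open>mm\<close>, so each fractional multiplier is dominated by \<open>phi\<close>; hence C2
      occurs twice in the final constant.\<close>
    have gain: "(\<integral>\<^sup>+ v. ennreal ((bracket v powr (\<gamma> / 3) * r v powr (2 / 3) * norm (f v))\<^sup>2) \<partial>lborel) \<le> ennreal (C2 * data \<xi> f)"
      if r: "\<And>v. 0 \<le> r v \<and> r v \<le> mm \<xi> v" for r
    proof -
      have "(\<integral>\<^sup>+ v. ennreal ((bracket v powr (\<gamma> / 3) * r v powr (2 / 3) * norm (f v))\<^sup>2) \<partial>lborel)
          \<le> (\<integral>\<^sup>+ v. ennreal ((phi \<xi> v * norm (f v))\<^sup>2) \<partial>lborel)"
        unfolding phi_def using r
        by (intro nn_integral_mono ennreal_leI power_mono mult_right_mono mult_left_mono powr_mono2) auto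
      also have "\<dots> = ennreal (gain \<xi> f)" unfolding gain_def
        by (rule nn_integral_rapid, intro rapid_power2 rapid_phi_norm \<xi> f) simp
      also have "\<dots> \<le> ennreal (C2 * data \<xi> f)" by (intro ennreal_leI C2(2) f \<xi>)
      finally show ?thesis .
    qed
    have 4: "?I4 \<le> ennreal (C2 * data \<xi> f)" by (rule gain) (simp add: norm_le_mm)
    have 5: "?I5 \<le> ennreal (C2 * data \<xi> f)"
      by (rule gain) (use norm_le_mm(2)[of \<xi>] cross_skew[of _ \<xi>] in \<open>simp add: norm_minus_cancel[of "cross3 \<xi> _"]\<close>)
    have "?I1 + (?I2 + ?I3) + ?I4 + ?I5 \<le> ennreal (C1 * data \<xi> f) + ennreal (C3 * data \<xi> f) + ennreal (C2 * data \<xi> f) + ennreal (C2 * data \<xi> f)"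
      by (intro add_mono 1 23 4 5)
    also have "\<dots> = ennreal ((C1 + C3 + 2 * C2) * data \<xi> f)"
      using C1(1) C2(1) C3(1) d by (simp add: ennreal_plus[symmetric] algebra_simps del: ennreal_plus)
    finally show ?thesis by (simp only: add.assoc)
  qed
  then show ?thesis using C1(1) C2(1) C3(1) by (intro exI[of _ "C1 + C3 + 2 * C2"]) auto
qed

text \<open>The two halves of Plancherel's formula act on opposite sides:
  \<open>plancherel_ge\<close> carries the differential terms on the left to the frequency side,
  \<open>plancherel_le\<close> brings the data back. The multiplier terms are inverse transforms and
  also use \<open>plancherel_le\<close>.\<close>

lemma main_estimate:
  "\<exists>C>0. \<forall>u. schwartz u \<longrightarrow>
     L2_norm_sq (mult_v (\<lambda>v. bracket v powr (\<gamma> + 2)) u)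
   + L2_norm_sq (mult_v (\<lambda>v. bracket v powr \<gamma>) (Dv_sq u))
   + L2_norm_sq (mult_v (\<lambda>v. bracket v powr \<gamma>) (Q_sq u))
   + L2_norm_sq (mult_v (\<lambda>v. bracket v powr (\<gamma> / 3)) (Dx_two_thirds u))
   + L2_norm_sq (mult_v (\<lambda>v. bracket v powr (\<gamma> / 3)) (v_cross_Dx_two_thirds u))
   \<le> ennreal C * (L2_norm_sq (landau_op lam mu F u) + L2_norm_sq u)"
proof -
  obtain C where C: "C > 0" and est: "\<And>\<xi> f. schwartz f \<Longrightarrow> \<xi> \<noteq> 0 \<Longrightarrow>
     (\<integral>\<^sup>+ v. ennreal ((bracket v powr (\<gamma> + 2) * norm (f v))\<^sup>2) \<partial>lborel)
   + (\<integral>\<^sup>+ v. ennreal ((bracket v powr \<gamma> * norm (trans_sq f v))\<^sup>2) \<partial>lborel)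
   + (\<integral>\<^sup>+ v. ennreal ((bracket v powr \<gamma> * norm (rot_sq f v))\<^sup>2) \<partial>lborel)
   + (\<integral>\<^sup>+ v. ennreal ((bracket v powr (\<gamma> / 3) * norm \<xi> powr (2 / 3) * norm (f v))\<^sup>2) \<partial>lborel)
   + (\<integral>\<^sup>+ v. ennreal ((bracket v powr (\<gamma> / 3) * norm (cross3 v \<xi>) powr (2 / 3) * norm (f v))\<^sup>2) \<partial>lborel)
   \<le> ennreal (C * data \<xi> f)" using fibre_estimate by blast
  have br [measurable]: "(\<lambda>v. bracket v powr s) \<in> borel_measurable borel" for s
    by (rule slow_measurable[OF slow_bracket_powr])
  have "L2_norm_sq (mult_v (\<lambda>v. bracket v powr (\<gamma> + 2)) u)
     + L2_norm_sq (mult_v (\<lambda>v. bracket v powr \<gamma>) (Dv_sq u))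
     + L2_norm_sq (mult_v (\<lambda>v. bracket v powr \<gamma>) (Q_sq u))
     + L2_norm_sq (mult_v (\<lambda>v. bracket v powr (\<gamma> / 3)) (Dx_two_thirds u))
     + L2_norm_sq (mult_v (\<lambda>v. bracket v powr (\<gamma> / 3)) (v_cross_Dx_two_thirds u))
     \<le> ennreal C * (L2_norm_sq (landau_op lam mu F u) + L2_norm_sq u)" (is "?L1 + ?L2 + ?L3 + ?L4 + ?L5 \<le> _") if u: "schwartz u" for u
  proof -
    define f where "f \<xi> = fourier_x u \<xi>" for \<xi>
    have sf: "schwartz (f \<xi>)" for \<xi> unfolding f_def by (rule schwartz_fourier_x[OF u])
    have su: "schwartz (Dv_sq u)" "schwartz (Q_sq u)" using u by (auto intro: schwartz_Dv_sq schwartz_Q_sq)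
    have [measurable]: "u \<in> borel_measurable borel" "Dv_sq u \<in> borel_measurable borel" "Q_sq u \<in> borel_measurable borel"
      using u su by (auto intro: schwartz_measurable)
    \<comment> \<open>Taken from the non-divergence form, where every factor is continuous.\<close>
    have lm [measurable]: "landau_op lam mu F u \<in> borel_measurable borel"
    proof -
      have c: "(\<lambda>z::phase. g (snd z)) \<in> borel_measurable borel" if "slow g" for g :: "real^3 \<Rightarrow> real"
        by (rule measurable_compose[OF _ slow_measurable[OF that]]) (simp add: borel_prod[symmetric])
      have s: "pder \<alpha> u \<in> borel_measurable borel" "pder \<alpha> (pder \<alpha> u) \<in> borel_measurable borel" "Dx j u \<in> borel_measurable borel" for \<alpha> j
        by (intro schwartz_measurable schwartz_pder schwartz_Dx u)+
      have [measurable]: "(\<lambda>z::phase. cf \<alpha> (snd z)) \<in> borel_measurable borel" "(\<lambda>z::phase. tder \<alpha> (cf \<alpha>) (snd z)) \<in> borel_measurable borel"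
        "(\<lambda>z::phase. F (snd z)) \<in> borel_measurable borel" "(\<lambda>z::phase. snd z $ j) \<in> borel_measurable borel" for \<alpha> j
        using c[OF slow1D(2)[OF slow1_cf]] c[OF slow_tder[OF slow1_cf]] c[OF slow_F]
          c[OF slow_bounded_linear[OF bounded_linear_vec_nth]] by auto
      have "landau_op lam mu F u = (\<lambda>z. (\<Sum>j\<in>UNIV. (\<i> * complex_of_real (snd z $ j)) * Dx j u z)
        - (\<Sum>\<alpha>\<in>UNIV. complex_of_real (cf \<alpha> (snd z)) * pder \<alpha> (pder \<alpha> u) z
            + complex_of_real (tder \<alpha> (cf \<alpha>) (snd z)) * pder \<alpha> u z)
        + complex_of_real (F (snd z)) * u z)"
        using landau_op_eq[OF u slow1_lam slow1_mu] by auto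
      also have "\<dots> \<in> borel_measurable borel" using s by measurable
      finally show ?thesis .
    qed
    have m1: "(\<lambda>(v, \<xi>). norm \<xi> powr (2 / 3)) \<in> borel_measurable (borel :: phase measure)"
      unfolding borel_prod[symmetric] by measurable
    have "continuous_on UNIV (\<lambda>z::phase. cross3 (fst z) (snd z))"
      by (intro continuous_on_cross continuous_intros)
    then have "(\<lambda>z::phase. cross3 (fst z) (snd z)) \<in> borel_measurable borel" by (rule borel_measurable_continuous_onI)
    then have m2: "(\<lambda>(v, \<xi>). norm (cross3 v \<xi>) powr (2 / 3)) \<in> borel_measurable (borel :: phase measure)"
      by (simp add: case_prod_unfold)
    \<comment> \<open>The five integrands are indexed by a number so that measurability and the
      exchange of integrals are proved once for all of them.\<close>
    define t where "t i \<xi> v = ennreal ((case i :: nat of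
        0 \<Rightarrow> bracket v powr (\<gamma> + 2) * norm (fourier_x u \<xi> v)
      | Suc 0 \<Rightarrow> bracket v powr \<gamma> * norm (fourier_x (Dv_sq u) \<xi> v)
      | Suc (Suc 0) \<Rightarrow> bracket v powr \<gamma> * norm (fourier_x (Q_sq u) \<xi> v)
      | Suc (Suc (Suc 0)) \<Rightarrow> bracket v powr (\<gamma> / 3) * norm \<xi> powr (2 / 3) * norm (fourier_x u \<xi> v)
      | _ \<Rightarrow> bracket v powr (\<gamma> / 3) * norm (cross3 v \<xi>) powr (2 / 3) * norm (fourier_x u \<xi> v))\<^sup>2)" for i \<xi> v
    have mc [measurable]: "(\<lambda>w. norm (cross3 (snd w) (fst w)) powr (2 / 3)) \<in> borel_measurable ((borel \<Otimes>\<^sub>M borel) :: phase measure)"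
    proof -
      have "(\<lambda>w::phase. (snd w, fst w)) \<in> borel \<Otimes>\<^sub>M borel \<rightarrow>\<^sub>M borel" unfolding borel_prod[symmetric] by measurable
      from measurable_compose[OF this m2] show ?thesis by simp
    qed
    have tm [measurable]: "(\<lambda>(\<xi>, v). t i \<xi> v) \<in> borel_measurable (borel \<Otimes>\<^sub>M borel)" for i
      unfolding t_def case_prod_unfold by (cases i; cases "i - 1"; cases "i - 2"; cases "i - 3") (simp_all split: nat.split)
    define J where "J i = (\<integral>\<^sup>+ v. (\<integral>\<^sup>+ \<xi>. t i \<xi> v \<partial>lborel) \<partial>lborel)" for i
    have Jswap: "J i = (\<integral>\<^sup>+ \<xi>. (\<integral>\<^sup>+ v. t i \<xi> v \<partial>lborel) \<partial>lborel)" for i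
      unfolding J_def using tm by (intro nn_integral_swap) (simp only: borel_prod)
    have tmv: "(\<lambda>\<xi>. \<integral>\<^sup>+ v. t i \<xi> v \<partial>lborel) \<in> borel_measurable lborel" for i
      by (rule lborel.borel_measurable_nn_integral) (use tm in \<open>simp add: borel_prod lborel_prod\<close>)
    have "fourier_const * ?L1 \<le> J 0" "fourier_const * ?L2 \<le> J 1" "fourier_const * ?L3 \<le> J 2"
      "fourier_const * ?L4 \<le> J 3" "fourier_const * ?L5 \<le> J 4"
      using L2_mult_v_le[OF u br] L2_mult_v_le[OF su(1) br] L2_mult_v_le[OF su(2) br]
        L2_fourier_mult_le[OF u br m1] L2_fourier_mult_le[OF u br m2]
      unfolding J_def t_def Dx_two_thirds_def v_cross_Dx_two_thirds_def by (simp_all add: eval_nat_numeral)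
    then have "fourier_const * (?L1 + ?L2 + ?L3 + ?L4 + ?L5) \<le> J 0 + J 1 + J 2 + J 3 + J 4"
      unfolding distrib_left by (intro add_mono)
    also have "\<dots> = (\<integral>\<^sup>+ \<xi>. (\<integral>\<^sup>+ v. t 0 \<xi> v \<partial>lborel) + (\<integral>\<^sup>+ v. t 1 \<xi> v \<partial>lborel) + (\<integral>\<^sup>+ v. t 2 \<xi> v \<partial>lborel)
        + (\<integral>\<^sup>+ v. t 3 \<xi> v \<partial>lborel) + (\<integral>\<^sup>+ v. t 4 \<xi> v \<partial>lborel) \<partial>lborel)"
      unfolding Jswap by (simp add: nn_integral_add tmv del: One_nat_def)
    also have "\<dots> \<le> (\<integral>\<^sup>+ \<xi>. ennreal (C * data \<xi> (f \<xi>)) \<partial>lborel)"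
    proof (rule nn_integral_mono_AE)
      \<comment> \<open>At \<xi> = 0 the weights degenerate because \<open>mm\<close> vanishes; a
        single frequency is a null set.\<close>
      have "AE \<xi> in lborel. \<xi> \<noteq> (0 :: real^3)" by (rule AE_lborel_singleton)
      then show "AE \<xi> in lborel. (\<integral>\<^sup>+ v. t 0 \<xi> v \<partial>lborel) + (\<integral>\<^sup>+ v. t 1 \<xi> v \<partial>lborel) + (\<integral>\<^sup>+ v. t 2 \<xi> v \<partial>lborel)
        + (\<integral>\<^sup>+ v. t 3 \<xi> v \<partial>lborel) + (\<integral>\<^sup>+ v. t 4 \<xi> v \<partial>lborel) \<le> ennreal (C * data \<xi> (f \<xi>))"
      proof eventually_elim
        fix \<xi> :: "real^3" assume "\<xi> \<noteq> 0"
        from est[OF sf this]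
        show "(\<integral>\<^sup>+ v. t 0 \<xi> v \<partial>lborel) + (\<integral>\<^sup>+ v. t 1 \<xi> v \<partial>lborel) + (\<integral>\<^sup>+ v. t 2 \<xi> v \<partial>lborel)
          + (\<integral>\<^sup>+ v. t 3 \<xi> v \<partial>lborel) + (\<integral>\<^sup>+ v. t 4 \<xi> v \<partial>lborel) \<le> ennreal (C * data \<xi> (f \<xi>))"
          unfolding t_def fourier_x_Dv_sq[OF u] fourier_x_Q_sq[OF u] f_def by (simp add: eval_nat_numeral)
      qed
    qed
    also have "\<dots> = (\<integral>\<^sup>+ \<xi>. ennreal C * ((\<integral>\<^sup>+ v. ennreal ((norm (fourier_x (landau_op lam mu F u) \<xi> v))\<^sup>2) \<partial>lborel)
        + (\<integral>\<^sup>+ v. ennreal ((norm (fourier_x u \<xi> v))\<^sup>2) \<partial>lborel)) \<partial>lborel)"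
      using C data_nonneg
      by (intro nn_integral_cong) (simp add: ennreal_mult f_def data_eq[OF sf[unfolded f_def]] fourier_x_landau_op[OF u slow1_lam slow1_mu])
    also have "\<dots> = ennreal C * ((\<integral>\<^sup>+ \<xi>. (\<integral>\<^sup>+ v. ennreal ((norm (fourier_x (landau_op lam mu F u) \<xi> v))\<^sup>2) \<partial>lborel) \<partial>lborel)
        + (\<integral>\<^sup>+ \<xi>. (\<integral>\<^sup>+ v. ennreal ((norm (fourier_x u \<xi> v))\<^sup>2) \<partial>lborel) \<partial>lborel))" 
      (is "_ = ennreal C * (?A + ?B)")
    proof -
      show ?thesis by (subst nn_integral_cmult, measurable, subst nn_integral_add) auto
    qed
    also have "\<dots> \<le> ennreal C * (fourier_const * L2_norm_sq (landau_op lam mu F u) + fourier_const * L2_norm_sq u)"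
      by (intro mult_left_mono add_mono fourier_x_L2_le lm) (auto intro: schwartz_measurable u)
    also have "\<dots> = fourier_const * (ennreal C * (L2_norm_sq (landau_op lam mu F u) + L2_norm_sq u))"
      by (simp add: distrib_left mult_ac)
    \<comment> \<open>\<open>fourier_const\<close> is neither 0 nor infinite and cancels.\<close>
    finally show ?thesis
      by (subst (asm) ennreal_mult_le_mult_iff) auto
  qed
  then show ?thesis using C by blast
qed

end

section \<open>From symbol estimates to the hypotheses of the locale\<close>

lemma smooth_differentiable: "smooth f \<Longrightarrow> f differentiable (at z)"
  unfolding smooth_def by (metis empty_subsetI list.set(1) partials.simps(1))

lemma smooth_partial_differentiable: "smooth f \<Longrightarrow> b \<in> Basis \<Longrightarrow> partial b f differentiable (at z)"
  unfolding smooth_def by (metis bot.extremum insert_subset list.set(1) list.simps(15) partials.simps)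

text \<open>Each of the three components of a field is at most <v>, and the coordinate derivatives
  of the coefficient gain <v>^(-1); the factor 3 counts the components.\<close>

lemma slow1_smooth:
  fixes a :: "real^3 \<Rightarrow> real"
  assumes a: "smooth a" and bound: "\<And>v. \<bar>a v\<bar> \<le> K * bracket v powr \<gamma>"
    and deriv: "\<And>j v. \<bar>partial (axis j 1) a v\<bar> \<le> S * bracket v powr (\<gamma> - 1)"
  shows "slow1 a" "\<bar>tder \<alpha> a v\<bar> \<le> 3 * S * bracket v powr \<gamma>"
proof -
  have d: "a differentiable (at v)" for v using a by (rule smooth_differentiable)
  show "slow1 a"
  proof (rule slow1I_tder[OF d])
    show "slow a"
      by (rule slow_real_bound[OF slow_mult[OF slow_const slow_bracket_powr] continuous_on_differentiable[OF d] bound])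
    have "continuous_on UNIV (partial (axis j 1) a)" for j
      by (intro continuous_on_differentiable smooth_partial_differentiable a) (simp add: axis_in_Basis_iff)
    then show "slow (tder (Inl j) a)" for j
      unfolding tder_Inl
      by (rule slow_real_bound[OF slow_mult[OF slow_const slow_bracket_powr] _ deriv])
  qed
  have each: "\<bar>(fld \<alpha> v \<bullet> axis j 1) * partial (axis j 1) a v\<bar> \<le> bracket v * (S * bracket v powr (\<gamma> - 1))" for j
    unfolding abs_mult
    by (intro mult_mono deriv order_trans[OF Basis_le_norm norm_fld_le]) (auto simp: axis_in_Basis_iff)
  have "bracket v * (S * bracket v powr (\<gamma> - 1)) = S * bracket v powr \<gamma>"
    using powr_add[of "bracket v" 1 "\<gamma> - 1"] by simp
  then show "\<bar>tder \<alpha> a v\<bar> \<le> 3 * S * bracket v powr \<gamma>"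
    using each[of 1] each[of 2] each[of 3]
    unfolding tder_def partial_sum_Basis[OF d, of "fld \<alpha> v"] sum_Basis_vec3 real_scaleR_def by linarith
qed

text \<open>With the next lemma, evaluates the symbol estimates at the multi-index 0 and at the unit
  multi-indices \<open>axis j 1\<close>.\<close>

lemma multi_partial_0: "multi_partial 0 f = f" and multi_order_0: "multi_order 0 = 0"
  unfolding multi_partial_def multi_order_def by simp_all

lemma multi_partial_axis: "multi_partial (axis j 1) f = partial (axis j 1) f" and multi_order_axis: "multi_order (axis j 1) = 1"
proof -
  have "j = 1 \<or> j = 2 \<or> j = 3" by (rule exhaust_3)
  then show "multi_partial (axis j 1) f = partial (axis j 1) f"
    unfolding multi_partial_def by (elim disjE) (simp_all add: axis_def)
  show "multi_order (axis j 1) = 1" unfolding multi_order_def axis_def by simp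
qed

theorem theorem1p1:
  fixes \<gamma> :: real and lam mu F :: "real^3 \<Rightarrow> real"
  assumes "-3 \<le> \<gamma>" and "\<gamma> \<le> 1"
    and "smooth lam" and "smooth mu" and "smooth F"
    and "\<And>v. lam v > 0" and "\<And>v. mu v > 0" and "\<And>v. F v > 0"
    and "\<And>\<alpha> :: nat^3. \<exists>C>0. \<forall>v.
           \<bar>multi_partial \<alpha> lam v\<bar> + \<bar>multi_partial \<alpha> mu v\<bar>
             \<le> C * bracket v powr (\<gamma> - real (multi_order \<alpha>)) \<and>
           \<bar>multi_partial \<alpha> F v\<bar> \<le> C * bracket v powr (\<gamma> + 2 - real (multi_order \<alpha>))"
    and "\<exists>c>0. \<forall>v. lam v \<ge> c * bracket v powr \<gamma> \<and> mu v \<ge> c * bracket v powr \<gamma> \<and>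
           F v \<ge> c * bracket v powr (\<gamma> + 2)"
  shows "\<exists>C::real. C > 0 \<and> (\<forall>u :: (real^3) \<times> (real^3) \<Rightarrow> complex. schwartz u \<longrightarrow>
           L2_norm_sq (mult_v (\<lambda>v. bracket v powr (\<gamma> + 2)) u)
         + L2_norm_sq (mult_v (\<lambda>v. bracket v powr \<gamma>) (Dv_sq u))
         + L2_norm_sq (mult_v (\<lambda>v. bracket v powr \<gamma>) (Q_sq u))
         + L2_norm_sq (mult_v (\<lambda>v. bracket v powr (\<gamma> / 3)) (Dx_two_thirds u))
         + L2_norm_sq (mult_v (\<lambda>v. bracket v powr (\<gamma> / 3)) (v_cross_Dx_two_thirds u))
         \<le> ennreal C * (L2_norm_sq (landau_op lam mu F u) + L2_norm_sq u))"
proof -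
  obtain c where c: "c > 0" "\<And>v. c * bracket v powr \<gamma> \<le> lam v" "\<And>v. c * bracket v powr \<gamma> \<le> mu v"
    "\<And>v. c * bracket v powr (\<gamma> + 2) \<le> F v" using assms(10) by blast
  obtain C0 where C0: "C0 > 0" "\<And>v. \<bar>lam v\<bar> + \<bar>mu v\<bar> \<le> C0 * bracket v powr \<gamma>" "\<And>v. \<bar>F v\<bar> \<le> C0 * bracket v powr (\<gamma> + 2)"
    using assms(9)[of 0] unfolding multi_partial_0 multi_order_0 by auto
  have "\<forall>j. \<exists>C>0. \<forall>v. \<bar>partial (axis j 1) lam v\<bar> + \<bar>partial (axis j 1) mu v\<bar> \<le> C * bracket v powr (\<gamma> - 1)"
  proof
    fix j :: 3
    show "\<exists>C>0. \<forall>v. \<bar>partial (axis j 1) lam v\<bar> + \<bar>partial (axis j 1) mu v\<bar> \<le> C * bracket v powr (\<gamma> - 1)"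
      using assms(9)[of "axis j 1"] unfolding multi_partial_axis multi_order_axis by auto
  qed
  then obtain C1 where C1: "\<And>j. C1 j > 0"
    "\<And>j v. \<bar>partial (axis j 1) lam v\<bar> + \<bar>partial (axis j 1) mu v\<bar> \<le> C1 j * bracket v powr (\<gamma> - 1)"
    by metis
  \<comment> \<open>The constants of the three first-order estimates depend on the direction; their
    sum serves all directions.\<close>
  define S where "S = (\<Sum>j\<in>UNIV. C1 j)"
  have S: "C1 j \<le> S" for j unfolding S_def using C1(1) by (intro member_le_sum) (auto intro: less_imp_le)
  have le_S: "C1 j * bracket v powr (\<gamma> - 1) \<le> S * bracket v powr (\<gamma> - 1)" for j v
    by (intro mult_right_mono S) simp
  have dS: "\<bar>partial (axis j 1) lam v\<bar> \<le> S * bracket v powr (\<gamma> - 1)" "\<bar>partial (axis j 1) mu v\<bar> \<le> S * bracket v powr (\<gamma> - 1)" for j v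
    using C1(2)[of j v] le_S[of j v] by linarith+
  have b: "\<bar>lam v\<bar> \<le> C0 * bracket v powr \<gamma>" "\<bar>mu v\<bar> \<le> C0 * bracket v powr \<gamma>" for v
    using C0(2)[of v] by auto
  have S0: "S > 0" using C1(1)[of 1] S[of 1] by linarith
  \<comment> \<open>\<open>C0\<close> bounds the coefficients and \<open>3 * S\<close> their field
    derivatives, by \<open>slow1_smooth\<close>; the locale asks for one constant for both.\<close>
  define K where "K = C0 + 3 * S"
  have K: "C0 \<le> K" "3 * S \<le> K" "K > 0" unfolding K_def using C0(1) S0 by auto
  have KK: "r \<le> C0 * bracket v powr s \<Longrightarrow> r \<le> K * bracket v powr s" "r \<le> 3 * S * bracket v powr s \<Longrightarrow> r \<le> K * bracket v powr s" for r s v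
    using K(1,2) by (meson mult_right_mono order_trans powr_ge_zero)+
  have "continuous_on UNIV F" by (intro continuous_on_differentiable smooth_differentiable assms(5))
  then have sF: "slow F"
    by (rule slow_real_bound[OF slow_mult[OF slow_const slow_bracket_powr] _ C0(3)])
  interpret landau_coeffs \<gamma> lam mu F c K
  proof
    fix v \<alpha>
    show "lam v \<le> K * bracket v powr \<gamma>" "mu v \<le> K * bracket v powr \<gamma>" "F v \<le> K * bracket v powr (\<gamma> + 2)"
      using b[of v] C0(3)[of v] by (auto intro!: KK(1))
    show "\<bar>tder \<alpha> lam v\<bar> \<le> K * bracket v powr \<gamma>" "\<bar>tder \<alpha> mu v\<bar> \<le> K * bracket v powr \<gamma>"
      using slow1_smooth(2)[OF assms(3) b(1) dS(1)] slow1_smooth(2)[OF assms(4) b(2) dS(2)] by (auto intro: KK(2))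
  qed (use assms(2) c K sF slow1_smooth(1)[OF assms(3) b(1) dS(1)] slow1_smooth(1)[OF assms(4) b(2) dS(2)] in auto)
  show ?thesis by (rule main_estimate)
qed

end
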